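(* Let $\sigma>0$ and $L(x,k)\in\mathcal{S}'(\mathbb{R}^{2n})$. Denote $\hat L_1(u,k)=\mathcal{F}_{x\to u}[L(x,k)]$ and assume that there exists $M>0$ such that $\operatorname{supp}\hat L_1(u,k)\subseteq[-M,M]^n\times\mathbb{R}^n$, i.e. $\hat L_1(u,k)$ has compact support in $u$ (in particular, for each $k\in\mathbb{R}^n$, $L(x,k)$ is an entire analytic function of $x$). Then the Weyl symbol of $\Phi\,L(x,\partial_x)\,\Phi^{-1}$ is $$\tilde L(x,k)=L\left(x+\frac{i\sigma^2k}{2},k\right).$$
   Context: Fourier transform: $\hat f(k)=\mathcal{F}_{x\to k}[f(x)]=\int_{\mathbb{R}^n}e^{-2\pi i k\cdot x}f(x)\,dx$, extended to tempered distributions. The operator $L=L(x,\partial_x)$ has Weyl symbol $L(x,k)$ when $Lf(x)=\int_{y,k\in\mathbb{R}^n}e^{2\pi i k(x-y)}L\left(\frac{x+y}{2},k\right)f(y)\,dy\,dk$ (integrals understood in the sense of distributions). The smoothing operator is $\Phi f=\mathcal{F}^{-1}_{k\to x}\left[e^{-\frac{\pi}{2}\sigma^2|k|^2}\hat f(k)\right]$; it is injective with inverse (on its range) the Fourier multiplier $e^{\frac{\pi}{2}\sigma^2|k|^2}$. An identity $\Phi L\Phi^{-1}=\tilde L$ means that $\tilde L(\Phi f)=\Phi(Lf)$ for every $f\in\mathcal{S}(\mathbb{R}^n)$. The symbol $\tilde L(x,k)$ is not necessarily a tempered distribution. $L(x+\frac{i\sigma^2k}{2},k)$ denotes the value at a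 complex first argument of the entire extension of $x\mapsto L(x,k)$. *)

theory Defs
  imports "HOL-Analysis.Analysis"
begin

section \<open>Smooth, Schwartz and test functions\<close>

text \<open>
  Euclidean n-space is \<^typ>\<open>real ^ 'n\<close> and phase space, with points (x, k) or (u, k), is the
  product \<^typ>\<open>(real ^ 'n) \<times> (real ^ 'n)\<close>; both belong to the class \<^class>\<open>euclidean_space\<close>.
\<close>

fun dir_derivs :: "'a::euclidean_space list \<Rightarrow> ('a \<Rightarrow> complex) \<Rightarrow> 'a \<Rightarrow> complex" where
  "dir_derivs [] f = f"
| "dir_derivs (v # vs) f = (\<lambda>x. frechet_derivative (dir_derivs vs f) (at x) v)"

text \<open>
  All iterated partial derivatives exist and are again (Frechet) differentiable, hence continuous.
\<close>
definition smooth :: "('a::euclidean_space \<Rightarrow> complex) \<Rightarrow> bool" where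
  "smooth f \<longleftrightarrow> (\<forall>vs\<in>lists Basis. \<forall>x. dir_derivs vs f differentiable (at x))"

definition schwartz :: "('a::euclidean_space \<Rightarrow> complex) \<Rightarrow> bool" where
  "schwartz f \<longleftrightarrow> smooth f \<and>
     (\<forall>vs\<in>lists Basis. \<forall>m::nat. \<exists>C. \<forall>x. (1 + norm x) ^ m * norm (dir_derivs vs f x) \<le> C)"

definition schwartz_norm :: "nat \<Rightarrow> ('a::euclidean_space \<Rightarrow> complex) \<Rightarrow> real" where
  "schwartz_norm N f =
     (SUP (vs, x) \<in> {vs \<in> lists Basis. length vs \<le> N} \<times> UNIV.
        (1 + norm x) ^ N * norm (dir_derivs vs f x))"

definition fun_support :: "('a::topological_space \<Rightarrow> complex) \<Rightarrow> 'a set" where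
  "fun_support f = closure {x. f x \<noteq> 0}"

definition test_function :: "('a::euclidean_space \<Rightarrow> complex) \<Rightarrow> bool" where
  "test_function f \<longleftrightarrow> smooth f \<and> compact (fun_support f)"

section \<open>Distributions\<close>

text \<open>
  A distribution is a functional on functions of which only the values on the relevant test space
  matter. All pairings are bilinear (no complex conjugation).
\<close>

definition linear_on_class ::
  "(('a \<Rightarrow> complex) \<Rightarrow> bool) \<Rightarrow> (('a \<Rightarrow> complex) \<Rightarrow> complex) \<Rightarrow> bool" where
  "linear_on_class P T \<longleftrightarrow>
     (\<forall>\<phi> \<psi>. P \<phi> \<longrightarrow> P \<psi> \<longrightarrow> T (\<lambda>x. \<phi> x + \<psi> x) = T \<phi> + T \<psi>) \<and>
     (\<forall>c \<phi>. P \<phi> \<longrightarrow> T (\<lambda>x. c * \<phi> x) = c * T \<phi>)"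

definition tempered :: "(('a::euclidean_space \<Rightarrow> complex) \<Rightarrow> complex) \<Rightarrow> bool" where
  "tempered T \<longleftrightarrow> linear_on_class schwartz T \<and>
     (\<exists>N C. \<forall>\<phi>. schwartz \<phi> \<longrightarrow> norm (T \<phi>) \<le> C * schwartz_norm N \<phi>)"

definition dist_support :: "(('a::euclidean_space \<Rightarrow> complex) \<Rightarrow> complex) \<Rightarrow> 'a set" where
  "dist_support T =
     - \<Union>{U. open U \<and> (\<forall>\<phi>. test_function \<phi> \<longrightarrow> fun_support \<phi> \<subseteq> U \<longrightarrow> T \<phi> = 0)}"

text \<open>
  Symbols that need not be tempered: functionals on the Schwartz functions of (x, k) whose support
  is bounded in k, continuous in the inductive limit topology (an estimate for every bound R).
  They are tempered in x and arbitrary distributions in k, so they may grow arbitrarily fast in k.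
\<close>
definition k_bounded_schwartz ::
  "real \<Rightarrow> ((real ^ 'n) \<times> (real ^ 'n) \<Rightarrow> complex) \<Rightarrow> bool" where
  "k_bounded_schwartz R \<phi> \<longleftrightarrow> schwartz \<phi> \<and> (\<forall>x k. norm k > R \<longrightarrow> \<phi> (x, k) = 0)"

definition symbol_test :: "((real ^ 'n) \<times> (real ^ 'n) \<Rightarrow> complex) \<Rightarrow> bool" where
  "symbol_test \<phi> \<longleftrightarrow> (\<exists>R. k_bounded_schwartz R \<phi>)"

definition symbol_distribution ::
  "(((real ^ 'n) \<times> (real ^ 'n) \<Rightarrow> complex) \<Rightarrow> complex) \<Rightarrow> bool" where
  "symbol_distribution A \<longleftrightarrow> linear_on_class symbol_test A \<and>
     (\<forall>R. \<exists>N C. \<forall>\<phi>. k_bounded_schwartz R \<phi> \<longrightarrow> norm (A \<phi>) \<le> C * schwartz_norm N \<phi>)"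

section \<open>Fourier transform and smoothing operator\<close>

definition fourier :: "('a::euclidean_space \<Rightarrow> complex) \<Rightarrow> 'a \<Rightarrow> complex" where
  "fourier f k = (LINT x|lborel. exp (- 2 * pi * \<i> * of_real (k \<bullet> x)) * f x)"

definition inv_fourier :: "('a::euclidean_space \<Rightarrow> complex) \<Rightarrow> 'a \<Rightarrow> complex" where
  "inv_fourier g x = (LINT k|lborel. exp (2 * pi * \<i> * of_real (k \<bullet> x)) * g k)"

definition fourier_dist ::
  "(('a::euclidean_space \<Rightarrow> complex) \<Rightarrow> complex) \<Rightarrow> ('a \<Rightarrow> complex) \<Rightarrow> complex" where
  "fourier_dist T \<phi> = T (fourier \<phi>)"

definition inv_fourier_dist ::
  "(('a::euclidean_space \<Rightarrow> complex) \<Rightarrow> complex) \<Rightarrow> ('a \<Rightarrow> complex) \<Rightarrow> complex" where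
  "inv_fourier_dist T \<phi> = T (inv_fourier \<phi>)"

text \<open>Partial Fourier transform in the first variable, by duality.\<close>
definition fourier1_dist ::
  "((('a::euclidean_space) \<times> 'b \<Rightarrow> complex) \<Rightarrow> complex) \<Rightarrow> ('a \<times> 'b \<Rightarrow> complex) \<Rightarrow> complex" where
  "fourier1_dist T \<phi> = T (\<lambda>(x, k). fourier (\<lambda>u. \<phi> (u, k)) x)"

definition gauss_mult :: "real \<Rightarrow> 'a::euclidean_space \<Rightarrow> complex" where
  "gauss_mult \<sigma> k = of_real (exp (- (pi / 2) * \<sigma>\<^sup>2 * (norm k)\<^sup>2))"

definition smoothing :: "real \<Rightarrow> ('a::euclidean_space \<Rightarrow> complex) \<Rightarrow> 'a \<Rightarrow> complex" where
  "smoothing \<sigma> f = inv_fourier (\<lambda>k. gauss_mult \<sigma> k * fourier f k)"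

definition smoothing_dist ::
  "real \<Rightarrow> (('a::euclidean_space \<Rightarrow> complex) \<Rightarrow> complex) \<Rightarrow> ('a \<Rightarrow> complex) \<Rightarrow> complex" where
  "smoothing_dist \<sigma> T =
     inv_fourier_dist (\<lambda>\<phi>. fourier_dist T (\<lambda>k. gauss_mult \<sigma> k * \<phi> k))"

section \<open>Weyl quantization\<close>

text \<open>
  Pairing the defining integral of L f with a Schwartz function \<open>\<phi>\<close> of x and substituting
  p = (x + y)/2, q = x - y shows that \<open>\<langle>L f, \<phi>\<rangle>\<close> is the pairing of the symbol with the following
  function of (p, k), which is a Schwartz function on phase space if f and \<open>\<phi>\<close> are.
\<close>
definition weyl_kernel ::
  "(real ^ 'n \<Rightarrow> complex) \<Rightarrow> (real ^ 'n \<Rightarrow> complex) \<Rightarrow> (real ^ 'n) \<times> (real ^ 'n) \<Rightarrow> complex" where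
  "weyl_kernel f \<phi> =
     (\<lambda>(p, k). LINT q|lborel. exp (2 * pi * \<i> * of_real (k \<bullet> q)) *
        f (p - (1/2) *\<^sub>R q) * \<phi> (p + (1/2) *\<^sub>R q))"

text \<open>The operator with tempered Weyl symbol L, from Schwartz functions to tempered distributions.\<close>
definition weyl_op ::
  "(((real ^ 'n) \<times> (real ^ 'n) \<Rightarrow> complex) \<Rightarrow> complex) \<Rightarrow>
   (real ^ 'n \<Rightarrow> complex) \<Rightarrow> (real ^ 'n \<Rightarrow> complex) \<Rightarrow> complex" where
  "weyl_op L f \<phi> = L (weyl_kernel f \<phi>)"

text \<open>
  For a symbol A that is not tempered, the kernel above is in general not an admissible test
  function, because its support need not be bounded in k. The integral over k is then
  understood as an improper one: with a smooth cutoff \<open>\<eta>(k/R)\<close>, R tending to infinity, where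
  the limit must exist for every pairing and must not depend on \<open>\<eta>\<close>. The predicate says that the
  operator with Weyl symbol A maps g to the tempered distribution T. For tempered A and Schwartz
  g it holds exactly if T agrees with \<open>weyl_op A g\<close> on Schwartz functions.
\<close>
definition weyl_maps ::
  "(((real ^ 'n) \<times> (real ^ 'n) \<Rightarrow> complex) \<Rightarrow> complex) \<Rightarrow>
   (real ^ 'n \<Rightarrow> complex) \<Rightarrow> ((real ^ 'n \<Rightarrow> complex) \<Rightarrow> complex) \<Rightarrow> bool" where
  "weyl_maps A g T \<longleftrightarrow> tempered T \<and>
     (\<forall>\<eta> \<phi>. test_function \<eta> \<longrightarrow> (\<forall>\<^sub>F k in nhds 0. \<eta> k = 1) \<longrightarrow> schwartz \<phi> \<longrightarrow>
        ((\<lambda>R. A (\<lambda>(x, k). \<eta> (k /\<^sub>R R) * weyl_kernel g \<phi> (x, k))) \<longlongrightarrow> T \<phi>) at_top)"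

section \<open>Entire extension in x\<close>

text \<open>Holomorphy on all of complex n-space: the derivative exists and is complex linear.\<close>
definition entire :: "(complex ^ 'n \<Rightarrow> complex) \<Rightarrow> bool" where
  "entire F \<longleftrightarrow> (\<forall>z. \<exists>D. (F has_derivative D) (at z) \<and> (\<forall>c v. D (c *s v) = c * D v))"

definition cvec :: "real ^ 'n \<Rightarrow> complex ^ 'n" where
  "cvec x = (\<chi> i. of_real (x $ i))"

text \<open>
  L(x, k) is a distribution in k, so its entire extension in x is an entire function E of z with
  values in the tempered distributions in k; \<open>E z \<psi>\<close> stands for the integral of
  \<open>L(z, k) \<psi>(k)\<close> over k. The integral identity says that E restricted to real arguments is L.
\<close>
definition entire_extension ::
  "(((real ^ 'n) \<times> (real ^ 'n) \<Rightarrow> complex) \<Rightarrow> complex) \<Rightarrow>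
   (complex ^ 'n \<Rightarrow> (real ^ 'n \<Rightarrow> complex) \<Rightarrow> complex) \<Rightarrow> bool" where
  "entire_extension L E \<longleftrightarrow>
     (\<forall>z. tempered (E z)) \<and>
     (\<forall>\<psi>. schwartz \<psi> \<longrightarrow> entire (\<lambda>z. E z \<psi>)) \<and>
     (\<forall>\<phi> \<psi>. schwartz \<phi> \<longrightarrow> schwartz \<psi> \<longrightarrow>
        integrable lborel (\<lambda>x. E (cvec x) \<psi> * \<phi> x) \<and>
        L (\<lambda>(x, k). \<phi> x * \<psi> k) = (LINT x|lborel. E (cvec x) \<psi> * \<phi> x))"

text \<open>
  \<open>E (\<zeta> x k)\<close> is evaluated at an argument depending on k although E has values in distributions in
  k. As usual for pullbacks of distributions, this is defined by regularization: convolution in k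
  with \<open>\<rho>\<^sub>\<epsilon>(k) = \<epsilon>\<^sup>-\<^sup>n \<rho>(k/\<epsilon>)\<close> turns E z into the honest function \<open>k \<mapsto> E z (\<rho>\<^sub>\<epsilon>(k - \<cdot>))\<close> of z and k,
  entire in z for each k; this is evaluated at \<open>z = \<zeta> x k\<close>, and the result must converge to the
  distribution A as \<open>\<epsilon>\<close> tends to 0, for every \<open>\<rho>\<close>.
\<close>
definition mollifier :: "(real ^ 'n \<Rightarrow> complex) \<Rightarrow> real \<Rightarrow> real ^ 'n \<Rightarrow> complex" where
  "mollifier \<rho> \<epsilon> v = \<rho> (v /\<^sub>R \<epsilon>) / of_real (\<epsilon> ^ CARD('n))"

definition symbol_of_extension_at ::
  "(complex ^ 'n \<Rightarrow> (real ^ 'n \<Rightarrow> complex) \<Rightarrow> complex) \<Rightarrow>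
   (real ^ 'n \<Rightarrow> real ^ 'n \<Rightarrow> complex ^ 'n) \<Rightarrow>
   (((real ^ 'n) \<times> (real ^ 'n) \<Rightarrow> complex) \<Rightarrow> complex) \<Rightarrow> bool" where
  "symbol_of_extension_at E \<zeta> A \<longleftrightarrow> symbol_distribution A \<and>
     (\<forall>\<rho> \<phi>. test_function \<rho> \<longrightarrow> (LINT v|lborel. \<rho> v) = 1 \<longrightarrow> symbol_test \<phi> \<longrightarrow>
        (\<forall>\<epsilon>>0. integrable lborel
           (\<lambda>(x, k). E (\<zeta> x k) (\<lambda>l. mollifier \<rho> \<epsilon> (k - l)) * \<phi> (x, k))) \<and>
        ((\<lambda>\<epsilon>. LINT (x, k)|lborel. E (\<zeta> x k) (\<lambda>l. mollifier \<rho> \<epsilon> (k - l)) * \<phi> (x, k))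
           \<longlongrightarrow> A \<phi>) (at_right 0))"

end

theory Submission
  imports Defs "HOL-Probability.Probability" "HOL-Complex_Analysis.Complex_Analysis"
begin

text \<open>
  The proof works on the Fourier side of x. Let \<open>Lhat\<close> be the Fourier transform of L in its first
  variable; by inversion the pairing of L with \<open>\<phi>\<close> is the pairing of \<open>Lhat\<close> with the inverse transform of
  \<open>\<phi>\<close> in x. The support of \<open>Lhat\<close> lies over a ball of the u-space, so multiplying a test function by a
  smooth cutoff \<open>chi u\<close> does not change the pairing (\<open>tempered_cutoff_fst\<close>). Hence \<open>Lhat\<close> may be paired
  with \<open>chi u * exp (2 \<pi> i z \<bullet> u) * \<psi> k\<close> for every complex z, and this is the value \<open>E z \<psi>\<close> of the entire
  extension. At the point \<open>z = x + i \<sigma>\<^sup>2 k / 2\<close> the exponential is \<open>exp (2 \<pi> i x \<bullet> u) * exp (- \<pi> \<sigma>\<^sup>2 k \<bullet> u)\<close>: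
  moving x to the complex point multiplies \<open>Lhat\<close> by the real weight \<open>exp (- \<pi> \<sigma>\<^sup>2 k \<bullet> u)\<close>.

  The effect of this weight on the Weyl operator is seen from the transform in p of the kernel
  \<open>weyl_kernel g \<phi>\<close>, which is the product of \<open>fourier g\<close> at \<open>k - u/2\<close> and \<open>inv_fourier \<phi>\<close> at \<open>k + u/2\<close>
  (\<open>partial_inv_fourier_weyl_kernel\<close>). If g is the smoothing of f, the first factor contains the
  Gaussian at \<open>k - u/2\<close>, and since \<open>|k - u/2|\<^sup>2 + 2 k \<bullet> u = |k + u/2|\<^sup>2\<close> the weight moves this Gaussian to
  the second factor (\<open>weyl_kernel_smoothing\<close>). What remains is the transform of the kernel of f and the
  smoothed \<open>\<phi>\<close>, so the new operator maps the smoothing of f to the smoothing of L f. The weighted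
  kernel decays, so that the cutoff \<open>\<eta> (k / R)\<close> can be removed (\<open>tempered_cutoff_tendsto\<close>).

  The regularization that defines the symbol at the complex point requires interchanging \<open>Lhat\<close> with
  integrals over parameters. Two facts do this: for a Schwartz function H of (w, x) and a tempered T
  the function \<open>w \<mapsto> T (H (w, \<cdot>))\<close> is again Schwartz, with derivatives computed under T
  (\<open>schwartz_tempered_slice\<close>), and its integral is T applied to the integral of H over w
  (\<open>tempered_integral\<close>). Statements about an arbitrary entire extension and an arbitrary symbol reduce to
  the explicit ones because both are unique: an entire function of several variables that vanishes at
  all real points is zero (\<open>entire_extension_unique\<close>), and a limit is unique
  (\<open>symbol_of_extension_at_unique\<close>).

  The analysis below this rests on one predicate, \<open>deriv_bound\<close>, which bounds all derivatives up to a
  given order by a weight function; its closure rules yield everything about Schwartz functions,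
  including Fourier inversion, the continuity of the operators involved and the commutation of
  partial derivatives.
\<close>

section \<open>Functions with bounded derivatives\<close>

definition pdiff :: "'a::euclidean_space \<Rightarrow> ('a \<Rightarrow> complex) \<Rightarrow> 'a \<Rightarrow> complex" where
  "pdiff b f x = frechet_derivative f (at x) b"

text \<open>
  All derivatives of order at most k exist, in the sense of iterated Frechet derivatives, and are
  bounded by the weight w. The recursion takes the innermost derivative first, so that closure rules
  follow from the first-order rules by induction on k.
\<close>
fun deriv_bound :: "nat \<Rightarrow> ('a::euclidean_space \<Rightarrow> real) \<Rightarrow> ('a \<Rightarrow> complex) \<Rightarrow> bool" where
  "deriv_bound 0 w f \<longleftrightarrow> (\<forall>x. norm (f x) \<le> w x)"
| "deriv_bound (Suc k) w f \<longleftrightarrow> (\<forall>x. norm (f x) \<le> w x \<and> f differentiable (at x)) \<and>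
     (\<forall>b\<in>Basis. deriv_bound k w (pdiff b f))"

abbreviation decay :: "real \<Rightarrow> nat \<Rightarrow> 'a::real_normed_vector \<Rightarrow> real" where
  "decay C m \<equiv> \<lambda>x. C / (1 + norm x) ^ m"

lemma pdiff_eqI: "(f has_derivative D) (at x) \<Longrightarrow> pdiff b f x = D b"
  using frechet_derivative_at[of f D x] by (simp add: pdiff_def)

lemma pdiff_eqI': "(\<And>x. (f has_derivative D x) (at x)) \<Longrightarrow> pdiff b f = (\<lambda>x. D x b)"
  by (rule ext, rule pdiff_eqI)

lemma has_derivative_pdiff:
  assumes "f differentiable (at x)"
  shows "(f has_derivative (\<lambda>h. \<Sum>b\<in>Basis. (h \<bullet> b) *\<^sub>R pdiff b f x)) (at x)"
proof -
  have d: "(f has_derivative frechet_derivative f (at x)) (at x)"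
    using assms by (simp add: frechet_derivative_works)
  then have lin: "linear (frechet_derivative f (at x))"
    using has_derivative_linear by blast
  have "frechet_derivative f (at x) h = (\<Sum>b\<in>Basis. (h \<bullet> b) *\<^sub>R pdiff b f x)" for h
    unfolding pdiff_def
    by (subst (1) euclidean_representation[of h, symmetric]) (simp add: linear_sum[OF lin] linear_scale[OF lin])
  then show ?thesis by (intro has_derivative_eq_rhs[OF d] ext)
qed

lemma deriv_bound_norm: "deriv_bound k w f \<Longrightarrow> norm (f x) \<le> w x"
  by (cases k) auto

lemma deriv_bound_nonneg: "deriv_bound k w f \<Longrightarrow> 0 \<le> w x"
  using deriv_bound_norm[of k w f x] norm_ge_zero order_trans by blast

lemma deriv_bound_mono: "deriv_bound k v f \<Longrightarrow> (\<And>x. v x \<le> w x) \<Longrightarrow> deriv_bound k w f"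
  by (induction k arbitrary: f) (auto intro: order_trans)

lemma deriv_bound_le: "deriv_bound k w f \<Longrightarrow> j \<le> k \<Longrightarrow> deriv_bound j w f"
proof (induction k arbitrary: f j)
  case (Suc k)
  then show ?case by (cases j) auto
qed auto

lemma deriv_bound_zero: "(\<And>x. 0 \<le> w x) \<Longrightarrow> deriv_bound k w (\<lambda>_. 0)"
proof (induction k)
  case (Suc k)
  have "pdiff b (\<lambda>_. 0) = (\<lambda>_::'a. 0)" for b :: 'a
    by (rule pdiff_eqI') simp
  with Suc show ?case by simp
qed auto

lemma deriv_bound_const: "norm c \<le> K \<Longrightarrow> deriv_bound k (\<lambda>_. K) (\<lambda>_. c)"
proof (cases k)
  case (Suc k)
  assume "norm c \<le> K"
  moreover have "pdiff b (\<lambda>_. c) = (\<lambda>_::'a. 0)" for b :: 'a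
    by (rule pdiff_eqI') simp
  moreover have "0 \<le> K" using \<open>norm c \<le> K\<close> norm_ge_zero order_trans by blast
  ultimately show ?thesis using Suc by (simp add: deriv_bound_zero)
qed auto

lemma pdiff_add:
  assumes "f differentiable (at x)" "g differentiable (at x)"
  shows "pdiff b (\<lambda>x. f x + g x) x = pdiff b f x + pdiff b g x"
proof -
  have d: "(f has_derivative frechet_derivative f (at x)) (at x)"
    "(g has_derivative frechet_derivative g (at x)) (at x)"
    using assms by (simp_all add: frechet_derivative_works)
  show ?thesis by (subst pdiff_eqI[OF has_derivative_add[OF d(1,2)]]) (simp add: pdiff_def)
qed

lemma pdiff_mult:
  assumes "f differentiable (at x)" "g differentiable (at x)"
  shows "pdiff b (\<lambda>x. f x * g x) x = f x * pdiff b g x + pdiff b f x * g x"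
proof -
  have d: "(f has_derivative frechet_derivative f (at x)) (at x)"
    "(g has_derivative frechet_derivative g (at x)) (at x)"
    using assms by (simp_all add: frechet_derivative_works)
  show ?thesis by (subst pdiff_eqI[OF has_derivative_mult[OF d(1,2)]]) (simp add: pdiff_def)
qed

lemma pdiff_cmult:
  assumes "f differentiable (at x)"
  shows "pdiff b (\<lambda>x. c * f x) x = c * pdiff b f x"
proof -
  have d: "(f has_derivative frechet_derivative f (at x)) (at x)"
    using assms by (simp add: frechet_derivative_works)
  show ?thesis by (subst pdiff_eqI[OF has_derivative_mult_right[OF d]]) (simp add: pdiff_def)
qed

lemma deriv_bound_add:
  "deriv_bound k v f \<Longrightarrow> deriv_bound k w g \<Longrightarrow> deriv_bound k (\<lambda>x. v x + w x) (\<lambda>x. f x + g x)"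
proof (induction k arbitrary: f g)
  case 0
  then show ?case by (simp add: norm_triangle_mono)
next
  case (Suc k)
  have "pdiff b (\<lambda>x. f x + g x) = (\<lambda>x. pdiff b f x + pdiff b g x)" for b
    using Suc.prems by (intro ext pdiff_add) auto
  with Suc show ?case by (auto simp: norm_triangle_mono)
qed

lemma deriv_bound_cmult:
  "deriv_bound k w f \<Longrightarrow> deriv_bound k (\<lambda>x. norm c * w x) (\<lambda>x. c * f x)"
proof (induction k arbitrary: f)
  case 0
  then show ?case by (simp add: norm_mult mult_left_mono)
next
  case (Suc k)
  have "pdiff b (\<lambda>x. c * f x) = (\<lambda>x. c * pdiff b f x)" for b
    using Suc.prems by (intro ext pdiff_cmult) auto
  with Suc show ?case by (auto simp: norm_mult mult_left_mono)
qed

lemma deriv_bound_diff: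
  assumes "deriv_bound k v f" "deriv_bound k w g"
  shows "deriv_bound k (\<lambda>x. v x + w x) (\<lambda>x. f x - g x)"
  using deriv_bound_add[OF assms(1) deriv_bound_cmult[OF assms(2), of "-1"]] by simp

lemma deriv_bound_sum:
  assumes "finite I" "\<And>i. i \<in> I \<Longrightarrow> deriv_bound k (w i) (f i)"
  shows "deriv_bound k (\<lambda>x. \<Sum>i\<in>I. w i x) (\<lambda>x. \<Sum>i\<in>I. f i x)"
  using assms by (induction I rule: finite_induct) (auto intro: deriv_bound_zero deriv_bound_add)

text \<open>
  Leibniz rule: each differentiation at most doubles the number of terms, which accounts for the
  factor \<open>2 ^ k\<close>.
\<close>
lemma deriv_bound_mult:
  "deriv_bound k v f \<Longrightarrow> deriv_bound k w g \<Longrightarrow> deriv_bound k (\<lambda>x. 2 ^ k * v x * w x) (\<lambda>x. f x * g x)"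
proof (induction k arbitrary: f g)
  case 0
  then show ?case by (auto simp: norm_mult intro!: mult_mono intro: order_trans[OF norm_ge_zero])
next
  case (Suc k)
  have *: "pdiff b (\<lambda>x. f x * g x) = (\<lambda>x. f x * pdiff b g x + pdiff b f x * g x)" for b
    using Suc.prems by (intro ext pdiff_mult) auto
  have v: "0 \<le> v x" and w: "0 \<le> w x" for x
    using Suc.prems deriv_bound_nonneg by blast+
  have "deriv_bound k (\<lambda>x. 2 ^ k * v x * w x + 2 ^ k * v x * w x) (pdiff b (\<lambda>x. f x * g x))" if "b \<in> Basis" for b
    unfolding * using that Suc.prems by (intro deriv_bound_add Suc.IH)
      (auto intro: deriv_bound_le[of "Suc k"])
  moreover have "norm (f x * g x) \<le> 2 ^ Suc k * v x * w x" for x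
  proof -
    have "norm (f x * g x) \<le> 1 * (v x * w x)"
      using Suc.prems v w by (auto simp: norm_mult intro!: mult_mono)
    also have "\<dots> \<le> 2 ^ Suc k * (v x * w x)"
      using v[of x] w[of x] by (intro mult_right_mono one_le_power) auto
    finally show ?thesis by (simp add: mult.assoc)
  qed
  ultimately show ?case using Suc.prems by (auto simp: algebra_simps)
qed

text \<open>
  Chain rule for an affine map g, whose derivative is the same linear map A at every point. A partial
  derivative of the composition is a combination of partial derivatives of f with the coefficients
  \<open>A b \<bullet> c\<close>; their absolute sum K enters once for each order.
\<close>
lemma deriv_bound_pullback:
  fixes g :: "'a::euclidean_space \<Rightarrow> 'b::euclidean_space"
  assumes g: "\<And>x. (g has_derivative A) (at x)"
    and K: "1 \<le> K" "\<And>b. b \<in> Basis \<Longrightarrow> (\<Sum>c\<in>Basis. \<bar>A b \<bullet> c\<bar>) \<le> K"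
  shows "deriv_bound k w f \<Longrightarrow> deriv_bound k (\<lambda>x. K ^ k * w (g x)) (\<lambda>x. f (g x))"
proof (induction k arbitrary: f)
  case 0
  then show ?case by auto
next
  case (Suc k)
  have w: "0 \<le> w x" for x using Suc.prems deriv_bound_nonneg by blast
  have fg: "((\<lambda>x. f (g x)) has_derivative (\<lambda>h. \<Sum>c\<in>Basis. (A h \<bullet> c) *\<^sub>R pdiff c f (g x))) (at x)" for x
    using has_derivative_compose[OF g has_derivative_pdiff, of f x] Suc.prems by simp
  have *: "pdiff b (\<lambda>x. f (g x)) = (\<lambda>x. \<Sum>c\<in>Basis. of_real (A b \<bullet> c) * pdiff c f (g x))" for b
    by (subst pdiff_eqI'[OF fg]) (simp add: scaleR_conv_of_real)
  have "deriv_bound k (\<lambda>x. K ^ Suc k * w (g x)) (pdiff b (\<lambda>x. f (g x)))" if b: "b \<in> Basis" for b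
  proof -
    have "deriv_bound k (\<lambda>x. \<Sum>c\<in>Basis. norm (complex_of_real (A b \<bullet> c)) * (K ^ k * w (g x))) (pdiff b (\<lambda>x. f (g x)))"
      unfolding * using Suc.prems by (intro deriv_bound_sum deriv_bound_cmult Suc.IH) auto
    then show ?thesis
    proof (rule deriv_bound_mono)
      fix x
      have "(\<Sum>c\<in>Basis. norm (complex_of_real (A b \<bullet> c)) * (K ^ k * w (g x))) =
        (\<Sum>c\<in>Basis. \<bar>A b \<bullet> c\<bar>) * (K ^ k * w (g x))" by (simp add: sum_distrib_right)
      also have "\<dots> \<le> K * (K ^ k * w (g x))"
        using w K b by (intro mult_right_mono) auto
      finally show "(\<Sum>c\<in>Basis. norm (complex_of_real (A b \<bullet> c)) * (K ^ k * w (g x))) \<le> K ^ Suc k * w (g x)"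
        by simp
    qed
  qed
  moreover have "norm (f (g x)) \<le> K ^ Suc k * w (g x)" for x
  proof -
    have "norm (f (g x)) \<le> 1 * w (g x)" using Suc.prems by simp
    also have "\<dots> \<le> K ^ Suc k * w (g x)" using w K by (intro mult_right_mono one_le_power) auto
    finally show ?thesis .
  qed
  moreover have "(\<lambda>x. f (g x)) differentiable (at x)" for x
    using fg differentiable_def by blast
  ultimately show ?case by simp
qed

lemma pullback_const_exists:
  fixes A :: "'a::euclidean_space \<Rightarrow> 'b::euclidean_space"
  obtains K where "1 \<le> K" "\<And>b. b \<in> Basis \<Longrightarrow> (\<Sum>c\<in>Basis. \<bar>A b \<bullet> c\<bar>) \<le> K"
proof
  let ?K = "1 + (\<Sum>b\<in>Basis. \<Sum>c\<in>Basis. \<bar>A b \<bullet> c\<bar>)"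
  show "1 \<le> ?K" by (simp add: sum_nonneg)
  show "(\<Sum>c\<in>Basis. \<bar>A b \<bullet> c\<bar>) \<le> ?K" if "b \<in> Basis" for b
    using member_le_sum[OF that, of "\<lambda>b. \<Sum>c\<in>Basis. \<bar>A b \<bullet> c\<bar>"] by (simp add: sum_nonneg)
qed

lemma sum_abs_Basis_le:
  fixes i :: "'a::euclidean_space"
  assumes "i = 0 \<or> i \<in> Basis" shows "(\<Sum>c\<in>Basis. \<bar>i \<bullet> c\<bar>) \<le> 1"
  using assms by (auto simp: inner_Basis if_distrib cong: if_cong)

lemma deriv_bound_fst:
  assumes "deriv_bound k w f"
  shows "deriv_bound k (\<lambda>z. w (fst z)) (\<lambda>z::'a::euclidean_space \<times> 'b::euclidean_space. f (fst z))"
proof -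
  have d: "(fst has_derivative fst) (at z)" for z :: "'a \<times> 'b" by (auto intro!: derivative_eq_intros)
  have K: "(\<Sum>c\<in>Basis. \<bar>fst b \<bullet> c\<bar>) \<le> 1" if "b \<in> Basis" for b :: "'a \<times> 'b"
    using that by (intro sum_abs_Basis_le) (auto simp: Basis_prod_def)
  show ?thesis using deriv_bound_pullback[OF d order_refl K assms] by simp
qed

lemma deriv_bound_snd:
  assumes "deriv_bound k w f"
  shows "deriv_bound k (\<lambda>z. w (snd z)) (\<lambda>z::'a::euclidean_space \<times> 'b::euclidean_space. f (snd z))"
proof -
  have d: "(snd has_derivative snd) (at z)" for z :: "'a \<times> 'b" by (auto intro!: derivative_eq_intros)
  have K: "(\<Sum>c\<in>Basis. \<bar>snd b \<bullet> c\<bar>) \<le> 1" if "b \<in> Basis" for b :: "'a \<times> 'b"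
    using that by (intro sum_abs_Basis_le) (auto simp: Basis_prod_def)
  show ?thesis using deriv_bound_pullback[OF d order_refl K assms] by simp
qed

lemma deriv_bound_linear:
  fixes A :: "'a::euclidean_space \<Rightarrow> complex"
  assumes "linear A" and K: "\<And>x. norm (A x) \<le> K * norm x"
  shows "deriv_bound k (\<lambda>x. K * (1 + norm x)) A"
proof -
  have K0: "0 \<le> K"
  proof -
    obtain b :: 'a where "b \<in> Basis" using nonempty_Basis by blast
    then show ?thesis using K[of b] norm_ge_zero[of "A b"] by (simp del: norm_ge_zero)
  qed
  have d: "(A has_derivative A) (at x)" for x
    using assms(1) by (simp add: linear_imp_has_derivative)
  have *: "pdiff b A = (\<lambda>_. A b)" for b by (rule pdiff_eqI'[OF d])
  have le: "norm (A x) \<le> K * (1 + norm x)" for x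
    using K[of x] K0 by (simp add: algebra_simps)
  have "deriv_bound j (\<lambda>x. K * (1 + norm x)) (pdiff b A)" if "b \<in> Basis" for j b
    unfolding *
  proof (rule deriv_bound_mono[OF deriv_bound_const[OF order_refl]])
    fix x :: 'a
    have "norm (A b) \<le> K * 1" using K[of b] that by simp
    also have "\<dots> \<le> K * (1 + norm x)" using K0 by (intro mult_left_mono) auto
    finally show "norm (A b) \<le> K * (1 + norm x)" .
  qed
  moreover have "A differentiable (at x)" for x using d differentiable_def by blast
  ultimately show ?thesis using le by (cases k) auto
qed

lemma deriv_bound_exp:
  fixes A :: "'a::euclidean_space \<Rightarrow> complex"
  assumes "linear A" and K: "1 \<le> K" "\<And>b. b \<in> Basis \<Longrightarrow> norm (A b) \<le> K"
  shows "deriv_bound k (\<lambda>x. K ^ k * exp (Re (A x))) (\<lambda>x. exp (A x))"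
proof (induction k)
  case 0
  then show ?case by simp
next
  case (Suc k)
  have d: "((\<lambda>x. exp (A x)) has_derivative (\<lambda>h. A h * exp (A x))) (at x)" for x
    using has_derivative_compose[OF linear_imp_has_derivative[OF assms(1)]
        DERIV_exp[unfolded has_field_derivative_def]]
    by (simp add: mult.commute)
  have *: "pdiff b (\<lambda>x. exp (A x)) = (\<lambda>x. A b * exp (A x))" for b by (rule pdiff_eqI'[OF d])
  have "deriv_bound k (\<lambda>x. K ^ Suc k * exp (Re (A x))) (pdiff b (\<lambda>x. exp (A x)))" if "b \<in> Basis" for b
    unfolding * using deriv_bound_cmult[OF Suc, of "A b"]
    by (rule deriv_bound_mono) (use K that in \<open>auto intro!: mult_right_mono\<close>)
  moreover have "exp (Re (A x)) \<le> K ^ Suc k * exp (Re (A x))" for x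
    using K by (simp add: mult_le_cancel_right1 del: power_Suc)
  ultimately show ?case using d by (auto simp: differentiable_def)
qed

section \<open>Relation to iterated derivatives\<close>

lemma dir_derivs_snoc: "dir_derivs (vs @ [b]) f = dir_derivs vs (pdiff b f)"
  by (induction vs) (auto simp: pdiff_def)

lemma deriv_bound_iff:
  "deriv_bound k w f \<longleftrightarrow> (\<forall>vs\<in>lists Basis.
     (length vs \<le> k \<longrightarrow> (\<forall>x. norm (dir_derivs vs f x) \<le> w x)) \<and>
     (length vs < k \<longrightarrow> (\<forall>x. dir_derivs vs f differentiable (at x))))"
proof (induction k arbitrary: f)
  case 0
  show ?case by auto
next
  case (Suc k)
  have all: "(\<forall>vs\<in>lists Basis. P vs) \<longleftrightarrow> P [] \<and> (\<forall>b\<in>Basis. \<forall>vs\<in>lists Basis. P (vs @ [b]))"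
    for P :: "'a list \<Rightarrow> bool"
  proof (rule iffI)
    assume *: "P [] \<and> (\<forall>b\<in>Basis. \<forall>vs\<in>lists Basis. P (vs @ [b]))"
    have "P vs" if "vs \<in> lists Basis" for vs
      using * that by (cases vs rule: rev_cases) auto
    then show "\<forall>vs\<in>lists Basis. P vs" by blast
  next
    assume "\<forall>vs\<in>lists Basis. P vs"
    then show "P [] \<and> (\<forall>b\<in>Basis. \<forall>vs\<in>lists Basis. P (vs @ [b]))" by auto
  qed
  show ?case
    by (subst all) (auto simp: Suc.IH dir_derivs_snoc)
qed

lemma finite_dir_lists: "finite {vs \<in> lists (Basis::'a::euclidean_space set). length vs \<le> k}"
  using finite_lists_length_le[of "Basis::'a set" k] by (simp add: lists_eq_set)

lemma smooth_deriv_bound: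
  assumes "smooth f"
  shows "deriv_bound k (\<lambda>x. \<Sum>vs\<in>{vs \<in> lists Basis. length vs \<le> k}. norm (dir_derivs vs f x)) f"
  unfolding deriv_bound_iff using assms finite_dir_lists
  by (auto simp: smooth_def intro!: member_le_sum)

lemma smoothI: "(\<And>k. \<exists>w. deriv_bound k w f) \<Longrightarrow> smooth f"
  unfolding smooth_def
proof (intro ballI allI)
  fix vs x assume *: "\<And>k. \<exists>w. deriv_bound k w f" and vs: "vs \<in> lists (Basis::'a set)"
  obtain w where "deriv_bound (Suc (length vs)) w f" using * by blast
  then show "dir_derivs vs f differentiable (at x)"
    using vs unfolding deriv_bound_iff by auto
qed

lemma smooth_differentiable: "smooth f \<Longrightarrow> f differentiable (at x)"
  unfolding smooth_def by (metis dir_derivs.simps(1) lists.Nil)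

lemma smooth_pdiff: "smooth f \<Longrightarrow> b \<in> Basis \<Longrightarrow> smooth (pdiff b f)"
  unfolding smooth_def by (metis dir_derivs_snoc append_in_lists_conv lists.Cons lists.Nil)

lemma smooth_continuous: "smooth f \<Longrightarrow> continuous_on S f"
  by (meson continuous_at_imp_continuous_on differentiable_imp_continuous_within smooth_differentiable)

lemma smooth_measurable [measurable_dest]: "smooth f \<Longrightarrow> f \<in> borel_measurable borel"
  by (simp add: borel_measurable_continuous_onI smooth_continuous)

lemma smooth_mult: "smooth f \<Longrightarrow> smooth g \<Longrightarrow> smooth (\<lambda>x. f x * g x)"
  by (rule smoothI) (blast intro: deriv_bound_mult smooth_deriv_bound)

lemma smooth_add: "smooth f \<Longrightarrow> smooth g \<Longrightarrow> smooth (\<lambda>x. f x + g x)"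
  by (rule smoothI) (blast intro: deriv_bound_add smooth_deriv_bound)

lemma smooth_cmult: "smooth f \<Longrightarrow> smooth (\<lambda>x. c * f x)"
  by (rule smoothI) (blast intro: deriv_bound_cmult smooth_deriv_bound)

lemma smooth_const: "smooth (\<lambda>_. c)"
  by (rule smoothI) (blast intro: deriv_bound_const)

lemma smooth_diff: "smooth f \<Longrightarrow> smooth g \<Longrightarrow> smooth (\<lambda>x. f x - g x)"
  by (rule smoothI) (blast intro: deriv_bound_diff smooth_deriv_bound)

lemma smooth_sum: "finite I \<Longrightarrow> (\<And>i. i \<in> I \<Longrightarrow> smooth (f i)) \<Longrightarrow> smooth (\<lambda>x. \<Sum>i\<in>I. f i x)"
  by (induction I rule: finite_induct) (auto intro: smooth_const smooth_add)

lemma smooth_pullback: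
  assumes "smooth f" "\<And>x. (g has_derivative A) (at x)"
  shows "smooth (\<lambda>x. f (g x))"
proof (rule smoothI)
  fix k
  obtain K where "1 \<le> K" "\<And>b. b \<in> Basis \<Longrightarrow> (\<Sum>c\<in>Basis. \<bar>A b \<bullet> c\<bar>) \<le> K"
    using pullback_const_exists[of A] by blast
  from deriv_bound_pullback[OF assms(2) this smooth_deriv_bound[OF assms(1)]]
  show "\<exists>w. deriv_bound k w (\<lambda>x. f (g x))" by blast
qed

lemma smooth_linear:
  fixes A :: "'a::euclidean_space \<Rightarrow> complex"
  assumes "linear A" shows "smooth A"
proof -
  obtain K where "\<And>x. norm (A x) \<le> K * norm x"
    using linear_bounded[OF assms] by (auto simp: mult.commute)
  then show ?thesis using deriv_bound_linear[OF assms] by (blast intro: smoothI)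
qed

section \<open>Schwartz functions\<close>

lemma schwartz_iff: "schwartz f \<longleftrightarrow> (\<forall>k m. \<exists>C. deriv_bound k (decay C m) f)"
proof
  assume f: "schwartz f"
  show "\<forall>k m. \<exists>C. deriv_bound k (decay C m) f"
  proof (intro allI)
    fix k m
    have "\<forall>vs. \<exists>C. vs \<in> lists Basis \<longrightarrow> (\<forall>x. (1 + norm x) ^ m * norm (dir_derivs vs f x) \<le> C)"
      using f unfolding schwartz_def by blast
    from choice[OF this] obtain C where C: "(1 + norm x) ^ m * norm (dir_derivs vs f x) \<le> C vs"
      if "vs \<in> lists Basis" for vs x by blast
    let ?S = "{vs \<in> lists (Basis::'a set). length vs \<le> k}"
    have "C vs \<le> (\<Sum>vs\<in>?S. \<bar>C vs\<bar>)" if "vs \<in> ?S" for vs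
      by (rule order_trans[OF abs_ge_self member_le_sum[OF that, of "\<lambda>vs. \<bar>C vs\<bar>"]])
        (use finite_dir_lists[of k] in auto)
    then have "(1 + norm x) ^ m * norm (dir_derivs vs f x) \<le> (\<Sum>vs\<in>?S. \<bar>C vs\<bar>)" if "vs \<in> ?S" for vs x
      using that C[of vs x] order_trans by fastforce
    then have "norm (dir_derivs vs f x) \<le> (\<Sum>vs\<in>?S. \<bar>C vs\<bar>) / (1 + norm x) ^ m" if "vs \<in> ?S" for vs x
      using that by (simp add: pos_le_divide_eq add_pos_nonneg mult.commute)
    then have "deriv_bound k (decay (\<Sum>vs\<in>?S. \<bar>C vs\<bar>) m) f"
      unfolding deriv_bound_iff using f by (auto simp: schwartz_def smooth_def)
    then show "\<exists>C. deriv_bound k (decay C m) f" by blast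
  qed
next
  assume *: "\<forall>k m. \<exists>C. deriv_bound k (decay C m) f"
  then have "smooth f" by (intro smoothI) blast
  moreover have "\<exists>C. \<forall>x. (1 + norm x) ^ m * norm (dir_derivs vs f x) \<le> C" if "vs \<in> lists Basis" for vs m
  proof -
    obtain C where "deriv_bound (length vs) (decay C m) f" using * by blast
    then have "norm (dir_derivs vs f x) \<le> C / (1 + norm x) ^ m" for x
      unfolding deriv_bound_iff using that by auto
    then show ?thesis by (auto simp: pos_le_divide_eq add_pos_nonneg mult.commute)
  qed
  ultimately show "schwartz f" unfolding schwartz_def by blast
qed

lemma schwartz_smooth: "schwartz f \<Longrightarrow> smooth f"
  by (simp add: schwartz_def)

lemma divide_weight_mono:
  assumes "m \<le> n" "0 \<le> C" shows "C / (1 + norm x) ^ n \<le> C / (1 + norm (x::'a::real_normed_vector)) ^ m"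
  using assms by (intro divide_left_mono power_increasing mult_pos_pos zero_less_power)
    (auto simp: add_pos_nonneg)

lemma deriv_bound_weight_le:
  assumes "deriv_bound k (decay C n) f" "j \<le> k" "m \<le> n" "C \<le> C'"
  shows "deriv_bound j (decay C' m) f"
proof -
  have "0 \<le> C / (1 + norm (0::'a)) ^ n" using deriv_bound_nonneg[OF assms(1)] .
  then have C: "0 \<le> C" by simp
  show ?thesis
  proof (rule deriv_bound_mono[OF deriv_bound_le[OF assms(1,2)]])
    fix x :: 'a
    have "C / (1 + norm x) ^ n \<le> C / (1 + norm x) ^ m"
      using assms C by (intro divide_weight_mono)
    also have "\<dots> \<le> C' / (1 + norm x) ^ m"
      using assms by (intro divide_right_mono) auto
    finally show "C / (1 + norm x) ^ n \<le> C' / (1 + norm x) ^ m" .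
  qed
qed

lemma deriv_bound_schwartz_norm:
  assumes "schwartz f" "k \<le> N" "m \<le> N"
  shows "deriv_bound k (decay (schwartz_norm N f) m) f"
proof -
  obtain C where C: "deriv_bound N (decay C N) f"
    using assms(1) schwartz_iff by blast
  have "(1 + norm x) ^ N * norm (dir_derivs vs f x) \<le> C"
    if "vs \<in> lists Basis" "length vs \<le> N" for vs x
    using C that unfolding deriv_bound_iff by (auto simp: pos_le_divide_eq add_pos_nonneg mult.commute)
  then have bdd: "bdd_above ((\<lambda>(vs, x). (1 + norm x) ^ N * norm (dir_derivs vs f x)) `
      ({vs \<in> lists Basis. length vs \<le> N} \<times> UNIV))"
    by (auto simp: bdd_above_def)
  have "(1 + norm x) ^ N * norm (dir_derivs vs f x) \<le> schwartz_norm N f"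
    if "vs \<in> lists Basis" "length vs \<le> N" for vs x
    unfolding schwartz_norm_def using cSUP_upper[OF _ bdd, of "(vs, x)"] that by auto
  then have "deriv_bound N (decay (schwartz_norm N f) N) f"
    unfolding deriv_bound_iff using assms(1)
    by (auto simp: pos_le_divide_eq add_pos_nonneg mult.commute schwartz_def smooth_def)
  then show ?thesis using assms by (auto intro: deriv_bound_weight_le)
qed

lemma schwartz_norm_leI:
  assumes "deriv_bound N (decay C N) f"
  shows "schwartz_norm N f \<le> C"
  unfolding schwartz_norm_def
proof (rule cSUP_least)
  show "{vs \<in> lists (Basis::'a set). length vs \<le> N} \<times> (UNIV::'a set) \<noteq> {}"
    using lists.Nil by fastforce
  fix p assume "p \<in> {vs \<in> lists (Basis::'a set). length vs \<le> N} \<times> (UNIV::'a set)"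
  then show "(case p of (vs, x) \<Rightarrow> (1 + norm x) ^ N * norm (dir_derivs vs f x)) \<le> C"
    using assms unfolding deriv_bound_iff by (auto simp: pos_le_divide_eq add_pos_nonneg mult.commute)
qed

lemma schwartz_norm_nonneg: "schwartz f \<Longrightarrow> 0 \<le> schwartz_norm N f"
  using deriv_bound_nonneg[OF deriv_bound_schwartz_norm[of f 0 N 0], of 0] by simp

lemma schwartz_norm_mono:
  assumes "schwartz f" "M \<le> N" shows "schwartz_norm M f \<le> schwartz_norm N f"
  using assms by (intro schwartz_norm_leI deriv_bound_schwartz_norm) auto

text \<open>
  For linear F this is continuity with respect to the Schwartz seminorms.
\<close>
definition schwartz_cont ::
  "(('a::euclidean_space \<Rightarrow> complex) \<Rightarrow> ('b::euclidean_space \<Rightarrow> complex)) \<Rightarrow> bool" where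
  "schwartz_cont F \<longleftrightarrow> (\<forall>\<phi>. schwartz \<phi> \<longrightarrow> schwartz (F \<phi>)) \<and>
     (\<forall>N. \<exists>N' C. 0 \<le> C \<and> (\<forall>\<phi>. schwartz \<phi> \<longrightarrow> schwartz_norm N (F \<phi>) \<le> C * schwartz_norm N' \<phi>))"

text \<open>
  The estimate is phrased with an arbitrary bound c in place of a seminorm, so that the closure rules
  of \<open>deriv_bound\<close> apply directly.
\<close>
lemma schwartz_contI:
  assumes "\<And>N. \<exists>N' C. 0 \<le> C \<and> (\<forall>\<phi> c. schwartz \<phi> \<longrightarrow> 0 \<le> c \<longrightarrow> deriv_bound N' (decay c N') \<phi> \<longrightarrow>
     deriv_bound N (decay (C * c) N) (F \<phi>))"
  shows "schwartz_cont F"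
  unfolding schwartz_cont_def
proof (intro conjI allI impI)
  fix \<phi> :: "'a \<Rightarrow> complex" assume s: "schwartz \<phi>"
  show "schwartz (F \<phi>)"
    unfolding schwartz_iff
  proof (intro allI)
    fix k m
    obtain N' C where "\<And>c. 0 \<le> c \<Longrightarrow> deriv_bound N' (decay c N') \<phi> \<Longrightarrow>
       deriv_bound (max k m) (decay (C * c) (max k m)) (F \<phi>)"
      using assms[of "max k m"] s by blast
    from this[OF _ deriv_bound_schwartz_norm[OF s order_refl order_refl]] s
    have "deriv_bound (max k m) (decay (C * schwartz_norm N' \<phi>) (max k m)) (F \<phi>)"
      by (simp add: schwartz_norm_nonneg)
    then show "\<exists>C. deriv_bound k (decay C m) (F \<phi>)"
      by (blast intro: deriv_bound_weight_le max.cobounded1 max.cobounded2)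
  qed
next
  fix N
  obtain N' C where C: "0 \<le> C" "\<And>c \<phi>. schwartz \<phi> \<Longrightarrow> 0 \<le> c \<Longrightarrow> deriv_bound N' (decay c N') \<phi> \<Longrightarrow>
       deriv_bound N (decay (C * c) N) (F \<phi>)"
    using assms[of N] by blast
  have "schwartz_norm N (F \<phi>) \<le> C * schwartz_norm N' \<phi>" if "schwartz \<phi>" for \<phi>
    by (intro schwartz_norm_leI C deriv_bound_schwartz_norm that order_refl schwartz_norm_nonneg)
  with C(1) show "\<exists>N' C. 0 \<le> C \<and> (\<forall>\<phi>. schwartz \<phi> \<longrightarrow> schwartz_norm N (F \<phi>) \<le> C * schwartz_norm N' \<phi>)" by blast
qed

lemma schwartz_cont_schwartz: "schwartz_cont F \<Longrightarrow> schwartz \<phi> \<Longrightarrow> schwartz (F \<phi>)"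
  by (simp add: schwartz_cont_def)

lemma schwartz_cont_compose:
  assumes "schwartz_cont F" "schwartz_cont G"
  shows "schwartz_cont (\<lambda>\<phi>. F (G \<phi>))"
  unfolding schwartz_cont_def
proof (intro conjI allI impI)
  fix \<phi> :: "'c \<Rightarrow> complex" assume "schwartz \<phi>" then show "schwartz (F (G \<phi>))"
    using assms by (simp add: schwartz_cont_def)
next
  fix N
  obtain N1 C1 where 1: "0 \<le> C1" "\<And>\<phi>. schwartz \<phi> \<Longrightarrow> schwartz_norm N (F \<phi>) \<le> C1 * schwartz_norm N1 \<phi>"
    using assms(1) unfolding schwartz_cont_def by blast
  obtain N2 C2 where 2: "0 \<le> C2" "\<And>\<phi>. schwartz \<phi> \<Longrightarrow> schwartz_norm N1 (G \<phi>) \<le> C2 * schwartz_norm N2 \<phi>"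
    using assms(2) unfolding schwartz_cont_def by blast
  have "schwartz_norm N (F (G \<phi>)) \<le> C1 * C2 * schwartz_norm N2 \<phi>" if "schwartz \<phi>" for \<phi>
  proof -
    have "schwartz_norm N (F (G \<phi>)) \<le> C1 * schwartz_norm N1 (G \<phi>)"
      using 1 that assms(2) by (simp add: schwartz_cont_def)
    also have "\<dots> \<le> C1 * (C2 * schwartz_norm N2 \<phi>)"
      using 1 2 that by (intro mult_left_mono) auto
    finally show ?thesis by (simp add: mult.assoc)
  qed
  then show "\<exists>N' C. 0 \<le> C \<and> (\<forall>\<phi>. schwartz \<phi> \<longrightarrow> schwartz_norm N (F (G \<phi>)) \<le> C * schwartz_norm N' \<phi>)"
    using 1(1) 2(1) by (meson mult_nonneg_nonneg)
qed

lemma schwartz_cont_pdiff: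
  assumes "b \<in> Basis" shows "schwartz_cont (pdiff b)"
proof (rule schwartz_contI, intro exI conjI allI impI)
  fix N c and \<phi> :: "'a \<Rightarrow> complex" assume "deriv_bound (Suc N) (decay c (Suc N)) \<phi>"
  then have "deriv_bound N (decay c (Suc N)) (pdiff b \<phi>)" using assms by simp
  then show "deriv_bound N (decay (1 * c) N) (pdiff b \<phi>)"
    by (rule deriv_bound_weight_le) auto
qed simp

lemma schwartz_add: "schwartz f \<Longrightarrow> schwartz g \<Longrightarrow> schwartz (\<lambda>x. f x + g x)"
  unfolding schwartz_iff
proof (intro allI)
  fix k m assume "\<forall>k m. \<exists>C. deriv_bound k (decay C m) f" "\<forall>k m. \<exists>C. deriv_bound k (decay C m) g"
  then obtain C D where "deriv_bound k (decay C m) f" "deriv_bound k (decay D m) g"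
    by blast
  from deriv_bound_add[OF this] show "\<exists>C. deriv_bound k (decay C m) (\<lambda>x. f x + g x)"
    by (auto simp: add_divide_distrib[symmetric])
qed

lemma schwartz_zero: "schwartz (\<lambda>_. 0)"
  unfolding schwartz_iff by (intro allI exI[of _ 0] deriv_bound_zero) auto

text \<open>
  Smooth functions whose derivatives grow at most polynomially, the multipliers of the Schwartz space.
\<close>
definition multiplier :: "('a::euclidean_space \<Rightarrow> complex) \<Rightarrow> bool" where
  "multiplier g \<longleftrightarrow> (\<forall>k. \<exists>C m. deriv_bound k (\<lambda>x. C * (1 + norm x) ^ m) g)"

lemma schwartz_cont_mult:
  assumes "multiplier g" shows "schwartz_cont (\<lambda>\<phi> x. g x * \<phi> x)"
proof (rule schwartz_contI, goal_cases)
  case (1 N)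
  obtain C m where C: "deriv_bound N (\<lambda>x. C * (1 + norm x) ^ m) g"
    using assms unfolding multiplier_def by blast
  have C0: "0 \<le> C" using deriv_bound_nonneg[OF C, of 0] by simp
  have "deriv_bound N (decay ((2 ^ N * C) * c) N) (\<lambda>x. g x * \<phi> x)"
    if "deriv_bound (N + m) (decay c (N + m)) \<phi>" for c \<phi>
    using deriv_bound_mult[OF C deriv_bound_le[OF that, of N]]
    by (rule deriv_bound_mono) (auto simp: power_add add_pos_nonneg field_simps add_nonneg_eq_0_iff)
  then show ?case
    using C0 by (intro exI[of _ "N + m"] exI[of _ "2 ^ N * C"]) auto
qed

lemma schwartz_mult: "multiplier g \<Longrightarrow> schwartz \<phi> \<Longrightarrow> schwartz (\<lambda>x. g x * \<phi> x)"
  by (rule schwartz_cont_schwartz[OF schwartz_cont_mult])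

lemma schwartz_multiplier:
  assumes "schwartz f" shows "multiplier f"
  unfolding multiplier_def
proof
  fix k
  obtain C where "deriv_bound k (decay C 0) f"
    using assms unfolding schwartz_iff by blast
  then show "\<exists>C m. deriv_bound k (\<lambda>x. C * (1 + norm x) ^ m) f"
    by (intro exI[of _ C] exI[of _ 0]) simp
qed

lemma multiplier_const: "multiplier (\<lambda>_. c)"
  unfolding multiplier_def
proof
  fix k
  show "\<exists>C m. deriv_bound k (\<lambda>x. C * (1 + norm x) ^ m) (\<lambda>_. c)"
    using deriv_bound_const[of c "norm c" k] by (intro exI[of _ "norm c"] exI[of _ 0]) simp
qed

lemma schwartz_cmult: "schwartz \<phi> \<Longrightarrow> schwartz (\<lambda>x. c * \<phi> x)"
  by (rule schwartz_mult[OF multiplier_const])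

lemma schwartz_diff: "schwartz f \<Longrightarrow> schwartz g \<Longrightarrow> schwartz (\<lambda>x. f x - g x)"
  using schwartz_add[OF _ schwartz_cmult[of g "-1"], of f] by simp

lemma schwartz_sum: "finite I \<Longrightarrow> (\<And>i. i \<in> I \<Longrightarrow> schwartz (f i)) \<Longrightarrow> schwartz (\<lambda>x. \<Sum>i\<in>I. f i x)"
  by (induction I rule: finite_induct) (auto intro: schwartz_zero schwartz_add)

lemma multiplier_mult:
  assumes "multiplier f" "multiplier g" shows "multiplier (\<lambda>x. f x * g x)"
  unfolding multiplier_def
proof
  fix k
  obtain C m D n where "deriv_bound k (\<lambda>x. C * (1 + norm x) ^ m) f" "deriv_bound k (\<lambda>x. D * (1 + norm x) ^ n) g"
    using assms unfolding multiplier_def by metis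
  from deriv_bound_mult[OF this] have "deriv_bound k (\<lambda>x. (2 ^ k * C * D) * (1 + norm x) ^ (m + n)) (\<lambda>x. f x * g x)"
    by (rule deriv_bound_mono) (simp add: power_add)
  then show "\<exists>C m. deriv_bound k (\<lambda>x. C * (1 + norm x) ^ m) (\<lambda>x. f x * g x)" by blast
qed

lemma multiplier_linear:
  fixes A :: "'a::euclidean_space \<Rightarrow> complex"
  assumes "linear A" shows "multiplier A"
proof -
  obtain K where "\<And>x. norm (A x) \<le> K * norm x"
    using linear_bounded[OF assms] by (auto simp: mult.commute)
  from deriv_bound_linear[OF assms this] show ?thesis unfolding multiplier_def
    by (intro allI exI[of _ K] exI[of _ 1]) simp
qed

lemma affine_growth:
  fixes g :: "'a::euclidean_space \<Rightarrow> 'b::euclidean_space"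
  assumes g: "\<And>x. (g has_derivative A) (at x)"
  obtains c where "1 \<le> c" "\<And>x. 1 + norm (g x) \<le> c * (1 + norm x)"
proof -
  have lin: "linear A" using has_derivative_linear[OF g] .
  have "((\<lambda>x. g x - A x) has_derivative (\<lambda>h. A h - A h)) (at x)" for x
    by (intro has_derivative_diff g linear_imp_has_derivative lin)
  then have "((\<lambda>x. g x - A x) has_derivative (\<lambda>h. 0)) (at x within UNIV)" for x by simp
  then obtain a where a: "\<And>x. g x - A x = a"
    using has_derivative_zero_constant[OF convex_UNIV, of "\<lambda>x. g x - A x"] by blast
  obtain B where B: "B > 0" "\<And>x. norm (A x) \<le> B * norm x"
    using linear_bounded_pos[OF lin] by blast
  show ?thesis
  proof
    show "1 \<le> 1 + norm a + B" using B(1) norm_ge_zero[of a] by linarith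
    fix x
    have "g x = A x + a" using a[of x] by (simp add: algebra_simps)
    then have "norm (g x) \<le> B * norm x + norm a"
      using norm_triangle_ineq[of "A x" a] B(2)[of x] by simp
    moreover have "0 \<le> norm a * norm x" by simp
    moreover have "(1 + norm a + B) * (1 + norm x) = 1 + norm a + B + norm x + norm a * norm x + B * norm x"
      by (simp add: algebra_simps)
    ultimately show "1 + norm (g x) \<le> (1 + norm a + B) * (1 + norm x)"
      using B(1) norm_ge_zero[of x] by linarith
  qed
qed

lemma multiplier_pullback:
  assumes f: "multiplier f" and g: "\<And>x. (g has_derivative A) (at x)"
  shows "multiplier (\<lambda>x. f (g x))"
  unfolding multiplier_def
proof
  fix k
  obtain C m where C: "deriv_bound k (\<lambda>x. C * (1 + norm x) ^ m) f"
    using f unfolding multiplier_def by blast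
  have C0: "0 \<le> C" using deriv_bound_nonneg[OF C, of 0] by simp
  obtain K where K: "1 \<le> K" "\<And>b. b \<in> Basis \<Longrightarrow> (\<Sum>c\<in>Basis. \<bar>A b \<bullet> c\<bar>) \<le> K"
    using pullback_const_exists[of A] by blast
  obtain c where c: "1 \<le> c" "\<And>x. 1 + norm (g x) \<le> c * (1 + norm x)"
    using affine_growth[OF g] by blast
  have "deriv_bound k (\<lambda>x. (K ^ k * (C * c ^ m)) * (1 + norm x) ^ m) (\<lambda>x. f (g x))"
  proof (rule deriv_bound_mono[OF deriv_bound_pullback[OF g K C]], assumption)
    fix x
    have "(1 + norm (g x)) ^ m \<le> (c * (1 + norm x)) ^ m"
      using c by (intro power_mono) auto
    then have "K ^ k * (C * (1 + norm (g x)) ^ m) \<le> K ^ k * (C * (c * (1 + norm x)) ^ m)"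
      using K C0 by (intro mult_left_mono) auto
    then show "K ^ k * (C * (1 + norm (g x)) ^ m) \<le> (K ^ k * (C * c ^ m)) * (1 + norm x) ^ m"
      by (simp add: power_mult_distrib mult.assoc)
  qed
  then show "\<exists>C m. deriv_bound k (\<lambda>x. C * (1 + norm x) ^ m) (\<lambda>x. f (g x))" by blast
qed

text \<open>
  The affine left inverse h bounds \<open>norm x\<close> by a multiple of \<open>1 + norm (g x)\<close>; this transports the decay.
\<close>
lemma schwartz_cont_pullback:
  assumes g: "\<And>x. (g has_derivative A) (at x)" and h: "\<And>x. (h has_derivative B) (at x)"
    and hg: "\<And>x. h (g x) = x"
  shows "schwartz_cont (\<lambda>\<phi> x. \<phi> (g x))"
proof (rule schwartz_contI, goal_cases)
  case (1 N)
  obtain K where K: "1 \<le> K" "\<And>b. b \<in> Basis \<Longrightarrow> (\<Sum>c\<in>Basis. \<bar>A b \<bullet> c\<bar>) \<le> K"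
    using pullback_const_exists[of A] by blast
  obtain c where c: "1 \<le> c" "\<And>x. 1 + norm (h x) \<le> c * (1 + norm x)"
    using affine_growth[OF h] by blast
  have "deriv_bound N (decay ((K ^ N * c ^ N) * a) N) (\<lambda>x. \<phi> (g x))"
    if "0 \<le> a" "deriv_bound N (decay a N) \<phi>" for a \<phi>
  proof (rule deriv_bound_mono[OF deriv_bound_pullback[OF g K that(2)]], assumption)
    fix x
    have "(1 + norm x) ^ N \<le> (c * (1 + norm (g x))) ^ N"
      using c(2)[of "g x"] hg by (intro power_mono) auto
    then have "(1 + norm x) ^ N \<le> c ^ N * (1 + norm (g x)) ^ N"
      by (simp only: power_mult_distrib)
    moreover have "1 / Y \<le> C / X" if "0 < X" "0 < Y" "X \<le> C * Y" for X Y C :: real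
      using that by (simp add: field_simps)
    ultimately have "1 / (1 + norm (g x)) ^ N \<le> c ^ N / (1 + norm x) ^ N"
      by (simp add: add_pos_nonneg)
    then have "K ^ N * a * (1 / (1 + norm (g x)) ^ N) \<le> K ^ N * a * (c ^ N / (1 + norm x) ^ N)"
      using K that by (intro mult_left_mono) auto
    then show "K ^ N * (a / (1 + norm (g x)) ^ N) \<le> (K ^ N * c ^ N) * a / (1 + norm x) ^ N"
      by (simp add: mult.commute mult.left_commute)
  qed
  then show ?case
    using K c by (intro exI[of _ N] exI[of _ "K ^ N * c ^ N"]) auto
qed

lemma norm_Pair_weight: "1 + norm (x, y) \<le> (1 + norm x) * (1 + norm y)"
proof -
  have "0 \<le> norm x * norm y" by simp
  moreover have "(1 + norm x) * (1 + norm y) = 1 + norm x + norm y + norm x * norm y"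
    by (simp add: algebra_simps)
  ultimately show ?thesis using norm_Pair_le[of x y] by linarith
qed

lemma schwartz_cont_tensor:
  fixes \<psi> :: "'b::euclidean_space \<Rightarrow> complex"
  assumes "schwartz \<psi>"
  shows "schwartz_cont (\<lambda>\<phi> (x::'a::euclidean_space, y). \<phi> x * \<psi> y)"
proof (rule schwartz_contI, goal_cases)
  case (1 N)
  obtain D where D: "deriv_bound N (decay D N) \<psi>"
    using assms schwartz_iff by blast
  have D0: "0 \<le> D" using deriv_bound_nonneg[OF D, of 0] by simp
  have "deriv_bound N (decay ((2 ^ N * D) * a) N) (\<lambda>(x::'a, y). \<phi> x * \<psi> y)"
    if a: "0 \<le> a" "deriv_bound N (decay a N) \<phi>" for a \<phi>
  proof -
    have "deriv_bound N (\<lambda>z. 2 ^ N * (a / (1 + norm (fst z)) ^ N) * (D / (1 + norm (snd z)) ^ N))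
      (\<lambda>z::'a\<times>'b. \<phi> (fst z) * \<psi> (snd z))"
      by (rule deriv_bound_mult[OF deriv_bound_fst[OF a(2)] deriv_bound_snd[OF D]])
    then have "deriv_bound N (decay ((2 ^ N * D) * a) N) (\<lambda>z::'a\<times>'b. \<phi> (fst z) * \<psi> (snd z))"
    proof (rule deriv_bound_mono)
      fix z :: "'a \<times> 'b"
      have "(1 + norm z) ^ N \<le> ((1 + norm (fst z)) * (1 + norm (snd z))) ^ N"
        using norm_Pair_weight[of "fst z" "snd z"] by (intro power_mono) auto
      then have "2 ^ N * a * D / ((1 + norm (fst z)) * (1 + norm (snd z))) ^ N \<le> 2 ^ N * a * D / (1 + norm z) ^ N"
        using a D0 by (intro divide_left_mono mult_pos_pos zero_less_power) (auto simp: add_pos_nonneg)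
      then show "2 ^ N * (a / (1 + norm (fst z)) ^ N) * (D / (1 + norm (snd z)) ^ N) \<le> (2 ^ N * D) * a / (1 + norm z) ^ N"
        by (simp add: power_mult_distrib mult.commute mult.left_commute)
    qed
    then show ?thesis by (simp add: case_prod_beta')
  qed
  then show ?case
    using D0 by (intro exI[of _ N] exI[of _ "2 ^ N * D"]) auto
qed

text \<open>
  The bounds of the finitely many first derivatives can be added to a common bound.
\<close>
lemma exists_deriv_bound_Suc:
  assumes "\<And>x. f differentiable (at x)" "\<And>b. b \<in> Basis \<Longrightarrow> \<exists>w. deriv_bound k w (pdiff b f)"
  shows "\<exists>w. deriv_bound (Suc k) w f"
proof -
  obtain w where w: "\<And>b. b \<in> Basis \<Longrightarrow> deriv_bound k (w b) (pdiff b f)"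
    using assms(2) by metis
  have nn: "0 \<le> w b x" if "b \<in> Basis" for b x
    using deriv_bound_nonneg[OF w[OF that]] .
  have "deriv_bound k (\<lambda>x. norm (f x) + (\<Sum>b\<in>Basis. w b x)) (pdiff b f)" if b: "b \<in> Basis" for b
    using w[OF b]
  proof (rule deriv_bound_mono)
    fix x
    show "w b x \<le> norm (f x) + (\<Sum>b\<in>Basis. w b x)"
      using member_le_sum[OF b, of "\<lambda>b. w b x"] nn by (simp add: add_increasing)
  qed
  then show ?thesis
    using assms(1) nn by (intro exI[of _ "\<lambda>x. norm (f x) + (\<Sum>b\<in>Basis. w b x)"]) (auto simp: sum_nonneg)
qed

lemma smooth_inverse:
  assumes f: "smooth f" and nz: "\<And>x. f x \<noteq> 0"
  shows "smooth (\<lambda>x. inverse (f x))"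
proof (rule smoothI)
  fix k
  show "\<exists>w. deriv_bound k w (\<lambda>x. inverse (f x))"
  proof (induction k)
    case 0
    show ?case by auto
  next
    case (Suc k)
    have d: "((\<lambda>x. inverse (f x)) has_derivative
        (\<lambda>h. - (inverse (f x) * frechet_derivative f (at x) h * inverse (f x)))) (at x)" for x
      using smooth_differentiable[OF f, of x] nz
      by (intro Deriv.has_derivative_inverse) (simp_all add: frechet_derivative_works)
    have *: "pdiff b (\<lambda>x. inverse (f x)) = (\<lambda>x. (-1) * (inverse (f x) * pdiff b f x * inverse (f x)))" for b
      by (subst pdiff_eqI'[OF d]) (simp add: pdiff_def)
    show ?case
    proof (rule exists_deriv_bound_Suc)
      show "(\<lambda>x. inverse (f x)) differentiable (at x)" for x using d differentiable_def by blast
      fix b :: 'a assume "b \<in> Basis"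
      then obtain v where "deriv_bound k v (pdiff b f)" using smooth_deriv_bound[OF smooth_pdiff[OF f]] by blast
      moreover obtain w where "deriv_bound k w (\<lambda>x. inverse (f x))" using Suc by blast
      ultimately show "\<exists>w. deriv_bound k w (pdiff b (\<lambda>x. inverse (f x)))"
        unfolding * by (intro exI) (rule deriv_bound_cmult deriv_bound_mult | assumption)+
    qed
  qed
qed

section \<open>Cutoff functions\<close>

text \<open>
  The function \<open>exp (- 1 / t)\<close>, extended by zero, is flat at 0. Its derivatives are of the form
  \<open>p (1 / t) * exp (- 1 / t)\<close>; with the polynomial p as a parameter the family is closed under
  differentiation.
\<close>
definition flat_exp :: "real poly \<Rightarrow> real \<Rightarrow> real" where
  "flat_exp p t = (if 0 < t then poly p (inverse t) * exp (- inverse t) else 0)"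

lemma poly_exp_tendsto_0: "((\<lambda>s::real. poly p s * exp (- s)) \<longlongrightarrow> 0) at_top"
proof -
  have "((\<lambda>s. \<Sum>i\<le>degree p. coeff p i * (s ^ i / exp s)) \<longlongrightarrow> (\<Sum>i\<le>degree p. coeff p i * 0)) at_top"
    by (intro tendsto_intros tendsto_power_div_exp_0)
  moreover have "(\<Sum>i\<le>degree p. coeff p i * (s ^ i / exp s)) = poly p s * exp (- s)" for s
    by (simp add: poly_altdef sum_distrib_right exp_minus divide_inverse mult.assoc)
  ultimately show ?thesis by simp
qed

lemma flat_exp_has_derivative:
  "(flat_exp p has_real_derivative flat_exp ([:0, 0, 1:] * (p - pderiv p)) t) (at t)"
proof (cases t "0::real" rule: linorder_cases)
  case less
  have "((\<lambda>_. 0) has_real_derivative 0) (at t)" by simp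
  then have "(flat_exp p has_real_derivative 0) (at t)"
    by (rule has_field_derivative_transform_within_open[of _ _ _ "{..<0}"]) (use less in \<open>auto simp: flat_exp_def\<close>)
  with less show ?thesis by (simp add: flat_exp_def)
next
  case greater
  have "((\<lambda>t. poly p (inverse t) * exp (- inverse t)) has_real_derivative
     poly (pderiv p) (inverse t) * (- (inverse t ^ 2)) * exp (- inverse t) +
     poly p (inverse t) * (exp (- inverse t) * inverse t ^ 2)) (at t)"
    using greater
    by (auto intro!: derivative_eq_intros DERIV_chain2[OF poly_DERIV] simp: power2_eq_square divide_inverse)
  also have "poly (pderiv p) (inverse t) * (- (inverse t ^ 2)) * exp (- inverse t) +
     poly p (inverse t) * (exp (- inverse t) * inverse t ^ 2) = flat_exp ([:0, 0, 1:] * (p - pderiv p)) t"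
    using greater by (simp add: flat_exp_def power2_eq_square algebra_simps)
  finally show ?thesis
    by (rule has_field_derivative_transform_within_open[of _ _ _ "{0<..}"]) (use greater in \<open>auto simp: flat_exp_def\<close>)
next
  case equal
  have "((\<lambda>h. poly (pCons 0 p) (inverse h) * exp (- inverse h)) \<longlongrightarrow> 0) (at_right (0::real))"
    using filterlim_compose[OF poly_exp_tendsto_0 filterlim_inverse_at_top_right] .
  moreover have "\<forall>\<^sub>F h in at_right 0. poly (pCons 0 p) (inverse h) * exp (- inverse h) = (flat_exp p (0 + h) - flat_exp p 0) / h"
    by (rule eventually_at_rightI[of 0 1]) (auto simp: flat_exp_def divide_inverse)
  ultimately have r: "((\<lambda>h. (flat_exp p (0 + h) - flat_exp p 0) / h) \<longlongrightarrow> 0) (at_right 0)"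
    by (rule Lim_transform_eventually)
  have "\<forall>\<^sub>F h in at_left 0. 0 = (flat_exp p (0 + h) - flat_exp p 0) / h"
    by (rule eventually_at_leftI[of "-1" 0]) (auto simp: flat_exp_def divide_inverse)
  then have l: "((\<lambda>h. (flat_exp p (0 + h) - flat_exp p 0) / h) \<longlongrightarrow> 0) (at_left 0)"
    by (rule Lim_transform_eventually[OF tendsto_const])
  have "(flat_exp p has_real_derivative 0) (at 0)"
    unfolding DERIV_def using filterlim_split_at[OF l r] .
  with equal show ?thesis by (simp add: flat_exp_def)
qed

lemma smooth_flat_exp_compose:
  fixes q :: "'a::euclidean_space \<Rightarrow> real"
  assumes q: "\<And>x. (q has_derivative q' x) (at x)" and s: "smooth (\<lambda>x. complex_of_real (q x))"
  shows "smooth (\<lambda>x. complex_of_real (flat_exp p (q x)))"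
proof (rule smoothI)
  fix k
  show "\<exists>w. deriv_bound k w (\<lambda>x. complex_of_real (flat_exp p (q x)))"
  proof (induction k arbitrary: p)
    case 0
    show ?case by auto
  next
    case (Suc k)
    define p' where "p' = [:0, 0, 1:] * (p - pderiv p)"
    have "((\<lambda>x. flat_exp p (q x)) has_derivative (\<lambda>h. flat_exp p' (q x) * q' x h)) (at x)" for x
      using has_derivative_compose[OF q flat_exp_has_derivative[of p, unfolded has_field_derivative_def]]
      unfolding p'_def .
    then have d: "((\<lambda>x. complex_of_real (flat_exp p (q x))) has_derivative
        (\<lambda>h. complex_of_real (flat_exp p' (q x) * q' x h))) (at x)" for x
      by (rule bounded_linear.has_derivative[OF bounded_linear_of_real])
    have "((\<lambda>x. complex_of_real (q x)) has_derivative (\<lambda>h. complex_of_real (q' x h))) (at x)" for x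
      by (intro bounded_linear.has_derivative[OF bounded_linear_of_real] q)
    then have q'': "pdiff b (\<lambda>x. complex_of_real (q x)) = (\<lambda>x. complex_of_real (q' x b))" for b
      by (rule pdiff_eqI')
    have *: "pdiff b (\<lambda>x. complex_of_real (flat_exp p (q x))) =
       (\<lambda>x. complex_of_real (flat_exp p' (q x)) * pdiff b (\<lambda>x. complex_of_real (q x)) x)" for b
      unfolding q'' by (subst pdiff_eqI'[OF d]) simp
    show ?case
    proof (rule exists_deriv_bound_Suc)
      show "(\<lambda>x. complex_of_real (flat_exp p (q x))) differentiable (at x)" for x
        using d differentiable_def by blast
      fix b :: 'a assume "b \<in> Basis"
      then obtain v where "deriv_bound k v (pdiff b (\<lambda>x. complex_of_real (q x)))"
        using smooth_deriv_bound[OF smooth_pdiff[OF s]] by blast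
      moreover obtain w where "deriv_bound k w (\<lambda>x. complex_of_real (flat_exp p' (q x)))" using Suc by blast
      ultimately show "\<exists>w. deriv_bound k w (pdiff b (\<lambda>x. complex_of_real (flat_exp p (q x))))"
        unfolding * by (intro exI) (rule deriv_bound_mult | assumption)+
    qed
  qed
qed

lemma smooth_inner_square: "smooth (\<lambda>x::'a::euclidean_space. complex_of_real (x \<bullet> x))"
proof -
  have "smooth (\<lambda>x::'a. \<Sum>b\<in>Basis. complex_of_real (x \<bullet> b) * complex_of_real (x \<bullet> b))"
    by (intro smooth_sum smooth_mult smooth_linear finite_Basis)
      (auto intro!: linearI simp: inner_add_left scaleR_conv_of_real)
  moreover have "(\<Sum>b\<in>Basis. complex_of_real (x \<bullet> b) * complex_of_real (x \<bullet> b)) = complex_of_real (x \<bullet> x)" for x :: 'a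
    by (subst euclidean_inner) simp
  ultimately show ?thesis by simp
qed

text \<open>
  Equal to 1 on the unit ball and to 0 outside the ball of radius 2. The denominator is positive
  because \<open>4 - x \<bullet> x\<close> and \<open>x \<bullet> x - 1\<close> have a positive sum, so one of them is positive.
\<close>
definition cutoff :: "'a::euclidean_space \<Rightarrow> complex" where
  "cutoff x = complex_of_real (flat_exp 1 (4 - x \<bullet> x)) *
     inverse (complex_of_real (flat_exp 1 (4 - x \<bullet> x)) + complex_of_real (flat_exp 1 (x \<bullet> x - 1)))"

lemma flat_exp_1_pos: "0 < t \<Longrightarrow> 0 < flat_exp 1 t" and flat_exp_nonneg: "0 \<le> flat_exp 1 t"
  by (auto simp: flat_exp_def)

lemma smooth_cutoff: "smooth (cutoff :: 'a::euclidean_space \<Rightarrow> complex)"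
proof -
  have s1: "smooth (\<lambda>x::'a. complex_of_real (4 - x \<bullet> x))" and s2: "smooth (\<lambda>x::'a. complex_of_real (x \<bullet> x - 1))"
    using smooth_diff[OF smooth_const[of 4] smooth_inner_square]
      smooth_diff[OF smooth_inner_square smooth_const[of 1]] by simp_all
  have d1: "((\<lambda>x::'a. 4 - x \<bullet> x) has_derivative (\<lambda>h. - 2 * (x \<bullet> h))) (at x)"
    and d2: "((\<lambda>x::'a. x \<bullet> x - 1) has_derivative (\<lambda>h. 2 * (x \<bullet> h))) (at x)" for x :: 'a
    by (auto intro!: derivative_eq_intros simp: inner_commute)
  have nz: "complex_of_real (flat_exp 1 (4 - x \<bullet> x)) + complex_of_real (flat_exp 1 (x \<bullet> x - 1)) \<noteq> 0" for x :: 'a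
  proof -
    have "0 < flat_exp 1 (4 - x \<bullet> x) + flat_exp 1 (x \<bullet> x - 1)"
    proof (cases "x \<bullet> x < 4")
      case True then show ?thesis using flat_exp_1_pos[of "4 - x \<bullet> x"] flat_exp_nonneg[of "x \<bullet> x - 1"] by linarith
    next
      case False then show ?thesis using flat_exp_1_pos[of "x \<bullet> x - 1"] flat_exp_nonneg[of "4 - x \<bullet> x"] by linarith
    qed
    then have "complex_of_real (flat_exp 1 (4 - x \<bullet> x) + flat_exp 1 (x \<bullet> x - 1)) \<noteq> 0"
      by (simp only: of_real_eq_0_iff)
    then show ?thesis by simp
  qed
  show ?thesis unfolding cutoff_def[abs_def]
    by (intro smooth_mult smooth_inverse smooth_add smooth_flat_exp_compose[OF d1 s1] smooth_flat_exp_compose[OF d2 s2] nz)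
qed

lemma cutoff_eq_1: "norm x \<le> 1 \<Longrightarrow> cutoff x = 1"
proof -
  assume x: "norm x \<le> 1"
  then have "x \<bullet> x \<le> 1" by (simp add: dot_square_norm power_le_one)
  then have "0 < flat_exp 1 (4 - x \<bullet> x)" "flat_exp 1 (x \<bullet> x - 1) = 0"
    using flat_exp_1_pos[of "4 - x \<bullet> x"] by (auto simp: flat_exp_def)
  then show ?thesis by (simp add: cutoff_def)
qed

lemma cutoff_eq_0: "2 \<le> norm x \<Longrightarrow> cutoff x = 0"
proof -
  assume x: "2 \<le> norm x"
  then have "2\<^sup>2 \<le> (norm x)\<^sup>2" by (intro power_mono) auto
  then have "4 \<le> x \<bullet> x" by (simp add: dot_square_norm)
  then show ?thesis by (simp add: cutoff_def flat_exp_def)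
qed

lemma cutoff_real: obtains t where "0 \<le> t" "cutoff x = complex_of_real t"
proof
  let ?t = "flat_exp 1 (4 - x \<bullet> x) / (flat_exp 1 (4 - x \<bullet> x) + flat_exp 1 (x \<bullet> x - 1))"
  show "0 \<le> ?t" by (intro divide_nonneg_nonneg add_nonneg_nonneg flat_exp_nonneg)
  show "cutoff x = complex_of_real ?t" by (simp add: cutoff_def divide_inverse)
qed

lemma fun_support_subset_closed: "closed S \<Longrightarrow> (\<And>x. x \<notin> S \<Longrightarrow> f x = 0) \<Longrightarrow> fun_support f \<subseteq> S"
  unfolding fun_support_def by (rule closure_minimal) auto

lemma zero_outside_fun_support: "x \<notin> fun_support f \<Longrightarrow> f x = 0"
  using closure_subset[of "{x. f x \<noteq> 0}"] unfolding fun_support_def by blast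

text \<open>
  Compact support, from vanishing outside any compact set.
\<close>
lemma test_functionI:
  assumes "smooth f" "compact S" "\<And>x. x \<notin> S \<Longrightarrow> f x = 0"
  shows "test_function f"
proof -
  have "fun_support f \<subseteq> S"
    using assms compact_imp_closed by (intro fun_support_subset_closed) auto
  then have "fun_support f = S \<inter> fun_support f" by blast
  moreover have "compact (S \<inter> fun_support f)"
    using assms(2) by (intro compact_Int_closed) (auto simp: fun_support_def)
  ultimately show ?thesis using assms(1) by (simp add: test_function_def)
qed

lemma test_function_cutoff: "test_function (cutoff :: 'a::euclidean_space \<Rightarrow> complex)"
  by (rule test_functionI[OF smooth_cutoff compact_cball[of 0 2]]) (auto intro: cutoff_eq_0)

lemma test_function_mult:
  assumes "smooth f" "test_function g" shows "test_function (\<lambda>x. f x * g x)"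
  using assms by (intro test_functionI[of _ "fun_support g"])
    (auto simp: test_function_def smooth_mult zero_outside_fun_support)

lemma deriv_bound_zero_on_open:
  "deriv_bound k w f \<Longrightarrow> open U \<Longrightarrow> (\<And>x. x \<in> U \<Longrightarrow> f x = 0) \<Longrightarrow>
    deriv_bound k (\<lambda>x. if x \<in> U then 0 else w x) f"
proof (induction k arbitrary: f)
  case 0
  then show ?case by auto
next
  case (Suc k)
  have "pdiff b f x = 0" if "x \<in> U" for b x
  proof -
    have "(f has_derivative (\<lambda>_. 0)) (at x)"
      by (rule has_derivative_transform_within_open[OF has_derivative_const \<open>open U\<close> that]) (simp add: Suc.prems)
    then show ?thesis by (rule pdiff_eqI)
  qed
  with Suc show ?case by auto
qed

lemma test_function_schwartz:
  assumes "test_function f" shows "schwartz f"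
  unfolding schwartz_iff
proof (intro allI)
  fix k m
  define D where "D x = (1 + norm x) ^ m * (\<Sum>vs\<in>{vs \<in> lists Basis. length vs \<le> k}. norm (dir_derivs vs f x))" for x
  have f: "smooth f" "compact (fun_support f)" using assms by (auto simp: test_function_def)
  have "continuous_on UNIV (dir_derivs vs f)" if "vs \<in> lists Basis" for vs
    using f(1) that unfolding smooth_def
    by (meson continuous_at_imp_continuous_on differentiable_imp_continuous_within)
  then have "continuous_on (fun_support f) D"
    unfolding D_def by (intro continuous_intros) (auto intro: continuous_on_subset)
  then have "bounded (D ` fun_support f)" using f(2) compact_continuous_image compact_imp_bounded by blast
  then obtain C where C: "\<And>x. x \<in> fun_support f \<Longrightarrow> norm (D x) \<le> C"
    by (auto simp: bounded_iff)
  have "closed (fun_support f)" by (simp add: fun_support_def)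
  then have "deriv_bound k (\<lambda>x. if x \<in> - fun_support f then 0 else
      \<Sum>vs\<in>{vs \<in> lists Basis. length vs \<le> k}. norm (dir_derivs vs f x)) f"
    by (intro deriv_bound_zero_on_open smooth_deriv_bound f) (auto intro: zero_outside_fun_support)
  then have "deriv_bound k (decay (\<bar>C\<bar>) m) f"
  proof (rule deriv_bound_mono)
    fix x
    have "(\<Sum>vs\<in>{vs \<in> lists Basis. length vs \<le> k}. norm (dir_derivs vs f x)) \<le> \<bar>C\<bar> / (1 + norm x) ^ m"
      if "x \<in> fun_support f"
    proof -
      have "D x \<le> \<bar>C\<bar>" using C[OF that] by simp
      then show ?thesis by (simp add: D_def pos_le_divide_eq add_pos_nonneg mult.commute)
    qed
    then show "(if x \<in> - fun_support f then 0 else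
      \<Sum>vs\<in>{vs \<in> lists Basis. length vs \<le> k}. norm (dir_derivs vs f x)) \<le> \<bar>C\<bar> / (1 + norm x) ^ m"
      by auto
  qed
  then show "\<exists>C. deriv_bound k (decay C m) f" by blast
qed

lemma test_function_multiplier: "test_function f \<Longrightarrow> multiplier f"
  by (intro schwartz_multiplier test_function_schwartz)

section \<open>Gaussians\<close>

definition gaussian :: "real \<Rightarrow> 'a::euclidean_space \<Rightarrow> complex" where
  "gaussian a x = of_real (exp (- a * (x \<bullet> x)))"

lemma gaussian_has_derivative:
  "(gaussian a has_derivative (\<lambda>h. of_real (- 2 * a * (x \<bullet> h)) * gaussian a x)) (at x)"
proof -
  have "((\<lambda>x. exp (- a * (x \<bullet> x))) has_derivative (\<lambda>h. exp (- a * (x \<bullet> x)) * (- a * (2 * (x \<bullet> h))))) (at x)"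
    by (auto intro!: derivative_eq_intros simp: inner_commute)
  from bounded_linear.has_derivative[OF bounded_linear_of_real this]
  show ?thesis unfolding gaussian_def[abs_def] by (rule has_derivative_eq_rhs) (auto simp: algebra_simps)
qed

lemma pdiff_gaussian: "pdiff b (gaussian a) = (\<lambda>x. of_real (- 2 * a * (x \<bullet> b)) * gaussian a x)"
  by (rule pdiff_eqI'[OF gaussian_has_derivative])

text \<open>
  Every differentiation of a Gaussian produces one more linear factor.
\<close>
lemma deriv_bound_gaussian:
  "\<exists>C\<ge>0. deriv_bound k (\<lambda>x. C * (1 + norm x) ^ k * exp (- a * (x \<bullet> x))) (gaussian a :: 'a::euclidean_space \<Rightarrow> complex)"
proof (induction k)
  case 0
  show ?case by (rule exI[of _ 1]) (auto simp: gaussian_def)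
next
  case (Suc k)
  then obtain C where C: "0 \<le> C"
    "deriv_bound k (\<lambda>x::'a. C * (1 + norm x) ^ k * exp (- a * (x \<bullet> x))) (gaussian a)" by blast
  define C' where "C' = 1 + 2 ^ k * (2 * \<bar>a\<bar>) * C"
  have "deriv_bound k (\<lambda>x. C' * (1 + norm x) ^ Suc k * exp (- a * (x \<bullet> x))) (pdiff b (gaussian a))"
    if "b \<in> Basis" for b :: 'a
  proof -
    have "linear (\<lambda>x. complex_of_real (- 2 * a * (x \<bullet> b)))"
      by (rule linearI) (auto simp: inner_add_left algebra_simps scaleR_conv_of_real)
    moreover have "norm (complex_of_real (- 2 * a * (x \<bullet> b))) \<le> 2 * \<bar>a\<bar> * norm x" for x
      using Basis_le_norm[OF that, of x] by (simp only: norm_of_real abs_mult) (simp add: mult_left_mono)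
    ultimately have "deriv_bound k (\<lambda>x. 2 * \<bar>a\<bar> * (1 + norm x)) (\<lambda>x. complex_of_real (- 2 * a * (x \<bullet> b)))"
      by (rule deriv_bound_linear)
    from deriv_bound_mult[OF this C(2)] show ?thesis unfolding pdiff_gaussian
    proof (rule deriv_bound_mono)
      fix x :: 'a
      have "2 ^ k * (2 * \<bar>a\<bar> * (1 + norm x)) * (C * (1 + norm x) ^ k * exp (- a * (x \<bullet> x))) =
        (2 ^ k * (2 * \<bar>a\<bar>) * C) * ((1 + norm x) ^ Suc k * exp (- a * (x \<bullet> x)))" by (simp add: algebra_simps)
      also have "\<dots> \<le> C' * ((1 + norm x) ^ Suc k * exp (- a * (x \<bullet> x)))"
        unfolding C'_def by (intro mult_right_mono) auto
      finally show "2 ^ k * (2 * \<bar>a\<bar> * (1 + norm x)) * (C * (1 + norm x) ^ k * exp (- a * (x \<bullet> x)))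
         \<le> C' * (1 + norm x) ^ Suc k * exp (- a * (x \<bullet> x))" by (simp add: mult.assoc)
    qed
  qed
  moreover have "norm (gaussian a x) \<le> C' * (1 + norm x) ^ Suc k * exp (- a * (x \<bullet> x))" for x :: 'a
  proof -
    have "1 * 1 \<le> C' * (1 + norm x) ^ Suc k"
      using C(1) by (intro mult_mono one_le_power) (auto simp: C'_def)
    then have "1 * exp (- a * (x \<bullet> x)) \<le> C' * (1 + norm x) ^ Suc k * exp (- a * (x \<bullet> x))"
      by (intro mult_right_mono) auto
    then show ?thesis by (simp add: gaussian_def)
  qed
  moreover have "gaussian a differentiable (at x)" for x :: 'a
    using gaussian_has_derivative differentiable_def by blast
  ultimately have "deriv_bound (Suc k) (\<lambda>x::'a. C' * (1 + norm x) ^ Suc k * exp (- a * (x \<bullet> x))) (gaussian a)"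
    by simp
  moreover have "0 \<le> C'" using C(1) by (simp add: C'_def)
  ultimately show ?case by blast
qed

lemma schwartz_gaussian:
  assumes a: "0 < a" shows "schwartz (gaussian a :: 'a::euclidean_space \<Rightarrow> complex)"
  unfolding schwartz_iff
proof (intro allI)
  fix k m
  obtain C where C: "0 \<le> C" "deriv_bound k (\<lambda>x::'a. C * (1 + norm x) ^ k * exp (- a * (x \<bullet> x))) (gaussian a)"
    using deriv_bound_gaussian[where 'a = 'a, of k a] by blast
  define E where "E = exp ((real (k + m))\<^sup>2 / (4 * a))"
  \<comment> \<open>By \<open>1 + t \<le> exp t\<close> the left-hand side is at most \<open>exp (n t - a t\<^sup>2)\<close> with \<open>n = k + m\<close>, and the exponent is at most \<open>n\<^sup>2 / (4 a)\<close>.\<close>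
  have key: "(1 + norm x) ^ (k + m) * exp (- a * (x \<bullet> x)) \<le> E" for x :: 'a
  proof -
    let ?t = "norm x" and ?n = "real (k + m)"
    have "(1 + ?t) ^ (k + m) \<le> exp ?t ^ (k + m)"
      by (intro power_mono) (auto intro: exp_ge_add_one_self)
    then have "(1 + ?t) ^ (k + m) * exp (- a * (x \<bullet> x)) \<le> exp (?n * ?t) * exp (- a * (x \<bullet> x))"
      by (intro mult_right_mono) (simp_all only: exp_of_nat_mult exp_ge_zero)
    also have "\<dots> = exp (?n * ?t - a * ?t\<^sup>2)"
      by (simp add: exp_diff exp_minus field_simps dot_square_norm)
    also have "?n * ?t - a * ?t\<^sup>2 \<le> ?n\<^sup>2 / (4 * a)"
    proof -
      have "0 \<le> (?n - 2 * a * ?t)\<^sup>2" by simp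
      also have "\<dots> = ?n\<^sup>2 - 4 * a * (?n * ?t - a * ?t\<^sup>2)" by (simp add: power2_eq_square algebra_simps)
      finally have "(?n * ?t - a * ?t\<^sup>2) * (4 * a) \<le> ?n\<^sup>2" by (simp add: algebra_simps)
      then show ?thesis using a by (simp add: pos_le_divide_eq)
    qed
    finally show ?thesis by (simp add: E_def)
  qed
  have "deriv_bound k (\<lambda>x::'a. (C * E) / (1 + norm x) ^ m) (gaussian a)"
  proof (rule deriv_bound_mono[OF C(2)])
    fix x :: 'a
    have "C * ((1 + norm x) ^ (k + m) * exp (- a * (x \<bullet> x))) \<le> C * E"
      using key C(1) by (rule mult_left_mono)
    then show "C * (1 + norm x) ^ k * exp (- a * (x \<bullet> x)) \<le> (C * E) / (1 + norm x) ^ m"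
      by (simp add: pos_le_divide_eq add_pos_nonneg power_add algebra_simps)
  qed
  then show "\<exists>C. deriv_bound k (\<lambda>x::'a. C / (1 + norm x) ^ m) (gaussian a)" by blast
qed

text \<open>
  The Gaussian is a product of one-dimensional normal densities.
\<close>
lemma gaussian_integral:
  "has_bochner_integral lborel (gaussian pi :: 'a::euclidean_space \<Rightarrow> complex) 1"
proof -
  let ?f = "\<lambda>x::real. exp (- pi * x\<^sup>2)"
  have f: "normal_density 0 (1 / sqrt (2 * pi)) x = ?f x" for x
    by (auto simp: normal_density_def power_divide mult.commute)
  have "(\<integral>\<^sup>+x. normal_density 0 (1 / sqrt (2 * pi)) x \<partial>lborel) = 1"
    by (subst nn_integral_eq_integral) auto
  then have 1: "(\<integral>\<^sup>+x. ?f x \<partial>lborel) = 1"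
    by (simp only: f)
  have "(\<integral>\<^sup>+x. (\<Prod>b\<in>Basis. ennreal (?f (x \<bullet> b))) \<partial>(lborel::'a measure)) = (\<Prod>b\<in>(Basis::'a set). (\<integral>\<^sup>+x. ?f x \<partial>lborel))"
    by (rule nn_integral_lborel_prod) auto
  moreover have "(\<Prod>b\<in>Basis. ennreal (?f (x \<bullet> b))) = ennreal (exp (- pi * (x \<bullet> x)))" for x :: 'a
  proof -
    have "(\<Prod>b\<in>Basis. ennreal (?f (x \<bullet> b))) = ennreal (exp (\<Sum>b\<in>Basis. - pi * (x \<bullet> b)\<^sup>2))"
      by (simp add: prod_ennreal exp_sum)
    also have "(\<Sum>b\<in>Basis. - pi * (x \<bullet> b)\<^sup>2) = - pi * (x \<bullet> x)"
      by (simp only: euclidean_inner[of x x] sum_distrib_left power2_eq_square)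
    finally show ?thesis .
  qed
  ultimately have "(\<integral>\<^sup>+x. ennreal (exp (- pi * (x \<bullet> x))) \<partial>(lborel::'a measure)) = ennreal 1"
    using 1 by simp
  then have "has_bochner_integral lborel (\<lambda>x::'a. exp (- pi * (x \<bullet> x))) 1"
    by (intro has_bochner_integral_nn_integral) auto
  from has_bochner_integral_of_real[OF this] show ?thesis
    unfolding gaussian_def[abs_def] by simp
qed

section \<open>Integrability\<close>

lemma integrable_inverse_1_plus_square_real: "integrable lborel (\<lambda>x::real. inverse (1 + x\<^sup>2))"
  using integrable_inverse_1_plus_square by (simp add: set_integrable_def einterval_eq)

text \<open>
  The power \<open>(1 + norm x) ^ (2 * DIM('a))\<close> dominates the product of the \<open>1 + (x \<bullet> b)\<^sup>2\<close> over all coordinates,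
  and the inverse of that product is integrable one coordinate at a time.
\<close>
lemma integrable_weight:
  assumes m: "2 * DIM('a::euclidean_space) \<le> m"
  shows "integrable lborel (\<lambda>x::'a. C / (1 + norm x) ^ m)"
proof -
  let ?f = "\<lambda>x::real. inverse (1 + x\<^sup>2)"
  have "(\<integral>\<^sup>+x. ?f x \<partial>lborel) < \<infinity>"
    using integrable_inverse_1_plus_square_real by (simp add: integrable_iff_bounded)
  then have "(\<Prod>b\<in>(Basis::'a set). (\<integral>\<^sup>+x. ?f x \<partial>lborel)) < \<infinity>"
    by (simp add: power_less_top_ennreal)
  moreover have "(\<integral>\<^sup>+x. (\<Prod>b\<in>Basis. ennreal (?f (x \<bullet> b))) \<partial>(lborel::'a measure)) = (\<Prod>b\<in>(Basis::'a set). (\<integral>\<^sup>+x. ?f x \<partial>lborel))"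
    by (rule nn_integral_lborel_prod) auto
  ultimately have fin: "(\<integral>\<^sup>+x. ennreal (\<Prod>b\<in>Basis. ?f (x \<bullet> b)) \<partial>(lborel::'a measure)) < \<infinity>"
    by (simp add: prod_ennreal)
  have "integrable lborel (\<lambda>x::'a. \<Prod>b\<in>Basis. ?f (x \<bullet> b))"
    unfolding integrable_iff_bounded using fin by (auto simp: prod_nonneg)
  then have int: "integrable lborel (\<lambda>x::'a. C * (\<Prod>b\<in>Basis. ?f (x \<bullet> b)))" by simp
  show ?thesis
  proof (rule Bochner_Integration.integrable_bound[OF int])
    show "AE x::'a in lborel. norm (C / (1 + norm x) ^ m) \<le> norm (C * (\<Prod>b\<in>Basis. ?f (x \<bullet> b)))"
    proof (rule AE_I2)
      fix x :: 'a
      have "(\<Prod>b\<in>(Basis::'a set). 1 + (x \<bullet> b)\<^sup>2) \<le> (\<Prod>b\<in>(Basis::'a set). (1 + norm x)\<^sup>2)"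
      proof (rule prod_mono, safe)
        fix b :: 'a assume "b \<in> Basis"
        then have "(x \<bullet> b)\<^sup>2 \<le> (norm x)\<^sup>2" using Basis_le_norm by (subst abs_le_square_iff[symmetric]) auto
        then show "1 + (x \<bullet> b)\<^sup>2 \<le> (1 + norm x)\<^sup>2"
          using norm_ge_zero[of x] by (simp only: power2_sum one_power2)
      qed auto
      also have "\<dots> = (1 + norm x) ^ (2 * DIM('a))" by (simp add: power_mult)
      also have "\<dots> \<le> (1 + norm x) ^ m" using m by (intro power_increasing) auto
      finally have "1 / (1 + norm x) ^ m \<le> 1 / (\<Prod>b\<in>(Basis::'a set). 1 + (x \<bullet> b)\<^sup>2)"
        by (intro divide_left_mono mult_pos_pos prod_pos) (auto simp: add_pos_nonneg)
      also have "\<dots> = (\<Prod>b\<in>Basis. ?f (x \<bullet> b))" by (simp add: prod_inversef[symmetric] divide_inverse)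
      finally have "\<bar>C\<bar> * (1 / (1 + norm x) ^ m) \<le> \<bar>C\<bar> * (\<Prod>b\<in>Basis. ?f (x \<bullet> b))"
        by (intro mult_left_mono) auto
      then show "norm (C / (1 + norm x) ^ m) \<le> norm (C * (\<Prod>b\<in>Basis. ?f (x \<bullet> b)))"
        by (simp add: abs_mult abs_prod)
    qed
  qed auto
qed

lemma integrable_bounded_by_weight:
  fixes f :: "'a::euclidean_space \<Rightarrow> complex"
  assumes "f \<in> borel_measurable borel" "2 * DIM('a) \<le> m" "\<And>x. norm (f x) \<le> C / (1 + norm x) ^ m"
  shows "integrable lborel f"
  using assms by (intro Bochner_Integration.integrable_bound[OF integrable_weight[OF assms(2), of C]])
    (auto intro!: AE_I2 order_trans[OF assms(3)] divide_right_mono)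

lemma schwartz_measurable [measurable_dest]: "schwartz f \<Longrightarrow> f \<in> borel_measurable borel"
  by (intro smooth_measurable schwartz_smooth)

lemma schwartz_integrable:
  fixes f :: "'a::euclidean_space \<Rightarrow> complex"
  assumes "schwartz f" shows "integrable lborel f"
  by (rule integrable_bounded_by_weight[OF schwartz_measurable[OF assms] order_refl
    deriv_bound_norm[OF deriv_bound_schwartz_norm[OF assms le0 order_refl]]])

section \<open>Taylor estimates\<close>

lemma lipschitz_deriv_bound:
  fixes f :: "'a::euclidean_space \<Rightarrow> complex" and W :: real
  assumes "deriv_bound (Suc 0) (\<lambda>_. W) f"
  shows "norm (f y - f x) \<le> DIM('a) * W * norm (y - x)"
proof -
  have d: "(f has_derivative (\<lambda>h. \<Sum>b\<in>Basis. (h \<bullet> b) *\<^sub>R pdiff b f z)) (at z within UNIV)" for z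
    using assms by (auto intro: has_derivative_pdiff)
  have "onorm (\<lambda>h. \<Sum>b\<in>Basis. (h \<bullet> b) *\<^sub>R pdiff b f z) \<le> DIM('a) * W" for z
  proof (rule onorm_le)
    fix h :: 'a
    have "norm (\<Sum>b\<in>Basis. (h \<bullet> b) *\<^sub>R pdiff b f z) \<le> (\<Sum>b\<in>(Basis::'a set). norm h * W)"
      using assms by (intro sum_norm_le) (auto simp: Basis_le_norm intro!: mult_mono)
    then show "norm (\<Sum>b\<in>Basis. (h \<bullet> b) *\<^sub>R pdiff b f z) \<le> DIM('a) * W * norm h"
      by (simp add: algebra_simps)
  qed
  from differentiable_bound[OF convex_UNIV d this UNIV_I UNIV_I] show ?thesis
    by simp
qed

lemma taylor_deriv_bound:
  fixes f :: "'a::euclidean_space \<Rightarrow> complex" and W :: real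
  assumes f: "deriv_bound 2 (\<lambda>_. W) f"
  shows "norm (f y - f x - (\<Sum>b\<in>Basis. ((y - x) \<bullet> b) *\<^sub>R pdiff b f x)) \<le> (DIM('a))\<^sup>2 * W * (norm (y - x))\<^sup>2"
proof -
  let ?D = "\<lambda>z h. \<Sum>b\<in>Basis. (h \<bullet> b) *\<^sub>R pdiff b f z"
  have W: "0 \<le> W" using deriv_bound_nonneg[OF f] .
  have d: "(f has_derivative ?D z) (at z within S)" for z S
    by (rule has_derivative_at_withinI[OF has_derivative_pdiff]) (use f in \<open>simp add: numeral_2_eq_2\<close>)
  have "onorm (?D z - ?D x) \<le> (DIM('a))\<^sup>2 * W * norm (y - x)" if z: "z \<in> closed_segment x y" for z
  proof (rule onorm_le)
    fix h :: 'a
    have "norm (pdiff b f z - pdiff b f x) \<le> DIM('a) * W * norm (y - x)" if b: "b \<in> Basis" for b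
    proof -
      have "norm (pdiff b f z - pdiff b f x) \<le> DIM('a) * W * norm (z - x)"
        using f b by (intro lipschitz_deriv_bound) (simp add: numeral_2_eq_2)
      also have "\<dots> \<le> DIM('a) * W * norm (y - x)"
        using segment_bound1[OF z] W by (intro mult_left_mono) auto
      finally show ?thesis .
    qed
    then have "norm (\<Sum>b\<in>Basis. (h \<bullet> b) *\<^sub>R (pdiff b f z - pdiff b f x)) \<le>
        (\<Sum>b\<in>(Basis::'a set). norm h * (DIM('a) * W * norm (y - x)))"
      by (intro sum_norm_le) (auto simp: Basis_le_norm intro!: mult_mono)
    also have "\<dots> = (DIM('a))\<^sup>2 * W * norm (y - x) * norm h"
      by (simp add: power2_eq_square algebra_simps)
    finally show "norm ((?D z - ?D x) h) \<le> (DIM('a))\<^sup>2 * W * norm (y - x) * norm h"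
      by (simp add: sum_subtractf scaleR_diff_right)
  qed
  then have "norm (f y - f x - ?D x (y - x)) \<le> norm (y - x) * ((DIM('a))\<^sup>2 * W * norm (y - x))"
  proof (intro differentiable_bound_linearization[of x y "closed_segment x y" f ?D x, OF _ d])
    fix t :: real assume "t \<in> {0..1}"
    then show "x + t *\<^sub>R (y - x) \<in> closed_segment x y"
      unfolding closed_segment_def by (auto intro!: exI[of _ t] simp: algebra_simps)
  qed auto
  then show ?thesis by (simp add: power2_eq_square mult_ac)
qed

section \<open>Differentiation under the integral\<close>

lemma pdiff_measurable:
  assumes meas: "\<And>x. (\<lambda>w. h w x) \<in> borel_measurable M"
    and d: "\<And>w. w \<in> space M \<Longrightarrow> h w differentiable (at x)" and b: "b \<in> Basis"
  shows "(\<lambda>w. pdiff b (h w) x) \<in> borel_measurable M"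
proof (rule borel_measurable_LIMSEQ_metric)
  let ?t = "\<lambda>n. inverse (real (Suc n))"
  show "(\<lambda>w. (h w (x + ?t n *\<^sub>R b) - h w x) /\<^sub>R ?t n) \<in> borel_measurable M" for n
    using meas by measurable
  fix w assume "w \<in> space M"
  then have D: "(h w has_derivative frechet_derivative (h w) (at x)) (at x)" (is "(_ has_derivative ?D) _")
    using d by (simp add: frechet_derivative_works)
  have "filterlim (\<lambda>n. x + ?t n *\<^sub>R b) (nhds (x + 0 *\<^sub>R b)) sequentially"
    by (intro tendsto_intros LIMSEQ_inverse_real_of_nat)
  then have "filterlim (\<lambda>n. x + ?t n *\<^sub>R b) (at x) sequentially"
    using b nonzero_Basis[OF b] by (auto simp: filterlim_at)
  moreover have "((\<lambda>y. norm (h w y - h w x - ?D (y - x)) / norm (y - x)) \<longlongrightarrow> 0) (at x)"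
    using D by (simp add: has_derivative_iff_norm)
  ultimately have "(\<lambda>n. norm (h w (x + ?t n *\<^sub>R b) - h w x - ?D (?t n *\<^sub>R b)) / norm (?t n *\<^sub>R b)) \<longlonglongrightarrow> 0"
    by (auto dest: filterlim_compose)
  moreover have "norm (h w (x + ?t n *\<^sub>R b) - h w x - ?D (?t n *\<^sub>R b)) / norm (?t n *\<^sub>R b) =
      norm ((h w (x + ?t n *\<^sub>R b) - h w x) /\<^sub>R ?t n - pdiff b (h w) x)" for n
  proof -
    have "?D (?t n *\<^sub>R b) = ?t n *\<^sub>R pdiff b (h w) x"
      using linear_scale[OF has_derivative_linear[OF D]] by (simp add: pdiff_def)
    then have "h w (x + ?t n *\<^sub>R b) - h w x - ?D (?t n *\<^sub>R b) =
        ?t n *\<^sub>R ((h w (x + ?t n *\<^sub>R b) - h w x) /\<^sub>R ?t n - pdiff b (h w) x)"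
      by (simp add: scaleR_diff_right)
    then show ?thesis using b by simp
  qed
  ultimately show "(\<lambda>n. (h w (x + ?t n *\<^sub>R b) - h w x) /\<^sub>R ?t n) \<longlonglongrightarrow> pdiff b (h w) x"
    by (simp only: tendsto_norm_zero_iff LIM_zero_iff)
qed

text \<open>
  The bound on the second derivatives makes the Taylor remainder of each integrand at most a multiple
  of \<open>W w * (norm (y - x))\<^sup>2\<close>, and integration keeps it of second order.
\<close>
lemma has_derivative_integral:
  fixes h :: "'w::euclidean_space \<Rightarrow> 'a::euclidean_space \<Rightarrow> complex"
  assumes meas: "\<And>x. (\<lambda>w. h w x) \<in> borel_measurable M"
    and bd: "\<And>w. w \<in> space M \<Longrightarrow> deriv_bound 2 (\<lambda>_. W w) (h w)" and W: "integrable M W"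
  shows "((\<lambda>x. LINT w|M. h w x) has_derivative
    (\<lambda>v. \<Sum>b\<in>Basis. (v \<bullet> b) *\<^sub>R (LINT w|M. pdiff b (h w) x))) (at x)"
proof (rule has_derivativeI_sandwich[of 1])
  let ?D = "\<lambda>v. \<Sum>b\<in>Basis. (v \<bullet> b) *\<^sub>R (LINT w|M. pdiff b (h w) x)"
  define C where "C = (DIM('a))\<^sup>2 * (LINT w|M. W w)"
  show "bounded_linear ?D"
    by (intro bounded_linear_sum bounded_linear_scaleR_left[THEN bounded_linear_compose] bounded_linear_inner_left)
  have dh: "h w differentiable (at y)" if "w \<in> space M" for w y
    using bd[OF that] by (simp add: numeral_2_eq_2)
  have int: "integrable M (\<lambda>w. h w y)" for y
    using deriv_bound_norm[OF bd] by (intro Bochner_Integration.integrable_bound[OF W meas]) (auto intro!: AE_I2 order_trans[OF _ abs_ge_self])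
  have intd: "integrable M (\<lambda>w. pdiff b (h w) y)" if "b \<in> Basis" for b y
  proof (intro Bochner_Integration.integrable_bound[OF W pdiff_measurable] meas dh that AE_I2)
    fix w assume "w \<in> space M"
    then have "deriv_bound 1 (\<lambda>_. W w) (pdiff b (h w))" using bd that by (simp add: numeral_2_eq_2)
    from deriv_bound_norm[OF this] show "norm (pdiff b (h w) y) \<le> norm (W w)" by (auto intro: order_trans[OF _ abs_ge_self])
  qed
  show "norm ((LINT w|M. h w y) - (LINT w|M. h w x) - ?D (y - x)) / norm (y - x) \<le> C * norm (y - x)"
    if "y \<noteq> x" for y
  proof -
    have "(LINT w|M. h w y) - (LINT w|M. h w x) - ?D (y - x) =
      (LINT w|M. h w y - h w x - (\<Sum>b\<in>Basis. ((y - x) \<bullet> b) *\<^sub>R pdiff b (h w) x))"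
      using int intd by (simp add: Bochner_Integration.integral_sum)
    also have "norm \<dots> \<le> (LINT w|M. (DIM('a))\<^sup>2 * W w * (norm (y - x))\<^sup>2)"
      using int intd W
      by (intro Bochner_Integration.integral_norm_bound_integral taylor_deriv_bound bd) (auto intro!: Bochner_Integration.integrable_sum)
    also have "\<dots> = C * (norm (y - x))\<^sup>2" by (simp add: C_def)
    finally show ?thesis using that by (simp add: divide_le_eq power2_eq_square mult_ac)
  qed
  have "((\<lambda>y. C * norm (y - x)) \<longlongrightarrow> C * norm (x - x)) (at x)" by (intro tendsto_intros)
  then show "((\<lambda>y. C * norm (y - x)) \<longlongrightarrow> 0) (at x)" by simp
qed simp

lemma pdiff_integral:
  fixes h :: "'w::euclidean_space \<Rightarrow> 'a::euclidean_space \<Rightarrow> complex"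
  assumes "\<And>x. (\<lambda>w. h w x) \<in> borel_measurable M"
    and "\<And>w. w \<in> space M \<Longrightarrow> deriv_bound 2 (\<lambda>_. W w) (h w)" "integrable M W" "b \<in> Basis"
  shows "pdiff b (\<lambda>x. LINT w|M. h w x) = (\<lambda>x. LINT w|M. pdiff b (h w) x)"
proof (subst pdiff_eqI'[OF has_derivative_integral[OF assms(1-3)]], assumption, rule ext)
  fix x
  have "(\<Sum>c\<in>Basis. (b \<bullet> c) *\<^sub>R (LINT w|M. pdiff c (h w) x)) =
    (\<Sum>c\<in>Basis. if c = b then (LINT w|M. pdiff c (h w) x) else 0)"
    using assms(4) by (intro sum.cong) (auto simp: inner_Basis)
  then show "(\<Sum>c\<in>Basis. (b \<bullet> c) *\<^sub>R (LINT w|M. pdiff c (h w) x)) = (LINT w|M. pdiff b (h w) x)"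
    using assms(4) by simp
qed

text \<open>
  The bound \<open>W'\<close>, for two more orders but without the weight v, serves to differentiate under the integral;
  the weight v is then carried along by W.
\<close>
lemma deriv_bound_integral:
  fixes h :: "'w::euclidean_space \<Rightarrow> 'a::euclidean_space \<Rightarrow> complex"
  assumes "integrable M W" "integrable M W'"
  shows "(\<And>x. (\<lambda>w. h w x) \<in> borel_measurable M) \<Longrightarrow>
    (\<And>w. w \<in> space M \<Longrightarrow> deriv_bound k (\<lambda>x. W w * v x) (h w)) \<Longrightarrow>
    (\<And>w. w \<in> space M \<Longrightarrow> deriv_bound (k + 2) (\<lambda>_. W' w) (h w)) \<Longrightarrow>
    deriv_bound k (\<lambda>x. (LINT w|M. W w) * v x) (\<lambda>x. LINT w|M. h w x)"
proof (induction k arbitrary: h)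
  have bound: "norm (LINT w|M. h w x) \<le> (LINT w|M. W w) * v x"
    if "\<And>x. (\<lambda>w. h w x) \<in> borel_measurable M" "\<And>w. w \<in> space M \<Longrightarrow> norm (h w x) \<le> W w * v x"
    for h :: "'w \<Rightarrow> 'a \<Rightarrow> complex" and x
  proof -
    have int: "integrable M (\<lambda>w. W w * v x)" using assms(1) by simp
    have "integrable M (\<lambda>w. h w x)"
      by (rule Bochner_Integration.integrable_bound[OF int that(1)])
        (auto intro!: AE_I2 intro: order_trans[OF that(2) abs_ge_self])
    then have "norm (LINT w|M. h w x) \<le> (LINT w|M. W w * v x)"
      using int that(2) by (rule Bochner_Integration.integral_norm_bound_integral)
    then show ?thesis by simp
  qed
  {
    case 0
    then show ?case using bound[of h, OF 0(1)] by simp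
  next
    case (Suc k)
    have 2: "deriv_bound 2 (\<lambda>_. W' w) (h w)" if "w \<in> space M" for w
      using Suc.prems(3)[OF that] by (rule deriv_bound_le) auto
    have dh: "h w differentiable (at y)" if "w \<in> space M" for w y
      using 2[OF that] by (simp add: numeral_2_eq_2)
    have "(\<lambda>x. LINT w|M. h w x) differentiable (at x)" for x
      using has_derivative_integral[OF Suc.prems(1) 2 assms(2)] differentiable_def by blast
    moreover have "norm (LINT w|M. h w x) \<le> (LINT w|M. W w) * v x" for x
      using Suc.prems by (intro bound) (auto intro: deriv_bound_norm)
    moreover have "deriv_bound k (\<lambda>x. (LINT w|M. W w) * v x) (pdiff b (\<lambda>x. LINT w|M. h w x))" if "b \<in> Basis" for b
    proof -
      have "deriv_bound k (\<lambda>x. (LINT w|M. W w) * v x) (\<lambda>x. LINT w|M. pdiff b (h w) x)"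
        using Suc.prems(2,3) that by (intro Suc.IH pdiff_measurable Suc.prems(1) dh) auto
      then show ?thesis using pdiff_integral[of h M W' b, OF Suc.prems(1) 2 assms(2) that] by simp
    qed
    ultimately show ?case by simp
  }
qed

section \<open>Functions on a product space\<close>

lemma pdiff_compose:
  assumes "(g has_derivative A) (at x)" "f differentiable (at (g x))"
  shows "pdiff b (\<lambda>x. f (g x)) x = pdiff (A b) f (g x)"
  using pdiff_eqI[OF has_derivative_compose[OF assms(1)], of f "frechet_derivative f (at (g x))"] assms(2)
  by (simp add: pdiff_def frechet_derivative_works)

lemma pdiff_slice2:
  fixes H :: "'w::euclidean_space \<times> 'a::euclidean_space \<Rightarrow> complex"
  assumes "smooth H" shows "pdiff b (\<lambda>x. H (w, x)) = (\<lambda>x. pdiff (0, b) H (w, x))"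
proof
  fix x :: 'a
  have "((\<lambda>x. (w, x)) has_derivative (\<lambda>h. (0, h))) (at x)" by (auto intro!: derivative_eq_intros)
  from pdiff_compose[OF this, of H b] show "pdiff b (\<lambda>x. H (w, x)) x = pdiff (0, b) H (w, x)"
    using smooth_differentiable[OF assms] by simp
qed

lemma pdiff_slice1:
  fixes H :: "'w::euclidean_space \<times> 'a::euclidean_space \<Rightarrow> complex"
  assumes "smooth H" shows "pdiff b (\<lambda>w. H (w, x)) = (\<lambda>w. pdiff (b, 0) H (w, x))"
proof
  fix w :: 'w
  have "((\<lambda>w. (w, x)) has_derivative (\<lambda>h. (h, 0))) (at w)" by (auto intro!: derivative_eq_intros)
  from pdiff_compose[OF this, of H b] show "pdiff b (\<lambda>w. H (w, x)) w = pdiff (b, 0) H (w, x)"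
    using smooth_differentiable[OF assms] by simp
qed

lemma Pair_weight:
  assumes "0 \<le> C"
  shows "C / (1 + norm (w, x)) ^ (m + n) \<le> C / ((1 + norm w) ^ m * (1 + norm x) ^ n)"
proof -
  have "(1 + norm w) ^ m * (1 + norm x) ^ n \<le> (1 + norm (w, x)) ^ m * (1 + norm (w, x)) ^ n"
    by (intro mult_mono power_mono add_mono) (auto simp: norm_fst_le norm_snd_le)
  then show ?thesis using assms
    by (intro divide_left_mono) (auto simp: power_add add_pos_nonneg intro!: mult_pos_pos)
qed

lemma deriv_bound_slice:
  fixes H :: "'w::euclidean_space \<times> 'a::euclidean_space \<Rightarrow> complex"
  assumes H: "deriv_bound k (decay C (m + n)) H"
  shows "deriv_bound k (\<lambda>x. C / ((1 + norm w) ^ m * (1 + norm x) ^ n)) (\<lambda>x. H (w, x))"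
    and "deriv_bound k (\<lambda>w. C / ((1 + norm w) ^ m * (1 + norm x) ^ n)) (\<lambda>w. H (w, x))"
proof -
  have C: "0 \<le> C" using deriv_bound_nonneg[OF H, of 0] by simp
  have d2: "((\<lambda>x. (w, x)) has_derivative (\<lambda>h. (0, h))) (at x)" for w :: 'w and x :: 'a
    by (auto intro!: derivative_eq_intros)
  have d1: "((\<lambda>w. (w, x)) has_derivative (\<lambda>h. (h, 0))) (at w)" for w :: 'w and x :: 'a
    by (auto intro!: derivative_eq_intros)
  show "deriv_bound k (\<lambda>x. C / ((1 + norm w) ^ m * (1 + norm x) ^ n)) (\<lambda>x. H (w, x))"
    by (rule deriv_bound_mono[OF deriv_bound_pullback[OF d2 order_refl sum_abs_Basis_le H]])
      (use Pair_weight[OF C] in \<open>auto simp: Basis_prod_def\<close>)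
  show "deriv_bound k (\<lambda>w. C / ((1 + norm w) ^ m * (1 + norm x) ^ n)) (\<lambda>w. H (w, x))"
    by (rule deriv_bound_mono[OF deriv_bound_pullback[OF d1 order_refl sum_abs_Basis_le H]])
      (use Pair_weight[OF C] in \<open>auto simp: Basis_prod_def\<close>)
qed

lemma schwartz_slice_bound:
  assumes "schwartz H"
  obtains C where "0 \<le> C"
    "\<And>w. deriv_bound k (\<lambda>x. C / ((1 + norm w) ^ m * (1 + norm x) ^ n)) (\<lambda>x. H (w, x))"
    "\<And>x. deriv_bound k (\<lambda>w. C / ((1 + norm w) ^ m * (1 + norm x) ^ n)) (\<lambda>w. H (w, x))"
proof -
  obtain C where C: "deriv_bound k (decay C (m + n)) H"
    using assms schwartz_iff by blast
  have "0 \<le> C" using deriv_bound_nonneg[OF C, of 0] by simp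
  with that deriv_bound_slice[OF C] show ?thesis by blast
qed

lemma schwartz_slice: assumes "schwartz H" shows "schwartz (\<lambda>x. H (w, x))" "schwartz (\<lambda>w. H (w, x))"
proof -
  show "schwartz (\<lambda>x. H (w, x))" unfolding schwartz_iff
  proof (intro allI)
    fix k m
    obtain C where "deriv_bound k (\<lambda>x. C / ((1 + norm w) ^ 0 * (1 + norm x) ^ m)) (\<lambda>x. H (w, x))"
      using schwartz_slice_bound[OF assms] by metis
    then show "\<exists>C. deriv_bound k (decay C m) (\<lambda>x. H (w, x))" by auto
  qed
  show "schwartz (\<lambda>w. H (w, x))" unfolding schwartz_iff
  proof (intro allI)
    fix k m
    obtain C where "deriv_bound k (\<lambda>w. C / ((1 + norm w) ^ m * (1 + norm x) ^ 0)) (\<lambda>w. H (w, x))"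
      using schwartz_slice_bound[OF assms] by metis
    then show "\<exists>C. deriv_bound k (decay C m) (\<lambda>w. H (w, x))" by auto
  qed
qed

lemma schwartz_slice1_bound2:
  fixes H :: "'w::euclidean_space \<times> 'a::euclidean_space \<Rightarrow> complex"
  assumes "schwartz H"
  obtains W where "integrable lborel W" "\<And>x. deriv_bound k (\<lambda>_. W x) (\<lambda>w. H (w, x))"
proof -
  obtain C where "\<And>x. deriv_bound k (\<lambda>w. C / ((1 + norm w) ^ 0 * (1 + norm x) ^ (2 * DIM('a)))) (\<lambda>w. H (w, x))"
    using schwartz_slice_bound[OF assms, of k 0 "2 * DIM('a)"] by metis
  then show ?thesis using integrable_weight[of "2 * DIM('a)" C, OF order_refl]
    by (intro that) auto
qed

lemma pdiff_integral_schwartz: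
  fixes H :: "'w::euclidean_space \<times> 'a::euclidean_space \<Rightarrow> complex"
  assumes "schwartz H" "b \<in> Basis"
  shows "pdiff b (\<lambda>w. LINT x|lborel. H (w, x)) = (\<lambda>w. LINT x|lborel. pdiff (b, 0) H (w, x))"
proof -
  obtain W where W: "integrable lborel W" "\<And>x. deriv_bound 2 (\<lambda>_. W x) (\<lambda>w. H (w, x))"
    using schwartz_slice1_bound2[OF assms(1)] by blast
  have "(\<lambda>x. H (w, x)) \<in> borel_measurable lborel" for w
    using schwartz_measurable[OF schwartz_slice(1)[OF assms(1)]] by simp
  from pdiff_integral[OF this W(2) W(1) assms(2)] show ?thesis
    by (simp add: pdiff_slice1[OF schwartz_smooth[OF assms(1)]])
qed

lemma lborel_integral_translation:
  fixes f :: "'a::euclidean_space \<Rightarrow> complex"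
  assumes "f \<in> borel_measurable borel"
  shows "(LINT x|lborel. f (x + v)) = (LINT x|lborel. f x)"
proof -
  have "(LINT x|lborel. f x) = (LINT x|distr lborel borel ((+) v). f x)"
    by (simp only: lborel_distr_plus)
  also have "\<dots> = (LINT x|lborel. f (v + x))" using assms by (intro integral_distr) auto
  finally show ?thesis by (simp add: add.commute)
qed

text \<open>
  The integral of \<open>\<psi> (x + t b)\<close> over x does not depend on t, and its derivative at \<open>t = 0\<close> is the integral of
  the partial derivative. The factor \<open>cutoff t\<close> makes the integrand a Schwartz function of (t, x), for
  which differentiation under the integral is available.
\<close>
lemma integral_pdiff_eq_0:
  fixes \<psi> :: "'a::euclidean_space \<Rightarrow> complex"
  assumes \<psi>: "schwartz \<psi>" and b: "b \<in> Basis"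
  shows "(LINT x|lborel. pdiff b \<psi> x) = 0"
proof -
  define K where "K = (\<lambda>(t::real, x::'a). cutoff t * \<psi> (x + t *\<^sub>R b))"
  have "schwartz (\<lambda>(x, t::real). \<psi> x * cutoff t)"
    by (intro schwartz_cont_schwartz[OF schwartz_cont_tensor] \<psi> test_function_schwartz test_function_cutoff)
  then have "schwartz (\<lambda>z. (\<lambda>(x, t::real). \<psi> x * cutoff t) ((\<lambda>(t, x). (x + t *\<^sub>R b, t)) z))"
    by (rule schwartz_cont_schwartz[OF schwartz_cont_pullback[where A = "\<lambda>(t, x). (x + t *\<^sub>R b, t)" and
       h = "\<lambda>(x, t). (t, x - t *\<^sub>R b)" and B = "\<lambda>(x, t). (t, x - t *\<^sub>R b)"], rotated 3])
      (auto intro!: derivative_eq_intros simp: case_prod_beta')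
  then have K: "schwartz K" by (simp add: K_def case_prod_beta' mult.commute)
  have shift: "(LINT x|lborel. \<psi> (x + v)) = (LINT x|lborel. \<psi> x)" for v
    by (rule lborel_integral_translation[OF schwartz_measurable[OF \<psi>]])
  have near: "0 \<in> ball (0::real) 1" "open (ball (0::real) 1)" by auto
  have "pdiff (1, 0) K (0, x) = pdiff b \<psi> x" for x
  proof -
    have "pdiff (1, 0) K (0, x) = pdiff 1 (\<lambda>t. K (t, x)) 0"
      by (simp add: pdiff_slice1[OF schwartz_smooth[OF K]])
    also have "\<dots> = pdiff b \<psi> x"
    proof (rule trans[OF pdiff_eqI[where D = "\<lambda>h. pdiff (h *\<^sub>R b) \<psi> x"]])
      have "((\<lambda>t::real. x + t *\<^sub>R b) has_derivative (\<lambda>h. h *\<^sub>R b)) (at 0)" by (auto intro!: derivative_eq_intros)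
      from has_derivative_compose[OF this, of \<psi>] smooth_differentiable[OF schwartz_smooth[OF \<psi>]]
      have "((\<lambda>t. \<psi> (x + t *\<^sub>R b)) has_derivative (\<lambda>h. pdiff (h *\<^sub>R b) \<psi> x)) (at 0)"
        by (simp add: pdiff_def frechet_derivative_works)
      then show "((\<lambda>t. K (t, x)) has_derivative (\<lambda>h. pdiff (h *\<^sub>R b) \<psi> x)) (at 0)"
        by (rule has_derivative_transform_within_open[OF _ near(2) near(1)])
          (auto simp: K_def cutoff_eq_1)
    qed simp
    finally show ?thesis .
  qed
  then have "(LINT x|lborel. pdiff b \<psi> x) = pdiff 1 (\<lambda>t. LINT x|lborel. K (t, x)) 0"
    by (subst pdiff_integral_schwartz[OF K]) auto
  also have "\<dots> = 0"
  proof (rule pdiff_eqI)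
    have "((\<lambda>_. LINT x|lborel. \<psi> x) has_derivative (\<lambda>_. 0)) (at (0::real))" by simp
    then show "((\<lambda>t. LINT x|lborel. K (t, x)) has_derivative (\<lambda>_. 0)) (at 0)"
      by (rule has_derivative_transform_within_open[OF _ near(2) near(1)])
        (auto simp: K_def cutoff_eq_1 shift)
  qed
  finally show ?thesis .
qed

section \<open>Partial Fourier transform\<close>

text \<open>
  Suppose that differentiating \<open>F \<phi>\<close>, or multiplying it by a coordinate, amounts to applying F to the image
  of \<open>\<phi>\<close> under a continuous operator. Then a single supremum bound for F suffices: applied to such images
  it yields the decay of \<open>F \<phi>\<close>, and this yields the decay of its derivatives.
\<close>
lemma schwartz_cont_intertwining:
  fixes F :: "('a::euclidean_space \<Rightarrow> complex) \<Rightarrow> ('b::euclidean_space \<Rightarrow> complex)"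
  assumes base: "\<exists>N C. 0 \<le> C \<and> (\<forall>\<phi> x. schwartz \<phi> \<longrightarrow> norm (F \<phi> x) \<le> C * schwartz_norm N \<phi>)"
    and diff: "\<And>\<phi> x. schwartz \<phi> \<Longrightarrow> F \<phi> differentiable (at x)"
    and D: "\<And>b. b \<in> Basis \<Longrightarrow> \<exists>D. schwartz_cont D \<and> (\<forall>\<phi>. schwartz \<phi> \<longrightarrow> pdiff b (F \<phi>) = F (D \<phi>))"
    and X: "\<And>b. b \<in> Basis \<Longrightarrow> \<exists>X. schwartz_cont X \<and> (\<forall>\<phi> x. schwartz \<phi> \<longrightarrow> of_real (x \<bullet> b) * F \<phi> x = F (X \<phi>) x)"
  shows "schwartz_cont F"
proof -
  \<comment> \<open>Finitely many continuous operators have a common continuity estimate.\<close>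
  have combine: "\<exists>N' C'. 0 \<le> C' \<and> (\<forall>\<phi>. schwartz \<phi> \<longrightarrow>
      schwartz_norm N \<phi> + (\<Sum>b\<in>(Basis::'b set). schwartz_norm N (G b \<phi>)) \<le> C' * schwartz_norm N' \<phi>)"
    if G: "\<And>b. b \<in> Basis \<Longrightarrow> schwartz_cont (G b)"
    for G :: "'b \<Rightarrow> ('a \<Rightarrow> complex) \<Rightarrow> ('a \<Rightarrow> complex)" and N
  proof -
    have "\<forall>b. \<exists>Nb Cb. b \<in> Basis \<longrightarrow> 0 \<le> Cb \<and> (\<forall>\<phi>. schwartz \<phi> \<longrightarrow> schwartz_norm N (G b \<phi>) \<le> Cb * schwartz_norm Nb \<phi>)"
      using G unfolding schwartz_cont_def by metis
    then obtain Nb Cb where Cb: "\<And>b. b \<in> Basis \<Longrightarrow> 0 \<le> Cb b"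
      and le: "\<And>b \<phi>. b \<in> Basis \<Longrightarrow> schwartz \<phi> \<Longrightarrow> schwartz_norm N (G b \<phi>) \<le> Cb b * schwartz_norm (Nb b) \<phi>"
      by metis
    define N' where "N' = N + (\<Sum>b\<in>Basis. Nb b)"
    have Nb: "Nb b \<le> N'" if "b \<in> Basis" for b
      using member_le_sum[OF that, of Nb] by (simp add: N'_def)
    have "schwartz_norm N \<phi> + (\<Sum>b\<in>Basis. schwartz_norm N (G b \<phi>)) \<le> (1 + (\<Sum>b\<in>Basis. Cb b)) * schwartz_norm N' \<phi>"
      if s: "schwartz \<phi>" for \<phi>
    proof -
      have "schwartz_norm N (G b \<phi>) \<le> Cb b * schwartz_norm N' \<phi>" if "b \<in> Basis" for b
        using le[OF that s] mult_left_mono[OF schwartz_norm_mono[OF s Nb[OF that]] Cb[OF that]] by linarith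
      then have "(\<Sum>b\<in>Basis. schwartz_norm N (G b \<phi>)) \<le> (\<Sum>b\<in>Basis. Cb b * schwartz_norm N' \<phi>)"
        by (intro sum_mono)
      moreover have "schwartz_norm N \<phi> \<le> schwartz_norm N' \<phi>" by (intro schwartz_norm_mono s) (simp add: N'_def)
      ultimately show ?thesis by (simp add: distrib_right sum_distrib_right)
    qed
    moreover have "0 \<le> 1 + (\<Sum>b\<in>Basis. Cb b)" using Cb by (simp add: sum_nonneg)
    ultimately show ?thesis by blast
  qed
  obtain D where D: "\<And>b. b \<in> Basis \<Longrightarrow> schwartz_cont (D b)"
    "\<And>b \<phi>. b \<in> Basis \<Longrightarrow> schwartz \<phi> \<Longrightarrow> pdiff b (F \<phi>) = F (D b \<phi>)"
    using D by metis
  obtain X where X: "\<And>b. b \<in> Basis \<Longrightarrow> schwartz_cont (X b)"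
    "\<And>b \<phi> x. b \<in> Basis \<Longrightarrow> schwartz \<phi> \<Longrightarrow> of_real (x \<bullet> b) * F \<phi> x = F (X b \<phi>) x"
    using X by metis
  have decay: "\<exists>N C. 0 \<le> C \<and> (\<forall>\<phi> x. schwartz \<phi> \<longrightarrow> (1 + norm x) ^ m * norm (F \<phi> x) \<le> C * schwartz_norm N \<phi>)" for m
  proof (induction m)
    case 0
    show ?case using base by simp
  next
    case (Suc m)
    then obtain N C where C: "0 \<le> C"
      and NC: "\<And>\<phi> x. schwartz \<phi> \<Longrightarrow> (1 + norm x) ^ m * norm (F \<phi> x) \<le> C * schwartz_norm N \<phi>" by blast
    obtain N' C' where C': "0 \<le> C'" and N': "\<And>\<phi>. schwartz \<phi> \<Longrightarrow>
        schwartz_norm N \<phi> + (\<Sum>b\<in>Basis. schwartz_norm N (X b \<phi>)) \<le> C' * schwartz_norm N' \<phi>"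
      using combine[of X N] X(1) by blast
    have "(1 + norm x) ^ Suc m * norm (F \<phi> x) \<le> C * C' * schwartz_norm N' \<phi>" if s: "schwartz \<phi>" for \<phi> x
    proof -
      let ?w = "(1 + norm x) ^ m"
      have "norm x \<le> (\<Sum>b\<in>Basis. \<bar>x \<bullet> b\<bar>)" by (rule norm_le_l1)
      then have "(1 + norm x) ^ Suc m * norm (F \<phi> x) \<le> (1 + (\<Sum>b\<in>Basis. \<bar>x \<bullet> b\<bar>)) * (?w * norm (F \<phi> x))"
        by (simp add: mult.assoc mult_right_mono)
      also have "\<dots> = ?w * norm (F \<phi> x) + (\<Sum>b\<in>Basis. \<bar>x \<bullet> b\<bar> * (?w * norm (F \<phi> x)))"
        by (simp only: distrib_right sum_distrib_right mult_1)
      also have "\<dots> = ?w * norm (F \<phi> x) + (\<Sum>b\<in>Basis. ?w * norm (of_real (x \<bullet> b) * F \<phi> x))"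
        by (simp add: norm_mult mult.left_commute)
      also have "\<dots> = ?w * norm (F \<phi> x) + (\<Sum>b\<in>Basis. ?w * norm (F (X b \<phi>) x))"
        using X(2) s by simp
      also have "\<dots> \<le> C * schwartz_norm N \<phi> + (\<Sum>b\<in>Basis. C * schwartz_norm N (X b \<phi>))"
        using s X(1) by (intro add_mono sum_mono NC) (auto intro: schwartz_cont_schwartz)
      also have "\<dots> \<le> C * (C' * schwartz_norm N' \<phi>)"
        using mult_left_mono[OF N'[OF s] C] by (simp add: distrib_left sum_distrib_left)
      finally show ?thesis by (simp add: mult.assoc)
    qed
    then show ?case using C C' by (intro exI[of _ N'] exI[of _ "C * C'"]) auto
  qed
  have main: "\<exists>N C. 0 \<le> C \<and> (\<forall>\<phi>. schwartz \<phi> \<longrightarrow> deriv_bound k (decay (C * schwartz_norm N \<phi>) m) (F \<phi>))" for k m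
  proof (induction k)
    case 0
    show ?case using decay[of m] by (simp add: pos_le_divide_eq add_pos_nonneg mult.commute)
  next
    case (Suc k)
    then obtain N C where C: "0 \<le> C"
      and NC: "\<And>\<phi>. schwartz \<phi> \<Longrightarrow> deriv_bound k (decay (C * schwartz_norm N \<phi>) m) (F \<phi>)" by blast
    obtain N' C' where C': "0 \<le> C'" and N': "\<And>\<phi>. schwartz \<phi> \<Longrightarrow>
        schwartz_norm N \<phi> + (\<Sum>b\<in>Basis. schwartz_norm N (D b \<phi>)) \<le> C' * schwartz_norm N' \<phi>"
      using combine[of D N] D(1) by blast
    have "deriv_bound (Suc k) (decay (C * C' * schwartz_norm N' \<phi>) m) (F \<phi>)" if s: "schwartz \<phi>" for \<phi>
    proof -
      have sD: "schwartz (D b \<phi>)" if "b \<in> Basis" for b using D(1)[OF that] s by (rule schwartz_cont_schwartz)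
      have nn: "0 \<le> schwartz_norm N (D b \<phi>)" if "b \<in> Basis" for b using schwartz_norm_nonneg sD[OF that] .
      have "deriv_bound k (decay (C * C' * schwartz_norm N' \<phi>) m) (pdiff b (F \<phi>))" if b: "b \<in> Basis" for b
        unfolding D(2)[OF b s]
      proof (rule deriv_bound_weight_le[OF NC[OF sD[OF b]]])
        have "schwartz_norm N (D b \<phi>) \<le> (\<Sum>b\<in>Basis. schwartz_norm N (D b \<phi>))"
          using member_le_sum[OF b, of "\<lambda>b. schwartz_norm N (D b \<phi>)"] nn by simp
        also have "\<dots> \<le> C' * schwartz_norm N' \<phi>" using N'[OF s] schwartz_norm_nonneg[OF s, of N] by linarith
        finally show "C * schwartz_norm N (D b \<phi>) \<le> C * C' * schwartz_norm N' \<phi>"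
          using C by (simp add: mult.assoc mult_left_mono)
      qed auto
      moreover have "deriv_bound 0 (decay (C * C' * schwartz_norm N' \<phi>) m) (F \<phi>)"
      proof (rule deriv_bound_weight_le[OF NC[OF s]])
        have "0 \<le> (\<Sum>b\<in>Basis. schwartz_norm N (D b \<phi>))" using nn by (intro sum_nonneg)
        then have "schwartz_norm N \<phi> \<le> C' * schwartz_norm N' \<phi>" using N'[OF s] by linarith
        then show "C * schwartz_norm N \<phi> \<le> C * C' * schwartz_norm N' \<phi>"
          using C by (simp add: mult.assoc mult_left_mono)
      qed auto
      ultimately show ?thesis using diff[OF s] by simp
    qed
    then show ?case using C C' by (intro exI[of _ N'] exI[of _ "C * C'"]) auto
  qed
  show ?thesis unfolding schwartz_cont_def
  proof (intro conjI allI impI)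
    fix \<phi> :: "'a \<Rightarrow> complex" assume s: "schwartz \<phi>"
    have "\<exists>C. deriv_bound k (decay C m) (F \<phi>)" for k m
      using main[of k m] s by blast
    then show "schwartz (F \<phi>)" by (simp add: schwartz_iff)
  next
    fix N
    obtain N' C where "0 \<le> C" "\<And>\<phi>. schwartz \<phi> \<Longrightarrow> deriv_bound N (decay (C * schwartz_norm N' \<phi>) N) (F \<phi>)"
      using main[of N N] by blast
    then show "\<exists>N' C. 0 \<le> C \<and> (\<forall>\<phi>. schwartz \<phi> \<longrightarrow> schwartz_norm N (F \<phi>) \<le> C * schwartz_norm N' \<phi>)"
      by (intro exI[of _ N'] exI[of _ C]) (auto intro: schwartz_norm_leI)
  qed
qed

definition fourier_char :: "'a::euclidean_space \<Rightarrow> 'a \<Rightarrow> complex" where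
  "fourier_char u x = exp (- 2 * pi * \<i> * of_real (x \<bullet> u))"

lemma fourier_alt: "fourier f x = (LINT u|lborel. fourier_char u x * f u)"
  by (simp add: fourier_def fourier_char_def)

lemma norm_fourier_char [simp]: "norm (fourier_char u x) = 1"
  by (simp add: fourier_char_def)

lemma linear_char_exponent: "linear (\<lambda>x. c * complex_of_real (x \<bullet> u))"
  by (rule linearI) (auto simp: inner_add_left algebra_simps scaleR_conv_of_real)

lemma fourier_char_has_derivative:
  "(fourier_char u has_derivative (\<lambda>h. - 2 * pi * \<i> * of_real (h \<bullet> u) * fourier_char u x)) (at x)"
  unfolding fourier_char_def[abs_def]
  using has_derivative_compose[OF linear_imp_has_derivative[OF linear_char_exponent]
        DERIV_exp[unfolded has_field_derivative_def], of "- 2 * pi * \<i>" u x]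
  by (simp add: mult.commute)

lemma fourier_char_commute: "fourier_char u x = fourier_char x u"
  by (simp add: fourier_char_def inner_commute)

lemma deriv_bound_fourier_char: "deriv_bound k (\<lambda>_. (2 * pi * (1 + norm u)) ^ k) (fourier_char u)"
proof -
  let ?A = "\<lambda>x. - 2 * pi * \<i> * complex_of_real (x \<bullet> u)"
  have "deriv_bound k (\<lambda>x. (2 * pi * (1 + norm u)) ^ k * exp (Re (?A x))) (\<lambda>x. exp (?A x))"
  proof (rule deriv_bound_exp[OF linear_char_exponent])
    have "1 * 1 \<le> 2 * pi * (1 + norm u)" using pi_ge_two by (intro mult_mono) auto
    then show "1 \<le> 2 * pi * (1 + norm u)" by simp
    fix b :: 'a assume "b \<in> Basis"
    then have "\<bar>b \<bullet> u\<bar> \<le> 1 + norm u" using Basis_le_norm[of b u] by (simp add: inner_commute)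
    then show "norm (?A b) \<le> 2 * pi * (1 + norm u)" by (simp add: norm_mult)
  qed
  then show ?thesis by (simp add: fourier_char_def[abs_def])
qed

lemma smooth_fourier_char: "smooth (fourier_char u)"
  using deriv_bound_fourier_char by (blast intro: smoothI)

lemma multiplier_fourier_char: "multiplier (fourier_char u)"
  unfolding multiplier_def
proof
  fix k
  show "\<exists>C m. deriv_bound k (\<lambda>x. C * (1 + norm x) ^ m) (fourier_char u)"
    using deriv_bound_fourier_char[of k u] by (intro exI[of _ "(2 * pi * (1 + norm u)) ^ k"] exI[of _ 0]) simp
qed

lemma fourier_char_measurable [measurable]: "fourier_char u \<in> borel_measurable borel"
  by (rule smooth_measurable[OF smooth_fourier_char])

lemma fourier_char_measurable2 [measurable]: "(\<lambda>u. fourier_char u x) \<in> borel_measurable borel"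
  unfolding fourier_char_commute[of _ x] by measurable

definition partial_fourier ::
  "('a::euclidean_space \<times> 'b::euclidean_space \<Rightarrow> complex) \<Rightarrow> 'a \<times> 'b \<Rightarrow> complex" where
  "partial_fourier \<phi> = (\<lambda>(x, k). fourier (\<lambda>u. \<phi> (u, k)) x)"

lemma partial_fourier_alt:
  "partial_fourier \<phi> = (\<lambda>z. LINT u|lborel. fourier_char u (fst z) * \<phi> (u, snd z))"
  by (auto simp: partial_fourier_def fourier_alt)



lemma partial_fourier_integrand_bound:
  fixes \<phi> :: "'a::euclidean_space \<times> 'b::euclidean_space \<Rightarrow> complex"
  assumes "schwartz \<phi>"
  obtains W where "integrable lborel W"
    "\<And>u. deriv_bound k (\<lambda>_. W u) (\<lambda>z::'a \<times> 'b. fourier_char u (fst z) * \<phi> (u, snd z))"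
proof -
  let ?n = "2 * DIM('a)"
  obtain C where C: "0 \<le> C"
    "\<And>u. deriv_bound k (\<lambda>x. C / ((1 + norm u) ^ (k + ?n) * (1 + norm x) ^ 0)) (\<lambda>x. \<phi> (u, x))"
    using schwartz_slice_bound[OF assms] by metis
  define D where "D = 2 ^ k * (2 * pi) ^ k * C"
  have "deriv_bound k (\<lambda>_. D / (1 + norm u) ^ ?n) (\<lambda>z::'a \<times> 'b. fourier_char u (fst z) * \<phi> (u, snd z))" for u
  proof (rule deriv_bound_mono[OF deriv_bound_mult[OF deriv_bound_fst[OF deriv_bound_fourier_char] deriv_bound_snd[OF C(2)]]])
    fix z :: "'a \<times> 'b"
    have "1 + norm u \<noteq> 0" using norm_ge_zero[of u] by linarith
    then show "2 ^ k * (2 * pi * (1 + norm u)) ^ k * (C / ((1 + norm u) ^ (k + ?n) * (1 + norm (snd z)) ^ 0)) \<le> D / (1 + norm u) ^ ?n"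
      by (simp add: D_def power_mult_distrib power_add)
  qed
  then show ?thesis using integrable_weight[OF order_refl, where C = D and 'a = 'a] by (intro that)
qed

lemma partial_fourier_integrand_measurable:
  assumes "schwartz \<phi>"
  shows "(\<lambda>u. fourier_char u (fst z) * \<phi> (u, snd z)) \<in> borel_measurable lborel"
  using schwartz_measurable[OF schwartz_slice(2)[OF assms]] by simp

lemma pdiff_partial_fourier:
  fixes \<phi> :: "'a::euclidean_space \<times> 'b::euclidean_space \<Rightarrow> complex"
  assumes s: "schwartz \<phi>" and b: "b \<in> Basis"
  shows "pdiff b (partial_fourier \<phi>) =
    partial_fourier (\<lambda>z. (- 2 * pi * \<i>) * (of_real (fst b \<bullet> fst z) * \<phi> z) + pdiff (0, snd b) \<phi> z)"
proof -
  obtain W where W: "integrable lborel W"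
    "\<And>u. deriv_bound 2 (\<lambda>_. W u) (\<lambda>z::'a \<times> 'b. fourier_char u (fst z) * \<phi> (u, snd z))"
    using partial_fourier_integrand_bound[OF s] by blast
  have *: "pdiff b (\<lambda>z. fourier_char u (fst z) * \<phi> (u, snd z)) z =
    fourier_char u (fst z) * ((- 2 * pi * \<i>) * (of_real (fst b \<bullet> u) * \<phi> (u, snd z)) + pdiff (0, snd b) \<phi> (u, snd z))"
    (is "?L = ?R") for u z
  proof -
    have 1: "((\<lambda>z::'a \<times> 'b. fourier_char u (fst z)) has_derivative
        (\<lambda>h. - 2 * pi * \<i> * of_real (fst h \<bullet> u) * fourier_char u (fst z))) (at z)"
      using has_derivative_compose[OF has_derivative_fst[OF has_derivative_ident] fourier_char_has_derivative] by simp
    have "((\<lambda>z::'a \<times> 'b. (u, snd z)) has_derivative (\<lambda>h. (0, snd h))) (at z)"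
      by (auto intro!: derivative_eq_intros)
    from has_derivative_compose[OF this, of \<phi> "frechet_derivative \<phi> (at (u, snd z))"]
    have 2: "((\<lambda>z::'a \<times> 'b. \<phi> (u, snd z)) has_derivative (\<lambda>h. pdiff (0, snd h) \<phi> (u, snd z))) (at z)"
      using smooth_differentiable[OF schwartz_smooth[OF s], of "(u, snd z)"]
      by (simp add: pdiff_def frechet_derivative_works)
    have "?L = fourier_char u (fst z) * pdiff (0, snd b) \<phi> (u, snd z) +
        - 2 * pi * \<i> * of_real (fst b \<bullet> u) * fourier_char u (fst z) * \<phi> (u, snd z)"
      by (rule pdiff_eqI[OF has_derivative_mult[OF 1 2]])
    then show ?thesis by (simp add: algebra_simps)
  qed
  show ?thesis
    unfolding partial_fourier_alt
    by (subst pdiff_integral[OF partial_fourier_integrand_measurable[OF s] W(2) W(1) b]) (simp only: * fst_conv)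
qed

lemma pdiff_zero_direction: "f differentiable (at x) \<Longrightarrow> pdiff 0 f x = 0"
  unfolding pdiff_def using linear_frechet_derivative linear_0 by blast

lemma integrable_partial_fourier:
  assumes "schwartz \<phi>"
  shows "integrable lborel (\<lambda>u. fourier_char u x * \<phi> (u, k))"
proof (rule Bochner_Integration.integrable_bound[OF integrable_norm[OF schwartz_integrable[OF schwartz_slice(2)[OF assms, of k]]]])
  show "(\<lambda>u. fourier_char u x * \<phi> (u, k)) \<in> borel_measurable lborel"
    using schwartz_measurable[OF schwartz_slice(2)[OF assms]] by simp
qed (simp add: norm_mult)

lemma partial_fourier_cmult: "partial_fourier (\<lambda>z. c * \<phi> z) = (\<lambda>z. c * partial_fourier \<phi> z)"
  unfolding partial_fourier_alt by (simp add: mult.left_commute[of _ c])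

text \<open>
  Integration by parts.
\<close>
lemma partial_fourier_pdiff:
  fixes \<phi> :: "'a::euclidean_space \<times> 'b::euclidean_space \<Rightarrow> complex"
  assumes s: "schwartz \<phi>" and b: "b \<in> Basis"
  shows "partial_fourier (pdiff (b, 0) \<phi>) (x, k) = 2 * pi * \<i> * of_real (x \<bullet> b) * partial_fourier \<phi> (x, k)"
proof -
  let ?\<psi> = "\<lambda>u. fourier_char u x * \<phi> (u, k)"
  have b0: "(b, 0) \<in> Basis" using b by (auto simp: Basis_prod_def)

  have "schwartz ?\<psi>" unfolding fourier_char_commute[of _ x]
    by (rule schwartz_mult[OF multiplier_fourier_char schwartz_slice(2)[OF s]])
  from integral_pdiff_eq_0[OF this b] have 0: "(LINT u|lborel. pdiff b ?\<psi> u) = 0" .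
  have "pdiff b ?\<psi> u = fourier_char u x * pdiff (b, 0) \<phi> (u, k) - 2 * pi * \<i> * of_real (x \<bullet> b) * ?\<psi> u" for u
  proof -
    have "pdiff b ?\<psi> u = fourier_char x u * pdiff b (\<lambda>u. \<phi> (u, k)) u + pdiff b (fourier_char x) u * \<phi> (u, k)"
      unfolding fourier_char_commute[of _ x]
      by (intro pdiff_mult smooth_differentiable smooth_fourier_char schwartz_smooth schwartz_slice(2) s)
    moreover have "pdiff b (fourier_char x) u = - 2 * pi * \<i> * of_real (b \<bullet> x) * fourier_char x u"
      by (rule pdiff_eqI[OF fourier_char_has_derivative])
    ultimately show ?thesis using pdiff_slice1[OF schwartz_smooth[OF s], of b k]
      by (simp add: fourier_char_commute[of x u] inner_commute)
  qed
  with 0 have "(LINT u|lborel. fourier_char u x * pdiff (b, 0) \<phi> (u, k)) - (LINT u|lborel. 2 * pi * \<i> * of_real (x \<bullet> b) * ?\<psi> u) = 0"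
    using integrable_partial_fourier[OF s, of x k]
      integrable_partial_fourier[OF schwartz_cont_schwartz[OF schwartz_cont_pdiff[OF b0] s], of x k]
    by (subst Bochner_Integration.integral_diff[symmetric]) auto
  then show ?thesis by (simp add: partial_fourier_alt)
qed

lemma schwartz_cont_add:
  assumes "schwartz_cont F" "schwartz_cont G" shows "schwartz_cont (\<lambda>\<phi> x. F \<phi> x + G \<phi> x)"
  unfolding schwartz_cont_def
proof (intro conjI allI impI)
  fix \<phi> :: "'a \<Rightarrow> complex" assume "schwartz \<phi>" then show "schwartz (\<lambda>x. F \<phi> x + G \<phi> x)"
    using assms by (intro schwartz_add) (auto intro: schwartz_cont_schwartz)
next
  fix N
  obtain N1 C1 where 1: "0 \<le> C1" "\<And>\<phi>. schwartz \<phi> \<Longrightarrow> schwartz_norm N (F \<phi>) \<le> C1 * schwartz_norm N1 \<phi>"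
    using assms(1) unfolding schwartz_cont_def by blast
  obtain N2 C2 where 2: "0 \<le> C2" "\<And>\<phi>. schwartz \<phi> \<Longrightarrow> schwartz_norm N (G \<phi>) \<le> C2 * schwartz_norm N2 \<phi>"
    using assms(2) unfolding schwartz_cont_def by blast
  let ?N = "N1 + N2"
  have "schwartz_norm N (\<lambda>x. F \<phi> x + G \<phi> x) \<le> (C1 + C2) * schwartz_norm ?N \<phi>" if s: "schwartz \<phi>" for \<phi>
  proof -
    have "schwartz_norm N (\<lambda>x. F \<phi> x + G \<phi> x) \<le> schwartz_norm N (F \<phi>) + schwartz_norm N (G \<phi>)"
    proof (rule schwartz_norm_leI)
      have "deriv_bound N (\<lambda>x. schwartz_norm N (F \<phi>) / (1 + norm x) ^ N + schwartz_norm N (G \<phi>) / (1 + norm x) ^ N)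
          (\<lambda>x. F \<phi> x + G \<phi> x)"
        using assms s by (intro deriv_bound_add deriv_bound_schwartz_norm) (auto intro: schwartz_cont_schwartz)
      then show "deriv_bound N (decay ((schwartz_norm N (F \<phi>) + schwartz_norm N (G \<phi>))) N)
          (\<lambda>x. F \<phi> x + G \<phi> x)" by (simp add: add_divide_distrib)
    qed
    also have "\<dots> \<le> C1 * schwartz_norm N1 \<phi> + C2 * schwartz_norm N2 \<phi>"
      using 1(2)[OF s] 2(2)[OF s] by linarith
    also have "\<dots> \<le> C1 * schwartz_norm ?N \<phi> + C2 * schwartz_norm ?N \<phi>"
      using 1(1) 2(1) s by (intro add_mono mult_left_mono schwartz_norm_mono) auto
    finally show ?thesis by (simp add: distrib_right)
  qed
  then show "\<exists>N' C. 0 \<le> C \<and> (\<forall>\<phi>. schwartz \<phi> \<longrightarrow> schwartz_norm N (\<lambda>x. F \<phi> x + G \<phi> x) \<le> C * schwartz_norm N' \<phi>)"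
    using 1(1) 2(1) by (intro exI[of _ ?N] exI[of _ "C1 + C2"]) auto
qed

lemma schwartz_cont_cmult: "schwartz_cont F \<Longrightarrow> schwartz_cont (\<lambda>\<phi> x. c * F \<phi> x)"
  by (rule schwartz_cont_compose[OF schwartz_cont_mult[OF multiplier_const]])

lemma schwartz_cont_zero: "schwartz_cont (\<lambda>\<phi> _. 0)"
  by (rule schwartz_contI) (auto intro!: exI[of _ 0] deriv_bound_zero)

lemma Basis_prod_cases:
  assumes "b \<in> Basis"
  obtains i where "b = (i, 0)" "i \<in> Basis" | j where "b = (0, j)" "j \<in> Basis"
  using assms by (auto simp: Basis_prod_def)

lemma schwartz_cont_partial_fourier:
  "schwartz_cont (partial_fourier :: ('a::euclidean_space \<times> 'b::euclidean_space \<Rightarrow> complex) \<Rightarrow> _)"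
proof (rule schwartz_cont_intertwining)
  show "\<exists>N C. 0 \<le> C \<and> (\<forall>(\<phi>::'a \<times> 'b \<Rightarrow> complex) z. schwartz \<phi> \<longrightarrow> norm (partial_fourier \<phi> z) \<le> C * schwartz_norm N \<phi>)"
  proof (intro exI conjI allI impI)
    let ?N = "2 * DIM('a)"
    show "0 \<le> (LINT u|lborel. 1 / (1 + norm (u::'a)) ^ ?N)" by (intro integral_nonneg_AE AE_I2) auto
    fix \<phi> :: "'a \<times> 'b \<Rightarrow> complex" and z :: "'a \<times> 'b" assume s: "schwartz \<phi>"
    have le: "norm (fourier_char u (fst z) * \<phi> (u, snd z)) \<le> schwartz_norm ?N \<phi> * (1 / (1 + norm u) ^ ?N)" for u
    proof -
      have "norm (\<phi> (u, snd z)) \<le> schwartz_norm ?N \<phi> / (1 + norm (u, snd z)) ^ (?N + 0)"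
        using deriv_bound_norm[OF deriv_bound_schwartz_norm[OF s, of 0 ?N]] by simp
      also have "\<dots> \<le> schwartz_norm ?N \<phi> / ((1 + norm u) ^ ?N * (1 + norm (snd z)) ^ 0)"
        by (rule Pair_weight[OF schwartz_norm_nonneg[OF s]])
      finally show ?thesis by (simp add: norm_mult)
    qed
    have "norm (partial_fourier \<phi> z) \<le> (LINT u|lborel. schwartz_norm ?N \<phi> * (1 / (1 + norm (u::'a)) ^ ?N))"
      unfolding partial_fourier_alt using le
      by (intro Bochner_Integration.integral_norm_bound_integral integrable_partial_fourier s
          Bochner_Integration.integrable_mult_right integrable_weight order_refl)
    then show "norm (partial_fourier \<phi> z) \<le> (LINT u|lborel. 1 / (1 + norm (u::'a)) ^ ?N) * schwartz_norm ?N \<phi>"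
      by (simp only: integral_mult_right_zero mult.commute)
  qed
  show "partial_fourier \<phi> differentiable (at z)" if s: "schwartz \<phi>" for \<phi> :: "'a \<times> 'b \<Rightarrow> complex" and z
  proof -
    obtain W where W: "integrable lborel W"
      "\<And>u. deriv_bound 2 (\<lambda>_. W u) (\<lambda>z::'a \<times> 'b. fourier_char u (fst z) * \<phi> (u, snd z))"
      using partial_fourier_integrand_bound[OF s] by blast
    from has_derivative_integral[OF partial_fourier_integrand_measurable[OF s] W(2) W(1)]
    show ?thesis unfolding partial_fourier_alt differentiable_def by blast
  qed
  fix b :: "'a \<times> 'b" assume b: "b \<in> Basis"
  have mult: "schwartz_cont (\<lambda>(\<phi>::'a \<times> 'b \<Rightarrow> complex) z. of_real (z \<bullet> b) * \<phi> z)" for b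
    using linear_char_exponent[of 1 b] by (intro schwartz_cont_mult multiplier_linear) simp
  show "\<exists>D. schwartz_cont D \<and> (\<forall>\<phi>::'a \<times> 'b \<Rightarrow> complex. schwartz \<phi> \<longrightarrow> pdiff b (partial_fourier \<phi>) = partial_fourier (D \<phi>))"
  proof (intro exI conjI allI impI)
    have "schwartz_cont (pdiff (0, snd b) :: ('a \<times> 'b \<Rightarrow> complex) \<Rightarrow> _)" if "snd b \<noteq> 0"
      using that b by (intro schwartz_cont_pdiff) (auto simp: Basis_prod_def)
    then have "schwartz_cont (\<lambda>\<phi>::'a \<times> 'b \<Rightarrow> complex. if snd b = 0 then (\<lambda>_. 0) else pdiff (0, snd b) \<phi>)"
      using schwartz_cont_zero by (cases "snd b = 0") auto
    from schwartz_cont_add[OF schwartz_cont_cmult[OF mult[of "(fst b, 0)"], of "- 2 * pi * \<i>"] this]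
    show "schwartz_cont (\<lambda>(\<phi>::'a \<times> 'b \<Rightarrow> complex) z. (- 2 * pi * \<i>) * (of_real (z \<bullet> (fst b, 0)) * \<phi> z) +
       (if snd b = 0 then (\<lambda>_. 0) else pdiff (0, snd b) \<phi>) z)" .
    fix \<phi> :: "'a \<times> 'b \<Rightarrow> complex" assume s: "schwartz \<phi>"
    have "pdiff (0, snd b) \<phi> z = (if snd b = 0 then (\<lambda>_. 0) else pdiff (0, snd b) \<phi>) z" for z
      using pdiff_zero_direction[OF smooth_differentiable[OF schwartz_smooth[OF s]]] by (simp add: zero_prod_def)
    then show "pdiff b (partial_fourier \<phi>) = partial_fourier (\<lambda>z. (- 2 * pi * \<i>) * (of_real (z \<bullet> (fst b, 0)) * \<phi> z) +
       (if snd b = 0 then (\<lambda>_. 0) else pdiff (0, snd b) \<phi>) z)"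
      unfolding pdiff_partial_fourier[OF s b] by (simp add: inner_Pair_0 inner_commute)
  qed
  show "\<exists>X. schwartz_cont X \<and> (\<forall>(\<phi>::'a \<times> 'b \<Rightarrow> complex) z. schwartz \<phi> \<longrightarrow> of_real (z \<bullet> b) * partial_fourier \<phi> z = partial_fourier (X \<phi>) z)"
    using b
  proof (cases rule: Basis_prod_cases)
    case (1 i)
    show ?thesis
    proof (intro exI conjI allI impI)
      show "schwartz_cont (\<lambda>(\<phi>::'a \<times> 'b \<Rightarrow> complex) z. (1 / (2 * pi * \<i>)) * pdiff b \<phi> z)"
        by (intro schwartz_cont_cmult schwartz_cont_pdiff b)
      fix \<phi> :: "'a \<times> 'b \<Rightarrow> complex" and z assume s: "schwartz \<phi>"
      have "schwartz (pdiff b \<phi>)" by (intro schwartz_cont_schwartz[OF schwartz_cont_pdiff] s b)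
      then show "of_real (z \<bullet> b) * partial_fourier \<phi> z = partial_fourier (\<lambda>z. (1 / (2 * pi * \<i>)) * pdiff b \<phi> z) z"
        using partial_fourier_pdiff[OF s 1(2), of "fst z" "snd z"] 1
        by (subst partial_fourier_cmult) (auto simp: inner_prod_def)
    qed
  next
    case (2 j)
    show ?thesis
    proof (intro exI conjI allI impI)
      show "schwartz_cont (\<lambda>(\<phi>::'a \<times> 'b \<Rightarrow> complex) z. of_real (z \<bullet> b) * \<phi> z)" by (rule mult)
      fix \<phi> :: "'a \<times> 'b \<Rightarrow> complex" and z assume s: "schwartz \<phi>"
      show "of_real (z \<bullet> b) * partial_fourier \<phi> z = partial_fourier (\<lambda>z. of_real (z \<bullet> b) * \<phi> z) z"
        unfolding partial_fourier_alt using 2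
        by (simp add: inner_prod_def mult.left_commute[of _ "complex_of_real (snd z \<bullet> j)"])
    qed
  qed
qed

section \<open>Fourier inversion\<close>

text \<open>
  The Fourier transform is a restriction of the partial one: the second variable is a dummy real
  variable, evaluated where the cutoff is 1. Its properties are thus special cases.
\<close>
lemma fourier_eq_partial: "fourier f = (\<lambda>x. partial_fourier (\<lambda>(u, k::real). f u * cutoff k) (x, 0))"
  by (simp add: partial_fourier_def fun_eq_iff cutoff_eq_1)

lemma schwartz_tensor: "schwartz \<phi> \<Longrightarrow> schwartz \<psi> \<Longrightarrow> schwartz (\<lambda>(x, y). \<phi> x * \<psi> y)"
  by (rule schwartz_cont_schwartz[OF schwartz_cont_tensor])

lemma schwartz_cutoff: "schwartz cutoff"
  by (intro test_function_schwartz test_function_cutoff)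

lemma schwartz_cont_fourier: "schwartz_cont fourier"
proof -
  have "schwartz_cont (\<lambda>f::'a \<Rightarrow> complex. \<lambda>x. partial_fourier ((\<lambda>\<phi> (u, k::real). \<phi> u * cutoff k) f) (x, 0))"
  proof (rule schwartz_cont_compose[OF schwartz_cont_pullback schwartz_cont_compose[OF schwartz_cont_partial_fourier schwartz_cont_tensor[OF schwartz_cutoff]]])
    show "((\<lambda>x::'a. (x, 0::real)) has_derivative (\<lambda>h. (h, 0))) (at x)" for x by (auto intro!: derivative_eq_intros)
    show "((\<lambda>z::'a \<times> real. fst z) has_derivative (\<lambda>h. fst h)) (at z)" for z by (auto intro!: derivative_eq_intros)
  qed simp
  then show ?thesis by (simp only: fourier_eq_partial[abs_def])
qed

lemma schwartz_fourier: "schwartz f \<Longrightarrow> schwartz (fourier f)"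
  by (rule schwartz_cont_schwartz[OF schwartz_cont_fourier])

lemma fourier_pdiff:
  assumes f: "schwartz f" and b: "b \<in> Basis"
  shows "fourier (pdiff b f) x = 2 * pi * \<i> * of_real (x \<bullet> b) * fourier f x"
proof -
  let ?\<Phi> = "\<lambda>(u, k::real). f u * cutoff k"
  have s: "schwartz ?\<Phi>" by (intro schwartz_tensor f schwartz_cutoff)
  have "pdiff b f = (\<lambda>u. pdiff (b, 0) ?\<Phi> (u, 0))"
    using pdiff_slice1[OF schwartz_smooth[OF s], of b 0] by (simp add: cutoff_eq_1)
  then have "fourier (pdiff b f) x = partial_fourier (pdiff (b, 0) ?\<Phi>) (x, 0)"
    by (simp add: partial_fourier_def)
  also have "\<dots> = 2 * pi * \<i> * of_real (x \<bullet> b) * fourier f x"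
    unfolding partial_fourier_pdiff[OF s b] by (simp add: fourier_eq_partial)
  finally show ?thesis .
qed

lemma pdiff_fourier:
  assumes f: "schwartz f" and b: "b \<in> Basis"
  shows "pdiff b (fourier f) x = fourier (\<lambda>u. - 2 * pi * \<i> * of_real (b \<bullet> u) * f u) x"
proof -
  let ?\<Phi> = "\<lambda>(u, k::real). f u * cutoff k"
  have s: "schwartz ?\<Phi>" by (intro schwartz_tensor f schwartz_cutoff)
  have b0: "(b, 0::real) \<in> Basis" using b by (auto simp: Basis_prod_def)
  have "pdiff b (fourier f) x = pdiff (b, 0) (partial_fourier ?\<Phi>) (x, 0)"
    unfolding fourier_eq_partial
    by (subst pdiff_slice1) (auto intro!: schwartz_smooth schwartz_cont_schwartz[OF schwartz_cont_partial_fourier] s)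
  also have "\<dots> = partial_fourier (\<lambda>z. (- 2 * pi * \<i>) * (of_real (b \<bullet> fst z) * ?\<Phi> z)) (x, 0)"
    unfolding pdiff_partial_fourier[OF s b0]
    by (simp add: pdiff_zero_direction[OF smooth_differentiable[OF schwartz_smooth[OF s]], unfolded zero_prod_def])
  also have "\<dots> = fourier (\<lambda>u. - 2 * pi * \<i> * of_real (b \<bullet> u) * f u) x"
    by (simp add: partial_fourier_def cutoff_eq_1 mult.assoc)
  finally show ?thesis .
qed

lemma fourier_cmult: "fourier (\<lambda>u. c * f u) = (\<lambda>x. c * fourier f x)"
  unfolding fourier_alt[abs_def] by (simp add: mult.left_commute[of _ c])

text \<open>
  The Gaussian satisfies \<open>pdiff b \<gamma> = - 2 \<pi> x\<^sub>b \<gamma>\<close>. The Fourier transform interchanges the two sides of this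
  equation up to a common factor, so the transform solves the same equation and is a constant multiple
  of the Gaussian; the constant is the integral of the Gaussian, which is 1.
\<close>
lemma fourier_gaussian: "fourier (gaussian pi) = (gaussian pi :: 'a::euclidean_space \<Rightarrow> complex)"
proof
  fix x :: 'a
  let ?g = "fourier (gaussian pi) :: 'a \<Rightarrow> complex"
  have s: "schwartz (gaussian pi :: 'a \<Rightarrow> complex)" by (rule schwartz_gaussian) simp
  have 1: "pdiff b ?g y = of_real (- 2 * pi * (y \<bullet> b)) * ?g y" if b: "b \<in> Basis" for b y
  proof -
    have "pdiff b ?g y = fourier (\<lambda>u. \<i> * pdiff b (gaussian pi) u) y"
      unfolding pdiff_fourier[OF s b] by (simp add: pdiff_gaussian inner_commute mult_ac)
    also have "\<dots> = \<i> * (2 * pi * \<i> * of_real (y \<bullet> b) * ?g y)"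
      unfolding fourier_cmult fourier_pdiff[OF s b] ..
    also have "\<dots> = (\<i> * \<i>) * (of_real (2 * pi * (y \<bullet> b)) * ?g y)"
      by (simp only: mult_ac of_real_mult of_real_numeral)
    finally show ?thesis by simp
  qed
  have dg: "(?g has_derivative (\<lambda>h. of_real (- 2 * pi * (y \<bullet> h)) * ?g y)) (at y)" for y
  proof (rule has_derivative_eq_rhs[OF has_derivative_pdiff])
    show "?g differentiable (at y)" by (intro smooth_differentiable schwartz_smooth schwartz_fourier s)
    show "(\<lambda>h. \<Sum>b\<in>Basis. (h \<bullet> b) *\<^sub>R pdiff b ?g y) = (\<lambda>h. of_real (- 2 * pi * (y \<bullet> h)) * ?g y)"
    proof
      fix h :: 'a
      have "(\<Sum>b\<in>Basis. (h \<bullet> b) *\<^sub>R pdiff b ?g y) = (\<Sum>b\<in>Basis. of_real (- 2 * pi * ((y \<bullet> b) * (h \<bullet> b))) * ?g y)"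
        by (intro sum.cong refl) (simp add: 1 scaleR_conv_of_real)
      also have "\<dots> = of_real (\<Sum>b\<in>Basis. - 2 * pi * ((y \<bullet> b) * (h \<bullet> b))) * ?g y"
        by (simp only: of_real_sum sum_distrib_right)
      also have "(\<Sum>b\<in>Basis. - 2 * pi * ((y \<bullet> b) * (h \<bullet> b))) = - 2 * pi * (y \<bullet> h)"
        by (simp only: euclidean_inner[of y h] sum_distrib_left)
      finally show "(\<Sum>b\<in>Basis. (h \<bullet> b) *\<^sub>R pdiff b ?g y) = of_real (- 2 * pi * (y \<bullet> h)) * ?g y" .
    qed
  qed
  \<comment> \<open>The quotient of the transform by the Gaussian.\<close>
  let ?q = "\<lambda>y::'a. ?g y * gaussian (- pi) y"
  have "(?q has_derivative (\<lambda>h. ?g y * (of_real (- 2 * (- pi) * (y \<bullet> h)) * gaussian (- pi) y) +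
      of_real (- 2 * pi * (y \<bullet> h)) * ?g y * gaussian (- pi) y)) (at y within UNIV)" for y
    by (rule has_derivative_mult[OF dg gaussian_has_derivative])
  then have "(?q has_derivative (\<lambda>h. 0)) (at y within UNIV)" for y
    by (rule has_derivative_eq_rhs) (simp add: fun_eq_iff)
  then obtain c where c: "\<And>y. ?q y = c"
    using has_derivative_zero_constant[OF convex_UNIV, of ?q] by blast
  have "fourier_char u (0::'a) = 1" "gaussian (- pi) (0::'a) = 1" for u
    by (auto simp: fourier_char_def gaussian_def)
  then have "?q 0 = (LINT u|lborel. gaussian pi (u::'a))"
    unfolding fourier_alt by (simp only: mult_1 mult.right_neutral)
  then have "?q 0 = 1"
    by (simp only: has_bochner_integral_integral_eq[OF gaussian_integral])
  then have "?q x = 1" using c by simp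
  moreover have "gaussian (- pi) x * gaussian pi x = 1"
    by (simp add: gaussian_def of_real_mult[symmetric] exp_add[symmetric] del: of_real_mult)
  ultimately show "?g x = gaussian pi x"
    by (metis mult.assoc mult.commute mult_1)
qed

lemma continuous_fourier_char2: "continuous_on UNIV (\<lambda>z. fourier_char (fst z) (snd z))"
  unfolding fourier_char_def by (intro continuous_intros)

lemma integrable_fourier_pair:
  fixes f g :: "'a::euclidean_space \<Rightarrow> complex"
  assumes "schwartz f" "schwartz g"
  shows "integrable (lborel \<Otimes>\<^sub>M lborel) (\<lambda>(u, x). fourier_char u x * (f u * g x))"
proof -
  have s: "schwartz (\<lambda>(u, x). f u * g x)" by (intro schwartz_tensor assms)
  have "integrable lborel (\<lambda>z. fourier_char (fst z) (snd z) * (f (fst z) * g (snd z)))"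
  proof (rule Bochner_Integration.integrable_bound[OF integrable_norm[OF schwartz_integrable[OF s]]])
    have "(\<lambda>z. fourier_char (fst z) (snd z)) \<in> borel_measurable (borel :: ('a \<times> 'a) measure)"
      by (rule borel_measurable_continuous_onI[OF continuous_fourier_char2])
    then show "(\<lambda>z. fourier_char (fst z) (snd z) * (f (fst z) * g (snd z))) \<in> borel_measurable lborel"
      using schwartz_measurable[OF s] by (simp add: case_prod_beta')
  qed (simp add: norm_mult case_prod_beta')
  then show ?thesis by (simp add: lborel_prod case_prod_beta')
qed

lemma fourier_multiplication_formula:
  fixes f g :: "'a::euclidean_space \<Rightarrow> complex"
  assumes "schwartz f" "schwartz g"
  shows "(LINT x|lborel. fourier f x * g x) = (LINT x|lborel. f x * fourier g x)"
proof -
  have "(LINT x|lborel. fourier f x * g x) = (LINT x|lborel. LINT u|lborel. fourier_char u x * (f u * g x))"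
    unfolding fourier_alt by (simp add: mult.assoc[symmetric])
  also have "\<dots> = (LINT u|lborel. LINT x|lborel. fourier_char u x * (f u * g x))"
    by (rule lborel_pair.Fubini_integral[OF integrable_fourier_pair[OF assms]])
  also have "\<dots> = (LINT u|lborel. f u * fourier g u)"
    unfolding fourier_alt by (simp add: mult.left_commute fourier_char_commute)
  finally show ?thesis .
qed

lemma lborel_integral_scale:
  fixes f :: "'a::euclidean_space \<Rightarrow> complex"
  assumes "f \<in> borel_measurable borel" "c \<noteq> 0"
  shows "(LINT x|lborel. f x) = of_real (\<bar>c\<bar> ^ DIM('a)) * (LINT x|lborel. f (c *\<^sub>R x))"
proof -
  have "(LINT x|lborel. f x) = (LINT x|density (distr lborel borel (\<lambda>x. 0 + c *\<^sub>R x)) (\<lambda>_. \<bar>c\<bar>^DIM('a)). f x)"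
    by (subst lborel_affine[OF assms(2), of 0, symmetric]) (rule refl)
  also have "\<dots> = (LINT x|distr lborel borel (\<lambda>x. 0 + c *\<^sub>R x). (\<bar>c\<bar>^DIM('a)) *\<^sub>R f x)"
    using assms(1) by (intro integral_density) auto
  also have "\<dots> = (LINT x|lborel. (\<bar>c\<bar>^DIM('a)) *\<^sub>R f (0 + c *\<^sub>R x))"
    using assms(1) by (intro integral_distr) auto
  finally show ?thesis by (simp add: scaleR_conv_of_real)
qed

lemma lborel_integral_reflect:
  fixes f :: "'a::euclidean_space \<Rightarrow> complex"
  assumes "f \<in> borel_measurable borel" shows "(LINT x|lborel. f (- x)) = (LINT x|lborel. f x)"
  using lborel_integral_scale[OF assms, of "-1"] by simp

lemma schwartz_compose_affine:
  fixes g :: "'a::euclidean_space \<Rightarrow> 'b::euclidean_space"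
  assumes "schwartz f" "\<And>x. (g has_derivative A) (at x)" "\<And>x. (h has_derivative B) (at x)" "\<And>x. h (g x) = x"
  shows "schwartz (\<lambda>x. f (g x))"
  by (rule schwartz_cont_schwartz[OF schwartz_cont_pullback[OF assms(2-4)] assms(1)])

lemma schwartz_scale: 
  assumes "schwartz f" "c \<noteq> 0" shows "schwartz (\<lambda>x. f (c *\<^sub>R x))"
  by (rule schwartz_compose_affine[OF assms(1), where h = "\<lambda>x. inverse c *\<^sub>R x" and A = "\<lambda>x. c *\<^sub>R x"
      and B = "\<lambda>x. inverse c *\<^sub>R x"]) (use assms(2) in \<open>auto intro!: derivative_eq_intros\<close>)

lemma schwartz_translate: 
  assumes "schwartz f" shows "schwartz (\<lambda>x. f (x + v))"
  by (rule schwartz_compose_affine[OF assms, where h = "\<lambda>x. x - v" and A = "\<lambda>x. x"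
      and B = "\<lambda>x. x"]) (auto intro!: derivative_eq_intros)

lemma schwartz_bounded:
  assumes "schwartz f" obtains B where "0 \<le> B" "\<And>x. norm (f x) \<le> B"
proof -
  have "norm (f x) \<le> schwartz_norm 0 f" for x
    using deriv_bound_norm[OF deriv_bound_schwartz_norm[OF assms, of 0 0 0]] by simp
  then show ?thesis using that schwartz_norm_nonneg[OF assms] by blast
qed

lemma integral_dilation_tendsto:
  fixes f :: "'a::euclidean_space \<Rightarrow> complex"
  assumes f: "continuous_on UNIV f" "\<And>x. norm (f x) \<le> B" and g: "schwartz g" and c: "c \<longlonglongrightarrow> 0"
  shows "(\<lambda>n. LINT x|lborel. f (c n *\<^sub>R x) * g x) \<longlonglongrightarrow> f 0 * (LINT x|lborel. g x)"
proof -
  have [measurable]: "f \<in> borel_measurable borel" "g \<in> borel_measurable borel"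
    using f g by (auto intro: schwartz_measurable borel_measurable_continuous_onI)
  have "(\<lambda>n. LINT x|lborel. f (c n *\<^sub>R x) * g x) \<longlonglongrightarrow> (LINT x|lborel. f 0 * g x)"
  proof (rule integral_dominated_convergence[where w = "\<lambda>x. B * norm (g x)"])
    show "integrable lborel (\<lambda>x. B * norm (g x))" using schwartz_integrable[OF g] by auto
    show "AE x in lborel. (\<lambda>n. f (c n *\<^sub>R x) * g x) \<longlonglongrightarrow> f 0 * g x"
    proof (intro AE_I2 tendsto_mult tendsto_const)
      fix x :: 'a
      have "(\<lambda>n. c n *\<^sub>R x) \<longlonglongrightarrow> 0 *\<^sub>R x"
        by (intro tendsto_intros c)
      moreover have "isCont f 0"
        using f(1) by (simp add: continuous_on_eq_continuous_at)
      ultimately show "(\<lambda>n. f (c n *\<^sub>R x)) \<longlonglongrightarrow> f 0"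
        using isCont_tendsto_compose by fastforce
    qed
    show "AE x in lborel. norm (f (c n *\<^sub>R x) * g x) \<le> B * norm (g x)" for n
      using f(2) by (intro AE_I2) (simp add: norm_mult mult_right_mono)
  qed measurable
  then show ?thesis by simp
qed

lemma integral_schwartz_dilation_tendsto:
  fixes f :: "'a::euclidean_space \<Rightarrow> complex"
  assumes f: "schwartz f" and g: "schwartz g" and c: "c \<longlonglongrightarrow> 0"
  shows "(\<lambda>n. LINT x|lborel. f (c n *\<^sub>R x) * g x) \<longlonglongrightarrow> f 0 * (LINT x|lborel. g x)"
proof -
  obtain B where "\<And>x. norm (f x) \<le> B" using schwartz_bounded[OF f] by blast
  then show ?thesis by (rule integral_dilation_tendsto[OF smooth_continuous[OF schwartz_smooth[OF f]] _ g c])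
qed

text \<open>
  Fourier inversion at the origin. By the multiplication formula, the self-duality of the Gaussian and
  a change of scale, the integrals of \<open>\<gamma> (c k) * fourier f k\<close> and of \<open>f (c x) * \<gamma> x\<close> agree for every \<open>c > 0\<close>;
  the two sides of the claim are their limits as c tends to 0.
\<close>
lemma integral_fourier:
  fixes f :: "'a::euclidean_space \<Rightarrow> complex"
  assumes f: "schwartz f"
  shows "(LINT k|lborel. fourier f k) = f 0"
proof -
  let ?\<gamma> = "gaussian pi :: 'a \<Rightarrow> complex"
  have s: "schwartz ?\<gamma>" by (rule schwartz_gaussian) simp
  have eq: "(LINT k|lborel. ?\<gamma> (c *\<^sub>R k) * fourier f k) = (LINT x|lborel. f (c *\<^sub>R x) * ?\<gamma> x)" if c: "0 < c" for c
  proof -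
    let ?G = "fourier (\<lambda>k. ?\<gamma> (c *\<^sub>R k))"
    have sc: "schwartz (\<lambda>k. ?\<gamma> (c *\<^sub>R k))" using s c by (intro schwartz_scale) auto
    have G: "of_real (c ^ DIM('a)) * ?G (c *\<^sub>R w) = ?\<gamma> w" for w
    proof -
      have "?\<gamma> w = (LINT u|lborel. fourier_char u w * ?\<gamma> u)"
        by (subst fourier_gaussian[symmetric]) (simp add: fourier_alt)
      also have "\<dots> = of_real (\<bar>c\<bar> ^ DIM('a)) * (LINT u|lborel. fourier_char (c *\<^sub>R u) w * ?\<gamma> (c *\<^sub>R u))"
        using schwartz_measurable[OF s] c by (intro lborel_integral_scale) auto
      also have "(\<lambda>u. fourier_char (c *\<^sub>R u) w) = (\<lambda>u. fourier_char u (c *\<^sub>R w))"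
        by (simp add: fourier_char_def)
      finally show ?thesis using c by (simp add: fourier_alt)
    qed
    have m: "(\<lambda>x. f x * ?G x) \<in> borel_measurable borel"
      using schwartz_measurable[OF f] schwartz_measurable[OF schwartz_fourier[OF sc]] by measurable
    have "(LINT k|lborel. ?\<gamma> (c *\<^sub>R k) * fourier f k) = (LINT k|lborel. fourier f k * ?\<gamma> (c *\<^sub>R k))"
      by (simp add: mult.commute)
    also have "\<dots> = (LINT x|lborel. f x * ?G x)"
      by (rule fourier_multiplication_formula[OF f sc])
    also have "\<dots> = of_real (\<bar>c\<bar> ^ DIM('a)) * (LINT x|lborel. f (c *\<^sub>R x) * ?G (c *\<^sub>R x))"
      using c by (intro lborel_integral_scale[OF m]) auto
    also have "\<dots> = (LINT x|lborel. f (c *\<^sub>R x) * (of_real (c ^ DIM('a)) * ?G (c *\<^sub>R x)))"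
      using c by (simp add: mult.left_commute[of _ "complex_of_real c ^ DIM('a)"])
    finally show ?thesis by (simp only: G)
  qed
  have "(\<lambda>n. LINT k|lborel. ?\<gamma> (inverse (real (Suc n)) *\<^sub>R k) * fourier f k) \<longlonglongrightarrow> ?\<gamma> 0 * (LINT k|lborel. fourier f k)"
    by (rule integral_schwartz_dilation_tendsto[OF s schwartz_fourier[OF f] LIMSEQ_inverse_real_of_nat])
  moreover have "(\<lambda>n. LINT x|lborel. f (inverse (real (Suc n)) *\<^sub>R x) * ?\<gamma> x) \<longlonglongrightarrow> f 0 * (LINT x|lborel. ?\<gamma> x)"
    by (rule integral_schwartz_dilation_tendsto[OF f s LIMSEQ_inverse_real_of_nat])
  moreover have "(LINT x|lborel. ?\<gamma> x) = 1"
    by (rule has_bochner_integral_integral_eq[OF gaussian_integral])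
  moreover have "?\<gamma> 0 = 1" by (simp add: gaussian_def)
  ultimately show ?thesis
    using LIMSEQ_unique by (auto simp: eq)
qed

lemma inv_fourier_eq: "inv_fourier g = (\<lambda>x. fourier g (- x))"
  by (auto simp: inv_fourier_def fourier_def inner_commute)

lemma schwartz_cont_reflect:
  "schwartz_cont (\<lambda>(f::'a::euclidean_space \<Rightarrow> complex) x. f (- x))"
  by (rule schwartz_cont_pullback[where h = uminus and A = uminus and B = uminus]) (auto intro!: derivative_eq_intros)

lemma schwartz_cont_inv_fourier: "schwartz_cont inv_fourier"
  unfolding inv_fourier_eq[abs_def] by (rule schwartz_cont_compose[OF schwartz_cont_reflect schwartz_cont_fourier])

lemma schwartz_inv_fourier: "schwartz f \<Longrightarrow> schwartz (inv_fourier f)"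
  by (rule schwartz_cont_schwartz[OF schwartz_cont_inv_fourier])

lemma fourier_translate:
  fixes f :: "'a::euclidean_space \<Rightarrow> complex"
  assumes "f \<in> borel_measurable borel"
  shows "fourier (\<lambda>x. f (x + v)) k = fourier_char v (- k) * fourier f k"
proof -
  have c: "fourier_char u k = fourier_char v (- k) * fourier_char (u + v) k" for u
    by (simp add: fourier_char_def exp_add[symmetric] inner_add_right algebra_simps)
  have "fourier (\<lambda>x. f (x + v)) k = (LINT u|lborel. fourier_char v (- k) * (fourier_char (u + v) k * f (u + v)))"
    unfolding fourier_alt by (subst c) (simp only: mult.assoc)
  also have "\<dots> = fourier_char v (- k) * (LINT u|lborel. fourier_char (u + v) k * f (u + v))" by simp
  also have "(LINT u|lborel. fourier_char (u + v) k * f (u + v)) = fourier f k"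
    unfolding fourier_alt using assms by (intro lborel_integral_translation[of "\<lambda>u. fourier_char u k * f u"]) measurable
  finally show ?thesis .
qed

text \<open>
  Inversion at x is inversion at the origin for a translate of f.
\<close>
theorem inv_fourier_fourier:
  assumes f: "schwartz f" shows "inv_fourier (fourier f) = f"
proof
  fix x
  have "inv_fourier (fourier f) x = (LINT k|lborel. fourier_char x (- k) * fourier f k)"
    by (simp add: inv_fourier_def fourier_char_def)
  also have "\<dots> = (LINT k|lborel. fourier (\<lambda>y. f (y + x)) k)"
    by (simp add: fourier_translate[OF schwartz_measurable[OF f]])
  also have "\<dots> = f x" using integral_fourier[OF schwartz_translate[OF f, of x]] by simp
  finally show "inv_fourier (fourier f) x = f x" .
qed

theorem fourier_inv_fourier:
  assumes f: "schwartz f" shows "fourier (inv_fourier f) = f"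
proof
  fix x
  have m: "(\<lambda>u. fourier_char u x * inv_fourier f u) \<in> borel_measurable borel"
    using schwartz_measurable[OF schwartz_inv_fourier[OF f]] by measurable
  have "fourier (inv_fourier f) x = (LINT u|lborel. fourier_char (- u) x * inv_fourier f (- u))"
    unfolding fourier_alt by (rule lborel_integral_reflect[OF m, symmetric])
  also have "\<dots> = inv_fourier (fourier f) x"
    by (simp add: inv_fourier_eq fourier_alt[of "fourier f"] fourier_char_def)
  finally show "fourier (inv_fourier f) x = f x" by (simp add: inv_fourier_fourier[OF f])
qed

text \<open>
  Both sides have the same Fourier transform, where partial derivatives are multiplications.
\<close>
lemma pdiff_commute:
  fixes f :: "'a::euclidean_space \<Rightarrow> complex"
  assumes f: "schwartz f" and b: "b \<in> Basis" and c: "c \<in> Basis"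
  shows "pdiff b (pdiff c f) = pdiff c (pdiff b f)"
proof -
  have s: "schwartz (pdiff i g)" if "i \<in> Basis" "schwartz g" for i and g :: "'a \<Rightarrow> complex"
    using that by (auto intro!: schwartz_cont_schwartz[OF schwartz_cont_pdiff])
  have "fourier (pdiff b (pdiff c f)) = fourier (pdiff c (pdiff b f))"
    by (simp add: fun_eq_iff fourier_pdiff s f b c)
  then have "inv_fourier (fourier (pdiff b (pdiff c f))) = inv_fourier (fourier (pdiff c (pdiff b f)))" by simp
  then show ?thesis by (simp add: inv_fourier_fourier s f b c)
qed

section \<open>Tempered distributions with parameters\<close>

lemma linear_on_classD:
  assumes "linear_on_class P T"
  shows "P \<phi> \<Longrightarrow> P \<psi> \<Longrightarrow> T (\<lambda>x. \<phi> x + \<psi> x) = T \<phi> + T \<psi>" "P \<phi> \<Longrightarrow> T (\<lambda>x. c * \<phi> x) = c * T \<phi>"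
  using assms by (auto simp: linear_on_class_def)

lemma tempered_add: "tempered T \<Longrightarrow> schwartz \<phi> \<Longrightarrow> schwartz \<psi> \<Longrightarrow> T (\<lambda>x. \<phi> x + \<psi> x) = T \<phi> + T \<psi>"
  and tempered_cmult: "tempered T \<Longrightarrow> schwartz \<phi> \<Longrightarrow> T (\<lambda>x. c * \<phi> x) = c * T \<phi>"
  by (auto simp: tempered_def linear_on_classD)

lemma tempered_zero: "tempered T \<Longrightarrow> T (\<lambda>_. 0) = 0"
  using tempered_cmult[OF _ schwartz_zero, of T 0] by simp

lemma tempered_diff:
  assumes "tempered T" "schwartz \<phi>" "schwartz \<psi>" shows "T (\<lambda>x. \<phi> x - \<psi> x) = T \<phi> - T \<psi>"
  using tempered_add[OF assms(1,2) schwartz_cmult[OF assms(3)], of "-1"] tempered_cmult[OF assms(1,3), of "-1"] by simp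

lemma tempered_sum:
  assumes T: "tempered T" shows "finite I \<Longrightarrow> (\<And>i. i \<in> I \<Longrightarrow> schwartz (f i)) \<Longrightarrow> T (\<lambda>x. \<Sum>i\<in>I. f i x) = (\<Sum>i\<in>I. T (f i))"
proof (induction I rule: finite_induct)
  case empty
  show ?case using tempered_zero[OF T] by simp
next
  case (insert i I)
  then show ?case using tempered_add[OF T, of "f i" "\<lambda>x. \<Sum>i\<in>I. f i x"] by (simp add: schwartz_sum)
qed

lemma tempered_bound:
  assumes "tempered T"
  obtains N C where "0 \<le> C" "\<And>\<phi>. schwartz \<phi> \<Longrightarrow> norm (T \<phi>) \<le> C * schwartz_norm N \<phi>"
    "\<And>\<phi> c. schwartz \<phi> \<Longrightarrow> deriv_bound N (decay c N) \<phi> \<Longrightarrow> norm (T \<phi>) \<le> C * c"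
proof -
  obtain N C where NC: "\<And>\<phi>. schwartz \<phi> \<Longrightarrow> norm (T \<phi>) \<le> C * schwartz_norm N \<phi>"
    using assms unfolding tempered_def by blast
  have 1: "norm (T \<phi>) \<le> \<bar>C\<bar> * schwartz_norm N \<phi>" if "schwartz \<phi>" for \<phi>
    using NC[OF that] mult_right_mono[OF abs_ge_self schwartz_norm_nonneg[OF that, of N], of C] by linarith
  moreover have "norm (T \<phi>) \<le> \<bar>C\<bar> * c"
    if "schwartz \<phi>" "deriv_bound N (decay c N) \<phi>" for \<phi> c
    using 1[OF that(1)] mult_left_mono[OF schwartz_norm_leI[OF that(2)] abs_ge_zero, of C] by linarith
  ultimately show ?thesis using that[of "\<bar>C\<bar>" N] by simp
qed

lemma tempered_compose:
  assumes T: "tempered T" and F: "schwartz_cont F"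
    and add: "\<And>\<phi> \<psi>. schwartz \<phi> \<Longrightarrow> schwartz \<psi> \<Longrightarrow> F (\<lambda>x. \<phi> x + \<psi> x) = (\<lambda>x. F \<phi> x + F \<psi> x)"
    and mult: "\<And>\<phi> c. schwartz \<phi> \<Longrightarrow> F (\<lambda>x. c * \<phi> x) = (\<lambda>x. c * F \<phi> x)"
  shows "tempered (\<lambda>\<phi>. T (F \<phi>))"
  unfolding tempered_def
proof
  have sF: "schwartz (F \<phi>)" if "schwartz \<phi>" for \<phi> by (rule schwartz_cont_schwartz[OF F that])
  show "linear_on_class schwartz (\<lambda>\<phi>. T (F \<phi>))"
    unfolding linear_on_class_def using add mult tempered_add[OF T] tempered_cmult[OF T] sF by simp
  obtain N C where C: "0 \<le> C" "\<And>\<phi>. schwartz \<phi> \<Longrightarrow> norm (T \<phi>) \<le> C * schwartz_norm N \<phi>"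
    using tempered_bound[OF T] by metis
  obtain N' C' where C': "\<And>\<phi>. schwartz \<phi> \<Longrightarrow> schwartz_norm N (F \<phi>) \<le> C' * schwartz_norm N' \<phi>"
    using F unfolding schwartz_cont_def by blast
  have "norm (T (F \<phi>)) \<le> (C * C') * schwartz_norm N' \<phi>" if "schwartz \<phi>" for \<phi>
    using C(2)[OF sF[OF that]] mult_left_mono[OF C'[OF that] C(1)] by (simp add: mult.assoc)
  then show "\<exists>N C. \<forall>\<phi>. schwartz \<phi> \<longrightarrow> norm (T (F \<phi>)) \<le> C * schwartz_norm N \<phi>" by blast
qed

text \<open>
  The number \<open>e i\<close> plays the role of the N-th seminorm of the difference.
\<close>
lemma tempered_tendsto:
  assumes T: "tempered T" and s: "\<And>i. schwartz (f i)" "schwartz g"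
    and conv: "\<And>N. \<exists>e. (e \<longlongrightarrow> 0) F \<and> (\<forall>\<^sub>F i in F. deriv_bound N (decay (e i) N) (\<lambda>x. f i x - g x))"
  shows "((\<lambda>i. T (f i)) \<longlongrightarrow> T g) F"
proof -
  obtain N C where C: "0 \<le> C"
    "\<And>\<phi> c. schwartz \<phi> \<Longrightarrow> deriv_bound N (decay c N) \<phi> \<Longrightarrow> norm (T \<phi>) \<le> C * c"
    using tempered_bound[OF T] by metis
  obtain e where e: "(e \<longlongrightarrow> 0) F" and
    ev: "\<forall>\<^sub>F i in F. deriv_bound N (decay (e i) N) (\<lambda>x. f i x - g x)" using conv by blast
  have "((\<lambda>i. T (f i) - T g) \<longlongrightarrow> 0) F"
  proof (rule Lim_null_comparison)
    show "\<forall>\<^sub>F i in F. norm (T (f i) - T g) \<le> C * e i"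
      using ev by eventually_elim (use C(2) s in \<open>simp add: tempered_diff[OF T, symmetric] schwartz_diff\<close>)
    show "((\<lambda>i. C * e i) \<longlongrightarrow> 0) F" using tendsto_mult_right_zero[OF e, of C] .
  qed
  then show ?thesis by (simp add: LIM_zero_iff)
qed

text \<open>
  If the partial derivatives of \<open>R H p\<close> are again members \<open>R H' p\<close> of the family, supremum bounds for all
  members are bounds for all derivatives. As the parameter p and the factor \<open>e p\<close> do not change under
  differentiation, the constants are uniform in p.
\<close>
lemma deriv_bound_family:
  fixes R :: "'h \<Rightarrow> 'p \<Rightarrow> 'a::euclidean_space \<Rightarrow> complex" and e :: "'p \<Rightarrow> real"
  assumes e: "\<And>p. 0 \<le> e p"
    and base: "\<And>H. S H \<Longrightarrow> \<exists>C\<ge>0. \<forall>p x. norm (R H p x) \<le> C * e p / (1 + norm x) ^ m"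
    and diff: "\<And>H p x. S H \<Longrightarrow> R H p differentiable (at x)"
    and deriv: "\<And>H b. S H \<Longrightarrow> b \<in> Basis \<Longrightarrow> \<exists>H'. S H' \<and> (\<forall>p. pdiff b (R H p) = R H' p)"
  shows "S H \<Longrightarrow> \<exists>C\<ge>0. \<forall>p. deriv_bound k (decay (C * e p) m) (R H p)"
proof (induction k arbitrary: H)
  case 0
  then show ?case using base by simp
next
  case (Suc k)
  obtain C0 where C0: "0 \<le> C0" "\<And>p x. norm (R H p x) \<le> C0 * e p / (1 + norm x) ^ m"
    using base[OF Suc.prems] by blast
  have "\<forall>b. \<exists>C. b \<in> Basis \<longrightarrow> 0 \<le> C \<and> (\<forall>p. deriv_bound k (decay (C * e p) m) (pdiff b (R H p)))"
  proof
    fix b :: 'a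
    show "\<exists>C. b \<in> Basis \<longrightarrow> 0 \<le> C \<and> (\<forall>p. deriv_bound k (decay (C * e p) m) (pdiff b (R H p)))"
    proof (cases "b \<in> Basis")
      case True
      then obtain H' where "S H'" "\<And>p. pdiff b (R H p) = R H' p" using deriv[OF Suc.prems] by blast
      with Suc.IH[of H'] show ?thesis by auto
    qed auto
  qed
  from choice[OF this] obtain C where C: "\<And>b. b \<in> Basis \<Longrightarrow> 0 \<le> C b"
    "\<And>b p. b \<in> Basis \<Longrightarrow> deriv_bound k (decay (C b * e p) m) (pdiff b (R H p))" by blast
  define D where "D = C0 + (\<Sum>b\<in>Basis. C b)"
  have D: "C0 \<le> D" "\<And>b. b \<in> Basis \<Longrightarrow> C b \<le> D"
    using C0(1) C(1) member_le_sum[of _ Basis C] by (auto simp: D_def sum_nonneg add_increasing)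
  have "deriv_bound (Suc k) (decay (D * e p) m) (R H p)" for p
  proof -
    have "norm (R H p x) \<le> D * e p / (1 + norm x) ^ m" for x
      by (rule order_trans[OF C0(2)]) (intro divide_right_mono mult_right_mono D e, simp)
    moreover have "deriv_bound k (decay (D * e p) m) (pdiff b (R H p))" if "b \<in> Basis" for b
      by (rule deriv_bound_weight_le[OF C(2)[OF that]]) (intro mult_right_mono D e that order_refl)+
    ultimately show ?thesis using diff[OF Suc.prems] by simp
  qed
  moreover have "0 \<le> D" using C0(1) D(1) by linarith
  ultimately show ?case by blast
qed

text \<open>
  Taylor's formula in the first variable, with the remainder estimated in every Schwartz seminorm of
  the second. Differentiation in x maps the remainder for H to the remainder for the derivative of H,
  because partial derivatives commute.
\<close>
lemma slice_taylor:
  fixes H :: "'w::euclidean_space \<times> 'a::euclidean_space \<Rightarrow> complex"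
  assumes "schwartz H"
  shows "\<exists>C\<ge>0. \<forall>v w. deriv_bound k (decay (C * (norm (v - w))\<^sup>2) m)
    (\<lambda>x. H (v, x) - H (w, x) - (\<Sum>b\<in>Basis. ((v - w) \<bullet> b) *\<^sub>R pdiff (b, 0) H (w, x)))"
proof -
  let ?R = "\<lambda>H (v, w) x. H (v, x) - H (w, x) - (\<Sum>b\<in>(Basis::'w set). ((v - w) \<bullet> b) *\<^sub>R pdiff (b, 0) H (w, x))"
  have b0: "(b, 0) \<in> Basis" if "b \<in> (Basis :: 'w set)" for b :: 'w using that by (auto simp: Basis_prod_def)
  have c0: "(0, c) \<in> Basis" if "c \<in> (Basis :: 'a set)" for c :: 'a using that by (auto simp: Basis_prod_def)
  have sp: "schwartz (pdiff i G)" if "i \<in> Basis" "schwartz G" for i and G :: "'w \<times> 'a \<Rightarrow> complex"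
    using that by (auto intro!: schwartz_cont_schwartz[OF schwartz_cont_pdiff])
  have dslice: "((\<lambda>x. G (w, x)) has_derivative (\<lambda>h. pdiff (0, h) G (w, x))) (at x)"
    if "schwartz G" for G :: "'w \<times> 'a \<Rightarrow> complex" and w x
  proof -
    have "((\<lambda>x. (w, x)) has_derivative (\<lambda>h. (0, h))) (at x)" by (auto intro!: derivative_eq_intros)
    from has_derivative_compose[OF this, of G "frechet_derivative G (at (w, x))"]
    show ?thesis using smooth_differentiable[OF schwartz_smooth[OF that], of "(w, x)"]
      by (simp add: pdiff_def frechet_derivative_works)
  qed
  have dR: "((?R H (v, w)) has_derivative (\<lambda>h. pdiff (0, h) H (v, x) - pdiff (0, h) H (w, x) -
      (\<Sum>b\<in>(Basis::'w set). ((v - w) \<bullet> b) *\<^sub>R pdiff (0, h) (pdiff (b, 0) H) (w, x)))) (at x)"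
    if "schwartz H" for H :: "'w \<times> 'a \<Rightarrow> complex" and v w x
    unfolding prod.case by (intro has_derivative_diff has_derivative_sum has_derivative_scaleR_right dslice sp b0 that)
  have "\<exists>C\<ge>0. \<forall>p. deriv_bound k (decay (C * (norm (fst p - snd p))\<^sup>2) m) (?R H p)"
  proof (rule deriv_bound_family[where S = schwartz and R = ?R and e = "\<lambda>p. (norm (fst p - snd p))\<^sup>2"])
    fix H :: "'w \<times> 'a \<Rightarrow> complex" assume H: "schwartz H"
    obtain C where C: "0 \<le> C" "\<And>x. deriv_bound 2 (\<lambda>w. C / ((1 + norm w) ^ 0 * (1 + norm x) ^ m)) (\<lambda>w. H (w, x))"
      using schwartz_slice_bound[OF H, of 2 0 m] by metis
    have "norm (?R H (v, w) x) \<le> ((DIM('w))\<^sup>2 * C) * (norm (v - w))\<^sup>2 / (1 + norm x) ^ m" for v w x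
      using taylor_deriv_bound[of "C / (1 + norm x) ^ m" "\<lambda>w. H (w, x)" v w] C(2)
      by (simp add: pdiff_slice1[OF schwartz_smooth[OF H]])
    then show "\<exists>C\<ge>0. \<forall>p x. norm (?R H p x) \<le> C * (norm (fst p - snd p))\<^sup>2 / (1 + norm x) ^ m"
      using C(1) by (intro exI[of _ "(DIM('w))\<^sup>2 * C"]) auto
    show "?R H p differentiable (at x)" for p x
      using dR[OF H, of "fst p" "snd p" x] unfolding prod.collapse differentiable_def by blast
    fix c :: 'a assume c: "c \<in> Basis"
    have "pdiff c (?R H (v, w)) = ?R (pdiff (0, c) H) (v, w)" for v w
      unfolding pdiff_eqI'[OF dR[OF H]] using pdiff_commute[OF H c0[OF c] b0] by simp
    then show "\<exists>H'. schwartz H' \<and> (\<forall>p. pdiff c (?R H p) = ?R H' p)"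
      using sp[OF c0[OF c] H] by (intro exI[of _ "pdiff (0, c) H"]) auto
  qed (use assms in auto)
  then show ?thesis by force
qed

lemma slice_lipschitz:
  fixes H :: "'w::euclidean_space \<times> 'a::euclidean_space \<Rightarrow> complex"
  assumes "schwartz H"
  shows "\<exists>C\<ge>0. \<forall>v w. deriv_bound k (decay (C * norm (v - w)) m) (\<lambda>x. H (v, x) - H (w, x))"
proof -
  let ?R = "\<lambda>(H::'w \<times> 'a \<Rightarrow> complex) (v, w) x. H (v, x) - H (w, x)"
  have "\<exists>C\<ge>0. \<forall>p. deriv_bound k (decay (C * norm (fst p - snd p)) m) (?R H p)"
  proof (rule deriv_bound_family[where S = schwartz and R = ?R and e = "\<lambda>p. norm (fst p - snd p)"])
    fix H :: "'w \<times> 'a \<Rightarrow> complex" assume H: "schwartz H"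
    obtain C where C: "0 \<le> C" "\<And>x. deriv_bound (Suc 0) (\<lambda>w. C / ((1 + norm w) ^ 0 * (1 + norm x) ^ m)) (\<lambda>w. H (w, x))"
      using schwartz_slice_bound[OF H, of "Suc 0" 0 m] by metis
    have "norm (?R H (v, w) x) \<le> (DIM('w) * C) * norm (v - w) / (1 + norm x) ^ m" for v w x
      using lipschitz_deriv_bound[of "C / (1 + norm x) ^ m" "\<lambda>w. H (w, x)" v w] C(2)[of x] by simp
    then show "\<exists>C\<ge>0. \<forall>p x. norm (?R H p x) \<le> C * norm (fst p - snd p) / (1 + norm x) ^ m"
      using C(1) by (intro exI[of _ "DIM('w) * C"]) auto
    have ds: "(\<lambda>x. H (v, x)) differentiable (at x)" for v x
      by (intro smooth_differentiable schwartz_smooth schwartz_slice(1) H)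
    then show "?R H p differentiable (at x)" for p x by (cases p) auto
    fix c :: 'a assume c: "c \<in> Basis"
    have "pdiff c (\<lambda>x. H (v, x) - H (w, x)) = (\<lambda>x. pdiff (0, c) H (v, x) - pdiff (0, c) H (w, x))" for v w
    proof
      fix x
      have "pdiff c (\<lambda>x. H (v, x) + (-1) * H (w, x)) x = pdiff c (\<lambda>x. H (v, x)) x + (-1) * pdiff c (\<lambda>x. H (w, x)) x"
        using pdiff_add[of "\<lambda>x. H (v, x)" x "\<lambda>x. (-1) * H (w, x)" c] pdiff_cmult[OF ds, of c "-1" w x] ds by auto
      then show "pdiff c (\<lambda>x. H (v, x) - H (w, x)) x = pdiff (0, c) H (v, x) - pdiff (0, c) H (w, x)"
        by (simp add: pdiff_slice2[OF schwartz_smooth[OF H]])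
    qed
    moreover have "schwartz (pdiff (0, c) H)"
      using c H by (intro schwartz_cont_schwartz[OF schwartz_cont_pdiff]) (auto simp: Basis_prod_def)
    ultimately show "\<exists>H'. schwartz H' \<and> (\<forall>p. pdiff c (?R H p) = ?R H' p)"
      by (intro exI[of _ "pdiff (0, c) H"]) auto
  qed (use assms in auto)
  then show ?thesis by force
qed

text \<open>
  The continuous linear functional T is applied to the Taylor formula \<open>slice_taylor\<close>.
\<close>
lemma tempered_slice_has_derivative:
  fixes H :: "'w::euclidean_space \<times> 'a::euclidean_space \<Rightarrow> complex"
  assumes T: "tempered T" and H: "schwartz H"
  shows "((\<lambda>w. T (\<lambda>x. H (w, x))) has_derivative
    (\<lambda>h. \<Sum>b\<in>Basis. (h \<bullet> b) *\<^sub>R T (\<lambda>x. pdiff (b, 0) H (w, x)))) (at w)"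
proof -
  obtain N C where C: "0 \<le> C"
    "\<And>\<phi> c. schwartz \<phi> \<Longrightarrow> deriv_bound N (decay c N) \<phi> \<Longrightarrow> norm (T \<phi>) \<le> C * c"
    using tempered_bound[OF T] by metis
  let ?R = "\<lambda>v w x. H (v, x) - H (w, x) - (\<Sum>b\<in>(Basis::'w set). ((v - w) \<bullet> b) *\<^sub>R pdiff (b, 0) H (w, x))"
  obtain D where D: "0 \<le> D" "\<And>v w. deriv_bound N (decay (D * (norm (v - w))\<^sup>2) N) (?R v w)"
    using slice_taylor[OF H] by blast
  have sp: "schwartz (\<lambda>x. pdiff (b, 0) H (w, x))" if "b \<in> Basis" for b w
    using that H by (intro schwartz_slice(1) schwartz_cont_schwartz[OF schwartz_cont_pdiff]) (auto simp: Basis_prod_def)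
  let ?D = "\<lambda>h. \<Sum>b\<in>Basis. (h \<bullet> b) *\<^sub>R T (\<lambda>x. pdiff (b, 0) H (w, x))"
  show ?thesis
  proof (rule has_derivativeI_sandwich[of 1])
    show "bounded_linear ?D"
      by (intro bounded_linear_sum bounded_linear_scaleR_left[THEN bounded_linear_compose] bounded_linear_inner_left)
    show "norm (T (\<lambda>x. H (v, x)) - T (\<lambda>x. H (w, x)) - ?D (v - w)) / norm (v - w) \<le> (C * D) * norm (v - w)"
      if "v \<noteq> w" for v
    proof -
      have ss: "schwartz (\<lambda>x. \<Sum>b\<in>(Basis::'w set). of_real ((v - w) \<bullet> b) * pdiff (b, 0) H (w, x))"
        by (intro schwartz_sum schwartz_cmult sp finite_Basis)
      have sR: "schwartz (?R v w)"
        unfolding scaleR_conv_of_real by (intro schwartz_diff schwartz_slice(1) H ss)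
      have "T (?R v w) = T (\<lambda>x. H (v, x)) - T (\<lambda>x. H (w, x)) - T (\<lambda>x. \<Sum>b\<in>(Basis::'w set). of_real ((v - w) \<bullet> b) * pdiff (b, 0) H (w, x))"
        unfolding scaleR_conv_of_real
        by (subst tempered_diff[OF T schwartz_diff ss]) (auto simp: tempered_diff[OF T] schwartz_slice(1)[OF H])
      also have "T (\<lambda>x. \<Sum>b\<in>(Basis::'w set). of_real ((v - w) \<bullet> b) * pdiff (b, 0) H (w, x)) = ?D (v - w)"
        by (subst tempered_sum[OF T]) (auto simp: tempered_cmult[OF T sp] scaleR_conv_of_real intro!: schwartz_cmult sp)
      finally have "norm (T (\<lambda>x. H (v, x)) - T (\<lambda>x. H (w, x)) - ?D (v - w)) \<le> C * (D * (norm (v - w))\<^sup>2)"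
        using C(2)[OF sR D(2)] by simp
      then show ?thesis using that by (simp add: divide_le_eq power2_eq_square mult_ac)
    qed
    have "((\<lambda>v. (C * D) * norm (v - w)) \<longlongrightarrow> (C * D) * norm (w - w)) (at w)" by (intro tendsto_intros)
    then show "((\<lambda>v. (C * D) * norm (v - w)) \<longlongrightarrow> 0) (at w)" by simp
  qed simp
qed

lemma schwartz_tempered_slice:
  fixes H :: "'w::euclidean_space \<times> 'a::euclidean_space \<Rightarrow> complex"
  assumes T: "tempered T" and H: "schwartz H"
  shows "schwartz (\<lambda>w. T (\<lambda>x. H (w, x)))"
  unfolding schwartz_iff
proof (intro allI)
  fix k m
  obtain N C where C: "0 \<le> C"
    "\<And>\<phi> c. schwartz \<phi> \<Longrightarrow> deriv_bound N (decay c N) \<phi> \<Longrightarrow> norm (T \<phi>) \<le> C * c"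
    using tempered_bound[OF T] by metis
  let ?R = "\<lambda>(H::'w \<times> 'a \<Rightarrow> complex) (_::unit) w. T (\<lambda>x. H (w, x))"
  have "\<exists>D\<ge>0. \<forall>p. deriv_bound k (decay (D * 1) m) (?R H p)"
  proof (rule deriv_bound_family[where S = schwartz and R = ?R and e = "\<lambda>_. 1"])
    fix H :: "'w \<times> 'a \<Rightarrow> complex" assume H: "schwartz H"
    obtain D where D: "0 \<le> D" "\<And>w. deriv_bound N (\<lambda>x. D / ((1 + norm w) ^ m * (1 + norm x) ^ N)) (\<lambda>x. H (w, x))"
      using schwartz_slice_bound[OF H, of N m N] by metis
    have "norm (T (\<lambda>x. H (w, x))) \<le> C * (D / (1 + norm w) ^ m)" for w
      using D(2)[of w] by (intro C(2) schwartz_slice(1) H) simp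
    then show "\<exists>D\<ge>0. \<forall>p w. norm (?R H p w) \<le> D * 1 / (1 + norm w) ^ m"
      using C(1) D(1) by (intro exI[of _ "C * D"]) auto
    show "?R H p differentiable (at w)" for p w
      using tempered_slice_has_derivative[OF T H] differentiable_def by blast
    fix b :: 'w assume b: "b \<in> Basis"
    have "(\<Sum>c\<in>Basis. (b \<bullet> c) *\<^sub>R T (\<lambda>x. pdiff (c, 0) H (w, x))) =
      (\<Sum>c\<in>Basis. if c = b then T (\<lambda>x. pdiff (c, 0) H (w, x)) else 0)" for w
      using b by (intro sum.cong) (auto simp: inner_Basis)
    then have "pdiff b (?R H p) = ?R (pdiff (b, 0) H) p" for p
      using b by (subst pdiff_eqI'[OF tempered_slice_has_derivative[OF T H]]) simp
    moreover have "schwartz (pdiff (b, 0) H)"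
      using b H by (intro schwartz_cont_schwartz[OF schwartz_cont_pdiff]) (auto simp: Basis_prod_def)
    ultimately show "\<exists>H'. schwartz H' \<and> (\<forall>p. pdiff b (?R H p) = ?R H' p)" by blast
  qed (use H in auto)
  then show "\<exists>D. deriv_bound k (decay D m) (\<lambda>w. T (\<lambda>x. H (w, x)))" by auto
qed

section \<open>Integrals of families of Schwartz functions\<close>

lemma schwartz_integral:
  fixes H :: "'w::euclidean_space \<times> 'a::euclidean_space \<Rightarrow> complex"
  assumes H: "schwartz H" shows "schwartz (\<lambda>x. LINT w|lborel. H (w, x))"
  unfolding schwartz_iff
proof (intro allI)
  fix k m
  let ?n = "2 * DIM('w)"
  obtain C where C: "\<And>w. deriv_bound k (\<lambda>x. C / ((1 + norm w) ^ ?n * (1 + norm x) ^ m)) (\<lambda>x. H (w, x))"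
    using schwartz_slice_bound[OF H, of k ?n m] by metis
  obtain D where D: "\<And>w. deriv_bound (k + 2) (\<lambda>x. D / ((1 + norm w) ^ ?n * (1 + norm x) ^ 0)) (\<lambda>x. H (w, x))"
    using schwartz_slice_bound[OF H, of "k + 2" ?n 0] by metis
  have "deriv_bound k (\<lambda>x. (LINT w|lborel. C / (1 + norm (w::'w)) ^ ?n) * (1 / (1 + norm x) ^ m)) (\<lambda>x. LINT w|lborel. H (w, x))"
  proof (rule deriv_bound_integral[where W' = "\<lambda>w. D / (1 + norm (w::'w)) ^ ?n"])
    show "(\<lambda>w. H (w, x)) \<in> borel_measurable lborel" for x
      using schwartz_measurable[OF schwartz_slice(2)[OF H]] by simp
  qed (use C D in \<open>auto intro: integrable_weight\<close>)
  then show "\<exists>C. deriv_bound k (decay C m) (\<lambda>x. LINT w|lborel. H (w, x))" by auto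
qed

lemma multiplier_add:
  assumes "multiplier f" "multiplier g" shows "multiplier (\<lambda>x. f x + g x)"
  unfolding multiplier_def
proof
  fix k
  obtain C m D n where C: "deriv_bound k (\<lambda>x. C * (1 + norm x) ^ m) f" and D: "deriv_bound k (\<lambda>x. D * (1 + norm x) ^ n) g"
    using assms unfolding multiplier_def by metis
  have C0: "0 \<le> C" and D0: "0 \<le> D" using deriv_bound_nonneg[OF C, of 0] deriv_bound_nonneg[OF D, of 0] by auto
  have "deriv_bound k (\<lambda>x. (C + D) * (1 + norm x) ^ (m + n)) (\<lambda>x. f x + g x)"
  proof (rule deriv_bound_mono[OF deriv_bound_add[OF C D]])
    fix x :: 'a
    have "C * (1 + norm x) ^ m \<le> C * (1 + norm x) ^ (m + n)" "D * (1 + norm x) ^ n \<le> D * (1 + norm x) ^ (m + n)"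
      using C0 D0 by (auto intro!: mult_left_mono power_increasing)
    then show "C * (1 + norm x) ^ m + D * (1 + norm x) ^ n \<le> (C + D) * (1 + norm x) ^ (m + n)"
      by (simp add: distrib_right)
  qed
  then show "\<exists>C m. deriv_bound k (\<lambda>x. C * (1 + norm x) ^ m) (\<lambda>x. f x + g x)" by blast
qed

lemma multiplier_sum: "finite I \<Longrightarrow> (\<And>i. i \<in> I \<Longrightarrow> multiplier (f i)) \<Longrightarrow> multiplier (\<lambda>x. \<Sum>i\<in>I. f i x)"
  by (induction I rule: finite_induct) (auto intro: multiplier_const multiplier_add)

lemma multiplier_power: "multiplier f \<Longrightarrow> multiplier (\<lambda>x. f x ^ n)"
  by (induction n) (auto intro: multiplier_const multiplier_mult)

lemma multiplier_inner_square: "multiplier (\<lambda>x::'a::euclidean_space. complex_of_real (x \<bullet> x))"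
proof -
  have "multiplier (\<lambda>x::'a. \<Sum>b\<in>Basis. complex_of_real (x \<bullet> b) * complex_of_real (x \<bullet> b))"
    using linear_char_exponent[of 1] by (intro multiplier_sum multiplier_mult multiplier_linear finite_Basis) simp_all
  moreover have "(\<Sum>b\<in>Basis. complex_of_real (x \<bullet> b) * complex_of_real (x \<bullet> b)) = complex_of_real (x \<bullet> x)" for x :: 'a
    by (subst euclidean_inner) simp
  ultimately show ?thesis by simp
qed

lemma simple_function_integral_mult:
  fixes s :: "'w::euclidean_space \<Rightarrow> 'w" and g :: "'w \<Rightarrow> complex" and \<omega> :: "'w \<Rightarrow> real"
  assumes s: "simple_function lborel s" and \<omega>: "integrable lborel \<omega>"
  shows "(LINT w|lborel. of_real (\<omega> w) * g (s w)) =
    (\<Sum>v\<in>range s. of_real (LINT w|lborel. \<omega> w * indicator (s -` {v}) w) * g v)"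
proof -
  have fin: "finite (range s)" and m: "\<And>v. s -` {v} \<in> sets lborel"
    using s simple_functionD(1)[OF s] simple_functionD(2)[OF s] by auto
  have int: "integrable lborel (\<lambda>w. \<omega> w * indicator (s -` {v}) w)" for v
    using \<omega> m by (intro integrable_real_mult_indicator)
  have "of_real (\<omega> w) * g (s w) = (\<Sum>v\<in>range s. of_real (\<omega> w * indicator (s -` {v}) w) * g v)" for w
  proof -
    have "(\<Sum>v\<in>range s. of_real (\<omega> w * indicator (s -` {v}) w) * g v) = (\<Sum>v\<in>range s. if v = s w then of_real (\<omega> w) * g v else 0)"
      by (intro sum.cong) (auto simp: indicator_def)
    then show ?thesis using fin by simp
  qed
  then have "(LINT w|lborel. of_real (\<omega> w) * g (s w)) = (LINT w|lborel. (\<Sum>v\<in>range s. of_real (\<omega> w * indicator (s -` {v}) w) * g v))"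
    by simp
  also have "\<dots> = (\<Sum>v\<in>range s. (LINT w|lborel. of_real (\<omega> w * indicator (s -` {v}) w) * g v))"
    using int by (intro Bochner_Integration.integral_sum Bochner_Integration.integrable_mult_left integrable_of_real)
  also have "\<dots> = (\<Sum>v\<in>range s. of_real (LINT w|lborel. \<omega> w * indicator (s -` {v}) w) * g v)"
    by (simp only: integral_mult_left_zero integral_complex_of_real)
  finally show ?thesis .
qed

text \<open>
  A tempered distribution commutes with integrals over a parameter. If w is replaced by a simple
  function s of w, the integral is a finite linear combination of slices, and T can be applied term by
  term. Simple functions \<open>s i\<close> that converge to the identity give the claim in the limit, since the slices
  depend on w in a Lipschitz way (\<open>slice_lipschitz\<close>). To integrate against a finite measure, the weight
  \<open>\<omega> = 1 / q\<close> is split off; \<open>G = q * H\<close> is still a Schwartz function.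
\<close>
theorem tempered_integral:
  fixes H :: "'w::euclidean_space \<times> 'a::euclidean_space \<Rightarrow> complex"
  assumes T: "tempered T" and H: "schwartz H"
  shows "T (\<lambda>x. LINT w|lborel. H (w, x)) = (LINT w|lborel. T (\<lambda>x. H (w, x)))"
proof -
  \<comment> \<open>With this exponent even \<open>(1 + norm w) * \<omega> w\<close> is integrable, which dominates \<open>norm (s i w - w) * \<omega> w\<close>.\<close>
  let ?p = "Suc (DIM('w))"
  define q :: "'w \<Rightarrow> real" where "q w = (1 + w \<bullet> w) ^ ?p" for w
  define \<omega> where "\<omega> w = 1 / q w" for w
  define G where "G = (\<lambda>z::'w \<times> 'a. complex_of_real (q (fst z)) * H z)"
  have q1: "1 \<le> q w" for w unfolding q_def by (intro one_le_power) simp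
  then have qpos: "0 < q w" for w using less_le_trans[OF zero_less_one] by blast
  have \<omega>0: "0 \<le> \<omega> w" for w using qpos[of w] by (simp add: \<omega>_def)
  have \<omega>_meas [measurable]: "\<omega> \<in> borel_measurable borel"
    unfolding \<omega>_def q_def by measurable
  have \<omega>_le: "(1 + norm w) * \<omega> w \<le> 2 ^ ?p / (1 + norm w) ^ (2 * DIM('w))" for w
  proof -
    have "0 \<le> (1 - norm w)\<^sup>2" by simp
    then have "(1 + norm w)\<^sup>2 \<le> 2 * (1 + w \<bullet> w)"
      by (simp add: power2_eq_square dot_square_norm algebra_simps)
    then have "((1 + norm w)\<^sup>2) ^ ?p \<le> (2 * (1 + w \<bullet> w)) ^ ?p" by (intro power_mono) auto
    then have "(1 + norm w) ^ (2 * ?p) \<le> 2 ^ ?p * q w"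
      by (simp only: q_def power_mult power_mult_distrib)
    moreover have "(1 + norm w) * (1 + norm w) ^ (2 * DIM('w)) \<le> (1 + norm w) ^ (2 * ?p)"
      by (simp flip: power_Suc add: power_increasing)
    ultimately have "(1 + norm w) * (1 + norm w) ^ (2 * DIM('w)) \<le> 2 ^ ?p * q w" by linarith
    then show ?thesis using qpos[of w]
      by (simp add: \<omega>_def pos_le_divide_eq pos_divide_le_eq add_pos_nonneg mult_ac)
  qed
  have int\<omega>1: "integrable lborel (\<lambda>w. (1 + norm w) * \<omega> w)"
    by (rule Bochner_Integration.integrable_bound[OF integrable_weight[OF order_refl, of "2 ^ ?p"]])
      (use \<omega>_le \<omega>0 in \<open>auto intro!: AE_I2 simp: abs_mult\<close>)
  have int\<omega>: "integrable lborel \<omega>"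
    by (rule Bochner_Integration.integrable_bound[OF int\<omega>1])
      (use \<omega>0 mult_right_mono[of 1 "1 + norm w" "\<omega> w" for w] in \<open>auto intro!: AE_I2 simp: abs_mult\<close>)
  have multq: "multiplier (\<lambda>z::'w \<times> 'a. complex_of_real (q (fst z)))"
  proof -
    have "multiplier (\<lambda>w::'w. (1 + complex_of_real (w \<bullet> w)) ^ ?p)"
      by (intro multiplier_power multiplier_add multiplier_const multiplier_inner_square)
    from multiplier_pullback[OF this has_derivative_fst[OF has_derivative_ident]]
    show ?thesis by (simp add: q_def)
  qed
  have G: "schwartz G" unfolding G_def by (rule schwartz_mult[OF multq H])
  have GH: "of_real (\<omega> w) * G (w, x) = H (w, x)" for w x
    using qpos[of w] by (simp add: \<omega>_def G_def)
  define g where "g w = T (\<lambda>x. G (w, x))" for w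
  have g: "schwartz g" unfolding g_def by (rule schwartz_tempered_slice[OF T G])
  have gH: "of_real (\<omega> w) * g w = T (\<lambda>x. H (w, x))" for w
    unfolding g_def by (subst tempered_cmult[OF T schwartz_slice(1)[OF G], symmetric]) (simp add: GH)
  have "\<exists>s. (\<forall>i. simple_function lborel (s i)) \<and> (\<forall>w\<in>space lborel. (\<lambda>i. s i w) \<longlonglongrightarrow> w) \<and>
     (\<forall>i. \<forall>w\<in>space lborel. dist (s i w) (0::'w) \<le> 2 * dist w 0)"
    by (rule borel_measurable_implies_sequence_metric) simp
  then obtain s where simple: "\<And>i. simple_function lborel (s i)" and lim: "\<And>w. (\<lambda>i. s i w) \<longlonglongrightarrow> w"
    and s_le: "\<And>i w. norm (s i w) \<le> 2 * norm (w::'w)" by auto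
  have s_meas [measurable]: "s i \<in> borel_measurable borel" for i
    using borel_measurable_simple_function[OF simple[of i]] by simp
  have d_le: "norm (s i w - w) \<le> 3 * (1 + norm w)" for i w
    using norm_triangle_ineq4[of "s i w" w] s_le[of i w] by simp
  define I where "I i x = (LINT w|lborel. of_real (\<omega> w) * G (s i w, x))" for i x
  define c where "c i v = (LINT w|lborel. \<omega> w * indicator (s i -` {v}) w)" for i v
  have fin: "finite (range (s i))" for i using simple_functionD(1)[OF simple[of i]] by simp
  have I_eq: "I i = (\<lambda>x. \<Sum>v\<in>range (s i). of_real (c i v) * G (v, x))" for i
    unfolding I_def c_def using simple_function_integral_mult[OF simple int\<omega>, of "\<lambda>v. G (v, x)" for x] by (intro ext)
  have I_schwartz: "schwartz (I i)" for i
    unfolding I_eq by (intro schwartz_sum schwartz_cmult schwartz_slice(1) G fin)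
  have TI: "T (I i) = (LINT w|lborel. of_real (\<omega> w) * g (s i w))" for i
  proof -
    have "T (I i) = (\<Sum>v\<in>range (s i). of_real (c i v) * g v)"
      unfolding I_eq g_def using fin
      by (subst tempered_sum[OF T]) (auto intro!: schwartz_cmult schwartz_slice(1)[OF G] simp: tempered_cmult[OF T schwartz_slice(1)[OF G]])
    then show ?thesis using simple_function_integral_mult[OF simple int\<omega>, of g i] by (simp add: c_def)
  qed
  have "(\<lambda>i. T (I i)) \<longlonglongrightarrow> T (\<lambda>x. LINT w|lborel. H (w, x))"
  proof (rule tempered_tendsto[OF T I_schwartz schwartz_integral[OF H]])
    fix N
    obtain C where C: "0 \<le> C" "\<And>v w. deriv_bound N (decay (C * norm (v - w)) N) (\<lambda>x. G (v, x) - G (w, x))"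
      using slice_lipschitz[OF G] by blast
    obtain D where D: "0 \<le> D" "\<And>v w. deriv_bound (N + 2) (decay (D * norm (v - w)) 0) (\<lambda>x. G (v, x) - G (w, x))"
      using slice_lipschitz[OF G] by blast
    let ?W = "\<lambda>C i w. C * (\<omega> w * norm (s i w - w))"
    have Wb: "\<omega> w * norm (s i w - w) \<le> 3 * ((1 + norm w) * \<omega> w)" for i w
      using mult_left_mono[OF d_le \<omega>0] by (simp add: mult_ac)
    have intW: "integrable lborel (\<lambda>w. \<omega> w * norm (s i w - w))" for i
      by (rule Bochner_Integration.integrable_bound[OF Bochner_Integration.integrable_mult_right[OF int\<omega>1, of 3]])
        (use Wb \<omega>0 in \<open>auto intro!: AE_I2 simp: abs_mult\<close>)
    have conv: "(\<lambda>i. LINT w|lborel. \<omega> w * norm (s i w - w)) \<longlonglongrightarrow> (LINT w|(lborel::'w measure). 0::real)"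
    proof (rule integral_dominated_convergence[where w = "\<lambda>w. 3 * ((1 + norm w) * \<omega> w)" and M = "lborel::'w measure"])
      show "AE w in lborel. (\<lambda>i. \<omega> w * norm (s i w - w)) \<longlonglongrightarrow> 0"
      proof (intro AE_I2)
        fix w
        have "(\<lambda>i. \<omega> w * norm (s i w - w)) \<longlonglongrightarrow> \<omega> w * norm (w - w)" by (intro tendsto_intros lim)
        then show "(\<lambda>i. \<omega> w * norm (s i w - w)) \<longlonglongrightarrow> 0" by simp
      qed
    qed (use int\<omega>1 Wb \<omega>0 in \<open>auto intro!: AE_I2 simp: abs_mult\<close>)
    have diff: "I i x - (LINT w|lborel. H (w, x)) = (LINT w|lborel. of_real (\<omega> w) * (G (s i w, x) - G (w, x)))" for i x
    proof -
      have mG [measurable]: "(\<lambda>w. G (w, x)) \<in> borel_measurable borel"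
        by (rule schwartz_measurable[OF schwartz_slice(2)[OF G]])
      obtain B where B: "0 \<le> B" "\<And>w. norm (G (w, x)) \<le> B" using schwartz_bounded[OF schwartz_slice(2)[OF G]] by blast
      have "integrable lborel (\<lambda>w. of_real (\<omega> w) * G (s i w, x))"
        by (rule Bochner_Integration.integrable_bound[OF Bochner_Integration.integrable_mult_left[OF int\<omega>, of B]])
          (use B \<omega>0 in \<open>auto intro!: AE_I2 mult_left_mono simp: norm_mult abs_mult\<close>)
      moreover have "integrable lborel (\<lambda>w. of_real (\<omega> w) * G (w, x))"
        unfolding GH by (rule schwartz_integrable[OF schwartz_slice(2)[OF H]])
      ultimately have "(LINT w|lborel. of_real (\<omega> w) * G (s i w, x)) - (LINT w|lborel. of_real (\<omega> w) * G (w, x)) =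
          (LINT w|lborel. of_real (\<omega> w) * G (s i w, x) - of_real (\<omega> w) * G (w, x))"
        by (rule Bochner_Integration.integral_diff[symmetric])
      then show ?thesis unfolding I_def GH right_diff_distrib .
    qed
    have "deriv_bound N (decay ((C * (LINT w|lborel. \<omega> w * norm (s i w - w)))) N)
        (\<lambda>x. I i x - (LINT w|lborel. H (w, x)))" for i
    proof -
      have "deriv_bound N (\<lambda>x. (LINT w|lborel. ?W C i w) * (1 / (1 + norm x) ^ N))
          (\<lambda>x. LINT w|lborel. of_real (\<omega> w) * (G (s i w, x) - G (w, x)))"
      proof (rule deriv_bound_integral)
        show "integrable lborel (?W C i)" "integrable lborel (?W D i)"
          by (intro Bochner_Integration.integrable_mult_right intW)+
        show "(\<lambda>w. of_real (\<omega> w) * (G (s i w, x) - G (w, x))) \<in> borel_measurable lborel" for x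
        proof -
          have [measurable]: "(\<lambda>w. G (w, x)) \<in> borel_measurable borel"
            by (rule schwartz_measurable[OF schwartz_slice(2)[OF G]])
          show ?thesis by measurable
        qed
        fix w
        show "deriv_bound N (\<lambda>x. ?W C i w * (1 / (1 + norm x) ^ N)) (\<lambda>x. of_real (\<omega> w) * (G (s i w, x) - G (w, x)))"
          by (rule deriv_bound_mono[OF deriv_bound_cmult[OF C(2)]]) (simp add: \<omega>0 mult_ac)
        show "deriv_bound (N + 2) (\<lambda>_. ?W D i w) (\<lambda>x. of_real (\<omega> w) * (G (s i w, x) - G (w, x)))"
          by (rule deriv_bound_mono[OF deriv_bound_cmult[OF D(2)]]) (simp add: \<omega>0 mult_ac)
      qed
      then show ?thesis unfolding diff by simp
    qed
    moreover have "(\<lambda>i. C * (LINT w|lborel. \<omega> w * norm (s i w - w))) \<longlonglongrightarrow> 0"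
      using tendsto_mult_left[OF conv, of C] by simp
    ultimately show "\<exists>e. e \<longlonglongrightarrow> 0 \<and> (\<forall>\<^sub>F i in sequentially. deriv_bound N (decay (e i) N)
        (\<lambda>x. I i x - (LINT w|lborel. H (w, x))))"
      by (intro exI[of _ "\<lambda>i. C * (LINT w|lborel. \<omega> w * norm (s i w - w))"]) auto
  qed
  moreover have "(\<lambda>i. T (I i)) \<longlonglongrightarrow> (LINT w|lborel. of_real (\<omega> w) * g w)"
    unfolding TI
  proof -
    obtain B where B: "0 \<le> B" "\<And>w. norm (g w) \<le> B" using schwartz_bounded[OF g] by blast
    have [measurable]: "g \<in> borel_measurable borel" by (rule schwartz_measurable[OF g])
    show "(\<lambda>i. LINT w|lborel. of_real (\<omega> w) * g (s i w)) \<longlonglongrightarrow> (LINT w|lborel. of_real (\<omega> w) * g w)"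
    proof (rule integral_dominated_convergence[where w = "\<lambda>w. \<omega> w * B"])
      show "AE w in lborel. (\<lambda>i. of_real (\<omega> w) * g (s i w)) \<longlonglongrightarrow> of_real (\<omega> w) * g w"
      proof (intro AE_I2 tendsto_mult tendsto_const)
        fix w :: 'w
        have "isCont g w"
          using smooth_continuous[OF schwartz_smooth[OF g], of UNIV] by (simp add: continuous_on_eq_continuous_at)
        then show "(\<lambda>i. g (s i w)) \<longlonglongrightarrow> g w" by (rule isCont_tendsto_compose[OF _ lim])
      qed
    qed (use B \<omega>0 int\<omega> in \<open>auto intro!: AE_I2 mult_left_mono simp: norm_mult\<close>)
  qed
  ultimately show ?thesis unfolding gH by (rule LIMSEQ_unique)
qed

section \<open>Cutoffs at infinity\<close>

text \<open>
  The function \<open>\<eta> - 1\<close> vanishes near 0, so it is bounded, together with its derivatives, by a multiple of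
  \<open>norm y\<close>. At \<open>y = A x / R\<close> this is a factor \<open>1 / R\<close>, paid for by one power of \<open>norm x\<close>.
\<close>
lemma tempered_cutoff_tendsto:
  fixes A :: "'a::euclidean_space \<Rightarrow> 'b::euclidean_space"
  assumes T: "tempered T" and \<eta>: "test_function \<eta>" and \<eta>1: "\<forall>\<^sub>F y in nhds 0. \<eta> y = 1"
    and A: "linear A" and \<phi>: "schwartz \<phi>"
  shows "((\<lambda>R. T (\<lambda>x. \<eta> (A x /\<^sub>R R) * \<phi> x)) \<longlongrightarrow> T \<phi>) at_top"
proof (rule tempered_tendsto[OF T _ \<phi>])
  have dA: "((\<lambda>x. A x /\<^sub>R R) has_derivative (\<lambda>h. A h /\<^sub>R R)) (at x)" for R x
    by (intro has_derivative_scaleR_right linear_imp_has_derivative A)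
  show "schwartz (\<lambda>x. \<eta> (A x /\<^sub>R R) * \<phi> x)" for R
    by (rule schwartz_mult[OF multiplier_pullback[OF test_function_multiplier[OF \<eta>] dA] \<phi>])
  obtain U where U: "open U" "0 \<in> U" "\<And>y. y \<in> U \<Longrightarrow> \<eta> y = 1" using \<eta>1 by (auto simp: eventually_nhds)
  then obtain \<delta> where \<delta>: "0 < \<delta>" "\<And>y. y \<in> ball 0 \<delta> \<Longrightarrow> \<eta> y = 1" using openE[OF U(1,2)] by (metis subsetD)
  obtain K where K: "1 \<le> K" "\<And>b. b \<in> Basis \<Longrightarrow> (\<Sum>c\<in>Basis. \<bar>A b \<bullet> c\<bar>) \<le> K"
    using pullback_const_exists[of A] by blast
  obtain B where B: "0 < B" "\<And>x. norm (A x) \<le> B * norm x" using linear_bounded_pos[OF A] by blast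
  fix N
  obtain C where "deriv_bound N (decay C 0) \<eta>"
    using test_function_schwartz[OF \<eta>] schwartz_iff by blast
  then have "deriv_bound N (\<lambda>x. C + 1) (\<lambda>y. \<eta> y - 1)"
    using deriv_bound_diff[OF _ deriv_bound_const[of 1 1]] by simp
  then have "deriv_bound N (\<lambda>y. if y \<in> ball 0 \<delta> then 0 else C + 1) (\<lambda>y. \<eta> y - 1)"
    by (rule deriv_bound_zero_on_open) (auto simp: \<delta>(2))
  then have \<mu>: "deriv_bound N (\<lambda>y. (\<bar>C\<bar> + 1) / \<delta> * norm y) (\<lambda>y. \<eta> y - 1)"
  proof (rule deriv_bound_mono)
    fix y :: 'b
    have "C + 1 \<le> (\<bar>C\<bar> + 1) / \<delta> * norm y" if "\<delta> \<le> norm y"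
    proof -
      have "(\<bar>C\<bar> + 1) * 1 \<le> (\<bar>C\<bar> + 1) * (norm y / \<delta>)" using that \<delta>(1) by (intro mult_left_mono) auto
      then show ?thesis by simp
    qed
    then show "(if y \<in> ball 0 \<delta> then 0 else C + 1) \<le> (\<bar>C\<bar> + 1) / \<delta> * norm y" using \<delta>(1) by auto
  qed
  obtain D where D: "deriv_bound N (decay D (Suc N)) \<phi>" using \<phi> schwartz_iff by blast
  have D0: "0 \<le> D" using deriv_bound_nonneg[OF D, of 0] by simp
  define E where "E = 2 ^ N * (K ^ N * ((\<bar>C\<bar> + 1) / \<delta> * B)) * D"
  have "deriv_bound N (\<lambda>x. E / R / (1 + norm x) ^ N) (\<lambda>x. \<eta> (A x /\<^sub>R R) * \<phi> x - \<phi> x)" if R: "1 \<le> R" for R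
  proof -
    have KR: "(\<Sum>c\<in>Basis. \<bar>(A b /\<^sub>R R) \<bullet> c\<bar>) \<le> K" if b: "b \<in> Basis" for b
    proof -
      have "(\<Sum>c\<in>Basis. \<bar>(A b /\<^sub>R R) \<bullet> c\<bar>) \<le> (\<Sum>c\<in>Basis. \<bar>A b \<bullet> c\<bar>)"
      proof (rule sum_mono)
        fix c :: 'b
        have "\<bar>inverse R\<bar> * \<bar>A b \<bullet> c\<bar> \<le> 1 * \<bar>A b \<bullet> c\<bar>"
          using R by (intro mult_right_mono) (auto simp: inverse_le_1_iff)
        then show "\<bar>(A b /\<^sub>R R) \<bullet> c\<bar> \<le> \<bar>A b \<bullet> c\<bar>" by (simp add: abs_mult)
      qed
      then show ?thesis using K(2)[OF b] by linarith
    qed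
    have "deriv_bound N (\<lambda>x. 2 ^ N * (K ^ N * ((\<bar>C\<bar> + 1) / \<delta> * norm (A x /\<^sub>R R))) * (D / (1 + norm x) ^ Suc N))
        (\<lambda>x. (\<eta> (A x /\<^sub>R R) - 1) * \<phi> x)"
      by (intro deriv_bound_mult D deriv_bound_pullback[OF dA K(1) KR \<mu>])
    then have "deriv_bound N (\<lambda>x. E / R / (1 + norm x) ^ N) (\<lambda>x. (\<eta> (A x /\<^sub>R R) - 1) * \<phi> x)"
    proof (rule deriv_bound_mono)
      fix x
      have "norm (A x /\<^sub>R R) \<le> B * (1 + norm x) / R"
      proof -
        have "norm (A x) \<le> B * (1 + norm x)" using B(1) B(2)[of x] by (simp add: distrib_left)
        then show ?thesis using R by (simp add: divide_right_mono divide_inverse mult.commute)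
      qed
      then have "2 ^ N * (K ^ N * ((\<bar>C\<bar> + 1) / \<delta> * norm (A x /\<^sub>R R))) * (D / (1 + norm x) ^ Suc N) \<le>
        2 ^ N * (K ^ N * ((\<bar>C\<bar> + 1) / \<delta> * (B * (1 + norm x) / R))) * (D / (1 + norm x) ^ Suc N)"
        using K(1) \<delta>(1) D0 by (intro mult_right_mono mult_left_mono) auto
      also have "\<dots> = E / R / (1 + norm x) ^ N"
      proof -
        have "1 + norm x \<noteq> 0" using norm_ge_zero[of x] by linarith
        then show ?thesis by (simp add: E_def)
      qed
      finally show "2 ^ N * (K ^ N * ((\<bar>C\<bar> + 1) / \<delta> * norm (A x /\<^sub>R R))) * (D / (1 + norm x) ^ Suc N) \<le> E / R / (1 + norm x) ^ N" .
    qed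
    then show ?thesis by (simp add: algebra_simps)
  qed
  moreover have "((\<lambda>R. E / R) \<longlongrightarrow> 0) at_top"
    by (rule tendsto_divide_0[OF tendsto_const filterlim_at_top_imp_at_infinity[OF filterlim_ident]])
  ultimately show "\<exists>e. (e \<longlongrightarrow> 0) at_top \<and> (\<forall>\<^sub>F R in at_top. deriv_bound N (decay (e R) N)
      (\<lambda>x. \<eta> (A x /\<^sub>R R) * \<phi> x - \<phi> x))"
    by (intro exI[of _ "\<lambda>R. E / R"]) (auto intro!: eventually_mono[OF eventually_ge_at_top[of 1]])
qed

lemma eventually_cutoff_eq_1: "\<forall>\<^sub>F y in nhds 0. cutoff y = 1"
proof -
  have "\<forall>\<^sub>F y in nhds 0. y \<in> ball (0::'a) 1" by (rule eventually_nhds_in_open) auto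
  then show ?thesis by eventually_elim (simp add: cutoff_eq_1)
qed

section \<open>Supports\<close>

lemma cutoff_bump:
  fixes x :: "'a::euclidean_space"
  assumes "0 < r"
  shows "test_function (\<lambda>y. cutoff ((y - x) /\<^sub>R r))" "fun_support (\<lambda>y. cutoff ((y - x) /\<^sub>R r)) \<subseteq> cball x (2 * r)"
    "y \<in> ball x r \<Longrightarrow> cutoff ((y - x) /\<^sub>R r) = 1"
proof -
  have n: "norm ((y - x) /\<^sub>R r) = dist x y / r" for y
    using assms by (simp add: dist_norm norm_minus_commute divide_inverse mult.commute)
  have out: "cutoff ((y - x) /\<^sub>R r) = 0" if "y \<notin> cball x (2 * r)" for y
    using that assms by (intro cutoff_eq_0) (simp only: n, simp add: pos_le_divide_eq)
  have "smooth (\<lambda>y. cutoff ((y - x) /\<^sub>R r))"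
    by (rule smooth_pullback[OF smooth_cutoff, where A = "\<lambda>h. h /\<^sub>R r"]) (auto intro!: derivative_eq_intros)
  then show "test_function (\<lambda>y. cutoff ((y - x) /\<^sub>R r))"
    using out by (rule test_functionI[OF _ compact_cball])
  show "fun_support (\<lambda>y. cutoff ((y - x) /\<^sub>R r)) \<subseteq> cball x (2 * r)"
    using out by (intro fun_support_subset_closed) auto
  show "y \<in> ball x r \<Longrightarrow> cutoff ((y - x) /\<^sub>R r) = 1"
    using assms by (intro cutoff_eq_1) (simp only: n, simp)
qed

text \<open>
  \<open>dist_support T\<close> is the complement of the union of the open sets on which T vanishes; the point is that
  T vanishes on this union. The support of \<open>\<phi>\<close> is covered by finitely many balls, with bump functions \<open>b x\<close>
  that are 1 on the balls and supported where T vanishes. Multiplying a test function by \<open>1 - b x\<close> does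
  not change its pairing with T, and the product of all \<open>1 - b x\<close> annihilates \<open>\<phi>\<close>.
\<close>
lemma tempered_zero_off_support:
  assumes T: "tempered T" and \<phi>: "test_function \<phi>" and disj: "fun_support \<phi> \<inter> dist_support T = {}"
  shows "T \<phi> = 0"
proof -
  have "\<forall>x. \<exists>r. x \<in> fun_support \<phi> \<longrightarrow> 0 < r \<and> (\<forall>\<psi>. test_function \<psi> \<longrightarrow> fun_support \<psi> \<subseteq> cball x (2 * r) \<longrightarrow> T \<psi> = 0)"
  proof (intro allI)
    fix x
    show "\<exists>r. x \<in> fun_support \<phi> \<longrightarrow> 0 < r \<and> (\<forall>\<psi>. test_function \<psi> \<longrightarrow> fun_support \<psi> \<subseteq> cball x (2 * r) \<longrightarrow> T \<psi> = 0)"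
    proof (cases "x \<in> fun_support \<phi>")
      case True
      then have "x \<notin> dist_support T" using disj by blast
      then obtain U where U: "open U" "x \<in> U" "\<And>\<psi>. test_function \<psi> \<Longrightarrow> fun_support \<psi> \<subseteq> U \<Longrightarrow> T \<psi> = 0"
        unfolding dist_support_def by blast
      obtain e where e: "0 < e" "cball x e \<subseteq> U" using U(1,2) open_contains_cball by blast
      then have "cball x (2 * (e / 2)) \<subseteq> U" by simp
      then show ?thesis using U(3) e(1) by (intro exI[of _ "e / 2"]) auto
    qed auto
  qed
  from choice[OF this] obtain r where r: "\<And>x. x \<in> fun_support \<phi> \<Longrightarrow> 0 < r x"
    "\<And>x \<psi>. x \<in> fun_support \<phi> \<Longrightarrow> test_function \<psi> \<Longrightarrow> fun_support \<psi> \<subseteq> cball x (2 * r x) \<Longrightarrow> T \<psi> = 0" by blast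
  have cover: "fun_support \<phi> \<subseteq> (\<Union>x\<in>fun_support \<phi>. ball x (r x))" using r(1) by force
  have "compact (fun_support \<phi>)" using \<phi> by (simp add: test_function_def)
  from compactE_image[OF this _ cover]
  obtain F where F: "F \<subseteq> fun_support \<phi>" "finite F" "fun_support \<phi> \<subseteq> (\<Union>x\<in>F. ball x (r x))"
    by auto
  define b where "b x y = cutoff ((y - x) /\<^sub>R r x)" for x y
  have b: "test_function (b x)" "fun_support (b x) \<subseteq> cball x (2 * r x)" "\<And>y. y \<in> ball x (r x) \<Longrightarrow> b x y = 1"
    if "x \<in> F" for x
    unfolding b_def[abs_def]
    using cutoff_bump(1,2)[of "r x" x] cutoff_bump(3)[where x = x and r = "r x"] r(1) F(1) that by auto
  have "test_function (\<lambda>y. (\<Prod>x\<in>F. 1 - b x y) * \<phi> y) \<and> T (\<lambda>y. (\<Prod>x\<in>F. 1 - b x y) * \<phi> y) = T \<phi>"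
    using F(2) b F(1)
  proof (induction F rule: finite_induct)
    case empty
    show ?case using \<phi> by simp
  next
    case (insert x F)
    let ?\<psi> = "\<lambda>y. (\<Prod>x\<in>F. 1 - b x y) * \<phi> y"
    have \<psi>: "test_function ?\<psi>" "T ?\<psi> = T \<phi>" using insert by auto
    have bx: "test_function (b x)" "fun_support (b x) \<subseteq> cball x (2 * r x)" using insert.prems by auto
    then have "smooth (b x)" by (simp add: test_function_def)
    then have t: "test_function (\<lambda>y. b x y * ?\<psi> y)" by (rule test_function_mult[OF _ \<psi>(1)])
    have "fun_support (\<lambda>y. b x y * ?\<psi> y) \<subseteq> fun_support (b x)"
    proof (rule fun_support_subset_closed)
      show "closed (fun_support (b x))" by (simp add: fun_support_def)
      show "b x y * ?\<psi> y = 0" if "y \<notin> fun_support (b x)" for y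
        using zero_outside_fun_support[OF that] by simp
    qed
    then have "T (\<lambda>y. b x y * ?\<psi> y) = 0"
      using bx(2) insert.prems by (intro r(2)[of x] t) auto
    then have "T (\<lambda>y. ?\<psi> y - b x y * ?\<psi> y) = T \<phi>"
      using tempered_diff[OF T test_function_schwartz[OF \<psi>(1)] test_function_schwartz[OF t]] \<psi>(2) by simp
    moreover have "test_function (\<lambda>y. (1 - b x y) * ?\<psi> y)"
      by (intro test_function_mult smooth_diff smooth_const \<open>smooth (b x)\<close> \<psi>(1))
    moreover have "(\<lambda>y. ?\<psi> y - b x y * ?\<psi> y) = (\<lambda>y. (\<Prod>x\<in>insert x F. 1 - b x y) * \<phi> y)"
      "(\<lambda>y. (1 - b x y) * ?\<psi> y) = (\<lambda>y. (\<Prod>x\<in>insert x F. 1 - b x y) * \<phi> y)"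
      using insert.hyps by (simp_all add: algebra_simps)
    ultimately show ?case by simp
  qed
  moreover have "(\<lambda>y. (\<Prod>x\<in>F. 1 - b x y) * \<phi> y) = (\<lambda>_. 0)"
  proof
    fix y
    show "(\<Prod>x\<in>F. 1 - b x y) * \<phi> y = 0"
    proof (cases "y \<in> fun_support \<phi>")
      case True
      then obtain x where "x \<in> F" "y \<in> ball x (r x)" using F(3) by blast
      then have "\<exists>x\<in>F. 1 - b x y = 0" using b(3) by auto
      then show ?thesis using F(2) by (simp add: prod_zero)
    qed (simp add: zero_outside_fun_support)
  qed
  ultimately show ?thesis using tempered_zero[OF T] by simp
qed

text \<open>
  The difference of the two test functions vanishes near the support of T, but its own support is not
  compact; hence the cutoffs \<open>cutoff (z / R)\<close> in all variables.
\<close>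
lemma tempered_cutoff_fst:
  fixes T :: "('a::euclidean_space \<times> 'b::euclidean_space \<Rightarrow> complex) \<Rightarrow> complex"
  assumes T: "tempered T" and r: "0 < r" and supp: "dist_support T \<subseteq> {u. norm u < r} \<times> UNIV" and \<phi>: "schwartz \<phi>"
  shows "T (\<lambda>z. cutoff (fst z /\<^sub>R r) * \<phi> z) = T \<phi>"
proof -
  have d: "((\<lambda>z::'a \<times> 'b. fst z /\<^sub>R r) has_derivative (\<lambda>h. fst h /\<^sub>R r)) (at z)" for z
    by (auto intro!: derivative_eq_intros)
  have \<chi>: "schwartz (\<lambda>z. cutoff (fst z /\<^sub>R r) * \<phi> z)"
    by (rule schwartz_mult[OF multiplier_pullback[OF test_function_multiplier[OF test_function_cutoff] d] \<phi>])
  define \<psi> where "\<psi> z = \<phi> z - cutoff (fst z /\<^sub>R r) * \<phi> z" for z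
  have \<psi>: "schwartz \<psi>" unfolding \<psi>_def[abs_def] by (intro schwartz_diff \<phi> \<chi>)
  have "T (\<lambda>z. cutoff (z /\<^sub>R R) * \<psi> z) = 0" if R: "1 \<le> R" for R
  proof (rule tempered_zero_off_support[OF T])
    have t: "test_function (\<lambda>z::'a \<times> 'b. cutoff (z /\<^sub>R R))" using cutoff_bump(1)[of R 0] R by simp
    show "test_function (\<lambda>z. cutoff (z /\<^sub>R R) * \<psi> z)"
      using test_function_mult[OF schwartz_smooth[OF \<psi>] t] by (simp add: mult.commute)
    have "closed {z::'a \<times> 'b. r \<le> norm (fst z)}" by (intro closed_Collect_le continuous_intros)
    moreover have "cutoff (z /\<^sub>R R) * \<psi> z = 0" if "z \<notin> {z. r \<le> norm (fst z)}" for z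
    proof -
      have "cutoff (fst z /\<^sub>R r) = 1" using that r by (intro cutoff_eq_1) (simp add: field_simps)
      then show ?thesis by (simp add: \<psi>_def)
    qed
    ultimately have "fun_support (\<lambda>z. cutoff (z /\<^sub>R R) * \<psi> z) \<subseteq> {z. r \<le> norm (fst z)}"
      by (rule fun_support_subset_closed)
    then show "fun_support (\<lambda>z. cutoff (z /\<^sub>R R) * \<psi> z) \<inter> dist_support T = {}" using supp by force
  qed
  then have "\<forall>\<^sub>F R in at_top. T (\<lambda>z. cutoff (z /\<^sub>R R) * \<psi> z) = 0"
    by (intro eventually_mono[OF eventually_ge_at_top[of 1]])
  moreover have "((\<lambda>R. T (\<lambda>z. cutoff (z /\<^sub>R R) * \<psi> z)) \<longlongrightarrow> T \<psi>) at_top"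
    by (rule tempered_cutoff_tendsto[OF T test_function_cutoff eventually_cutoff_eq_1 linear_id[unfolded id_def] \<psi>])
  ultimately have "((\<lambda>R. 0) \<longlongrightarrow> T \<psi>) (at_top :: real filter)"
    by (rule Lim_transform_eventually[rotated])
  then have "T \<psi> = 0" using tendsto_unique[OF _ tendsto_const] by (metis trivial_limit_at_top_linorder)
  moreover have "T \<psi> = T \<phi> - T (\<lambda>z. cutoff (fst z /\<^sub>R r) * \<phi> z)"
    unfolding \<psi>_def[abs_def] by (rule tempered_diff[OF T \<phi> \<chi>])
  ultimately show ?thesis by simp
qed

section \<open>Exponentials\<close>

lemma smooth_exp:
  assumes q: "smooth q" shows "smooth (\<lambda>x. exp (q x))"
proof (rule smoothI)
  fix k
  have d: "((\<lambda>x. exp (q x)) has_derivative (\<lambda>h. exp (q x) * frechet_derivative q (at x) h)) (at x)" for x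
    using has_derivative_compose[OF _ DERIV_exp[unfolded has_field_derivative_def]]
      smooth_differentiable[OF q, of x] by (simp add: frechet_derivative_works)
  have p: "pdiff b (\<lambda>x. exp (q x)) = (\<lambda>x. exp (q x) * pdiff b q x)" for b
    by (subst pdiff_eqI'[OF d]) (simp add: pdiff_def)
  show "\<exists>w. deriv_bound k w (\<lambda>x. exp (q x))"
  proof (induction k)
    case 0
    show ?case by auto
  next
    case (Suc k)
    show ?case
    proof (rule exists_deriv_bound_Suc)
      show "(\<lambda>x. exp (q x)) differentiable (at x)" for x using d differentiable_def by blast
      fix b :: 'a assume "b \<in> Basis"
      then obtain v where "deriv_bound k v (pdiff b q)" using smooth_deriv_bound[OF smooth_pdiff[OF q]] by blast
      moreover obtain w where "deriv_bound k w (\<lambda>x. exp (q x))" using Suc by blast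
      ultimately show "\<exists>w. deriv_bound k w (pdiff b (\<lambda>x. exp (q x)))"
        unfolding p by (intro exI) (rule deriv_bound_mult | assumption)+
    qed
  qed
qed

lemma multiplier_smooth: "multiplier f \<Longrightarrow> smooth f"
  unfolding multiplier_def by (intro smoothI) blast

text \<open>
  The exponential has modulus 1, and each differentiation produces a factor of polynomial growth.
\<close>
lemma multiplier_exp_imaginary:
  assumes q: "multiplier q" and Re: "\<And>x. Re (q x) = 0"
  shows "multiplier (\<lambda>x. exp (q x))"
  unfolding multiplier_def
proof
  fix k
  have d: "((\<lambda>x. exp (q x)) has_derivative (\<lambda>h. exp (q x) * frechet_derivative q (at x) h)) (at x)" for x
    using has_derivative_compose[OF _ DERIV_exp[unfolded has_field_derivative_def]]
      smooth_differentiable[OF multiplier_smooth[OF q], of x] by (simp add: frechet_derivative_works)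
  have p: "pdiff b (\<lambda>x. exp (q x)) = (\<lambda>x. exp (q x) * pdiff b q x)" for b
    by (subst pdiff_eqI'[OF d]) (simp add: pdiff_def)
  show "\<exists>C m. deriv_bound k (\<lambda>x. C * (1 + norm x) ^ m) (\<lambda>x. exp (q x))"
  proof (induction k)
    case 0
    show ?case by (rule exI[of _ 1], rule exI[of _ 0]) (simp add: Re)
  next
    case (Suc k)
    then obtain C m where C: "deriv_bound k (\<lambda>x. C * (1 + norm x) ^ m) (\<lambda>x. exp (q x))" by blast
    obtain D n where D: "deriv_bound (Suc k) (\<lambda>x. D * (1 + norm x) ^ n) q"
      using q unfolding multiplier_def by blast
    have C0: "0 \<le> C" and D0: "0 \<le> D" using deriv_bound_nonneg[OF C, of 0] deriv_bound_nonneg[OF D, of 0] by auto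
    let ?E = "1 + 2 ^ k * C * D"
    have "deriv_bound k (\<lambda>x. ?E * (1 + norm x) ^ (m + n)) (pdiff b (\<lambda>x. exp (q x)))" if "b \<in> Basis" for b
    proof -
      have "deriv_bound k (\<lambda>x. D * (1 + norm x) ^ n) (pdiff b q)" using D that by simp
      from deriv_bound_mult[OF C this] show ?thesis unfolding p
      proof (rule deriv_bound_mono)
        fix x
        have "2 ^ k * (C * (1 + norm x) ^ m) * (D * (1 + norm x) ^ n) = (2 ^ k * C * D) * (1 + norm x) ^ (m + n)"
          by (simp add: power_add)
        also have "\<dots> \<le> ?E * (1 + norm x) ^ (m + n)" by (intro mult_right_mono) auto
        finally show "2 ^ k * (C * (1 + norm x) ^ m) * (D * (1 + norm x) ^ n) \<le> ?E * (1 + norm x) ^ (m + n)" .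
      qed
    qed
    moreover have "norm (exp (q x)) \<le> ?E * (1 + norm x) ^ (m + n)" for x
    proof -
      have "1 * 1 \<le> ?E * (1 + norm x) ^ (m + n)"
        using C0 D0 by (intro mult_mono one_le_power) auto
      then show ?thesis by (simp add: Re)
    qed
    moreover have "(\<lambda>x. exp (q x)) differentiable (at x)" for x using d differentiable_def by blast
    ultimately show ?case by (intro exI[of _ ?E] exI[of _ "m + n"]) simp
  qed
qed

lemma multiplier_inner:
  "multiplier (\<lambda>z::'a::euclidean_space \<times> 'a. complex_of_real (fst z \<bullet> snd z))"
proof -
  have "multiplier (\<lambda>z::'a \<times> 'a. \<Sum>b\<in>Basis. complex_of_real (fst z \<bullet> b) * complex_of_real (snd z \<bullet> b))"
    by (intro multiplier_sum multiplier_mult multiplier_linear finite_Basis)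
      (auto intro!: linearI simp: inner_add_left scaleR_conv_of_real)
  moreover have "(\<Sum>b\<in>Basis. complex_of_real (fst z \<bullet> b) * complex_of_real (snd z \<bullet> b)) = complex_of_real (fst z \<bullet> snd z)"
    for z :: "'a \<times> 'a"
    by (subst (3) euclidean_inner) simp
  ultimately show ?thesis by simp
qed

lemma fourier_char_neg: "fourier_char u (- x) = exp (2 * pi * \<i> * of_real (x \<bullet> u))"
  by (simp add: fourier_char_def)

lemma multiplier_fourier_char_pair:
  "multiplier (\<lambda>z::'a::euclidean_space \<times> 'a. fourier_char (snd z) (- fst z))"
proof -
  have "multiplier (\<lambda>z::'a \<times> 'a. exp ((2 * pi * \<i>) * complex_of_real (fst z \<bullet> snd z)))"
    by (intro multiplier_exp_imaginary multiplier_mult multiplier_const multiplier_inner) simp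
  then show ?thesis by (simp only: fourier_char_neg mult.assoc)
qed

section \<open>Tensor products\<close>



text \<open>
  The left inverse makes g injective; this is all that the decay of \<open>\<phi> (g x)\<close> requires.
\<close>
lemma schwartz_cont_linear_iso:
  fixes g :: "'a::euclidean_space \<Rightarrow> 'b::euclidean_space" and h :: "'b \<Rightarrow> 'a"
  assumes "linear g" "linear h" "\<And>x. h (g x) = x"
  shows "schwartz_cont (\<lambda>\<phi> x. \<phi> (g x))"
  using schwartz_cont_pullback[OF linear_imp_has_derivative[OF assms(1)] linear_imp_has_derivative[OF assms(2)] assms(3)] .

lemma schwartz_linear_iso:
  fixes g :: "'a::euclidean_space \<Rightarrow> 'b::euclidean_space" and h :: "'b \<Rightarrow> 'a"
  assumes "schwartz \<phi>" "linear g" "linear h" "\<And>x. h (g x) = x"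
  shows "schwartz (\<lambda>x. \<phi> (g x))"
  by (rule schwartz_cont_schwartz[OF schwartz_cont_linear_iso[OF assms(2-4)] assms(1)])

lemma multiplier_linear_compose:
  fixes g :: "'a::euclidean_space \<Rightarrow> 'b::euclidean_space"
  assumes "multiplier f" "linear g" shows "multiplier (\<lambda>x. f (g x))"
  by (rule multiplier_pullback[OF assms(1) linear_imp_has_derivative[OF assms(2)]])

lemma schwartz_cont_tensor_left:
  fixes a :: "'a::euclidean_space \<Rightarrow> complex"
  assumes "schwartz a"
  shows "schwartz_cont (\<lambda>(\<psi>::'b::euclidean_space \<Rightarrow> complex) (u, k). a u * \<psi> k)"
proof -
  have "schwartz_cont (\<lambda>(\<psi>::'b \<Rightarrow> complex) (z::'a \<times> 'b). (\<lambda>\<psi> (k, u). \<psi> k * a u) \<psi> (prod.swap z))"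
    by (rule schwartz_cont_compose[OF schwartz_cont_linear_iso[where h = prod.swap] schwartz_cont_tensor[OF assms]])
      (auto intro!: linearI)
  then show ?thesis by (simp add: case_prod_beta' mult.commute)
qed

section \<open>Inverse partial Fourier transform\<close>

definition partial_inv_fourier ::
  "('a::euclidean_space \<times> 'b::euclidean_space \<Rightarrow> complex) \<Rightarrow> 'a \<times> 'b \<Rightarrow> complex" where
  "partial_inv_fourier \<phi> = (\<lambda>(u, k). inv_fourier (\<lambda>x. \<phi> (x, k)) u)"

lemma partial_inv_fourier_eq: "partial_inv_fourier \<phi> = (\<lambda>z. partial_fourier \<phi> (- fst z, snd z))"
  by (auto simp: partial_inv_fourier_def partial_fourier_def inv_fourier_eq)

lemma schwartz_cont_partial_inv_fourier: "schwartz_cont partial_inv_fourier"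
  unfolding partial_inv_fourier_eq[abs_def]
  by (rule schwartz_cont_compose[OF schwartz_cont_linear_iso[where h = "\<lambda>z. (- fst z, snd z)"] schwartz_cont_partial_fourier])
    (auto intro!: linearI)

lemma schwartz_partial_inv_fourier: "schwartz \<phi> \<Longrightarrow> schwartz (partial_inv_fourier \<phi>)"
  by (rule schwartz_cont_schwartz[OF schwartz_cont_partial_inv_fourier])

lemma partial_fourier_partial_inv_fourier:
  assumes "schwartz \<phi>" shows "partial_fourier (partial_inv_fourier \<phi>) = \<phi>"
  using fourier_inv_fourier[OF schwartz_slice(2)[OF assms]]
  by (auto simp: partial_fourier_def partial_inv_fourier_def)

lemma partial_fourier_add:
  "schwartz \<phi> \<Longrightarrow> schwartz \<psi> \<Longrightarrow> partial_fourier (\<lambda>z. \<phi> z + \<psi> z) = (\<lambda>z. partial_fourier \<phi> z + partial_fourier \<psi> z)"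
  unfolding partial_fourier_alt by (simp add: distrib_left integrable_partial_fourier fun_eq_iff)

lemma partial_inv_fourier_add:
  "schwartz \<phi> \<Longrightarrow> schwartz \<psi> \<Longrightarrow> partial_inv_fourier (\<lambda>z. \<phi> z + \<psi> z) = (\<lambda>z. partial_inv_fourier \<phi> z + partial_inv_fourier \<psi> z)"
  by (simp add: partial_inv_fourier_eq partial_fourier_add)

lemma partial_inv_fourier_cmult: "partial_inv_fourier (\<lambda>z. c * \<phi> z) = (\<lambda>z. c * partial_inv_fourier \<phi> z)"
  by (simp add: partial_inv_fourier_eq partial_fourier_cmult)

lemma partial_inv_fourier_snd_mult:
  "partial_inv_fourier (\<lambda>z. a (snd z) * \<phi> z) = (\<lambda>z. a (snd z) * partial_inv_fourier \<phi> z)"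
proof
  fix z :: "'a \<times> 'b"
  show "partial_inv_fourier (\<lambda>z. a (snd z) * \<phi> z) z = a (snd z) * partial_inv_fourier \<phi> z"
    unfolding partial_inv_fourier_eq partial_fourier_alt by (simp add: mult.left_commute[of _ "a (snd z)"])
qed

lemma tempered_fourier1_dist:
  fixes L :: "('a::euclidean_space \<times> 'b::euclidean_space \<Rightarrow> complex) \<Rightarrow> complex"
  assumes "tempered L" shows "tempered (fourier1_dist L)"
proof -
  have *: "fourier1_dist L = (\<lambda>\<phi>. L (partial_fourier \<phi>))"
    by (simp add: fourier1_dist_def partial_fourier_def fun_eq_iff)
  show ?thesis unfolding *
    by (rule tempered_compose[OF assms schwartz_cont_partial_fourier])
      (erule partial_fourier_add, assumption, rule partial_fourier_cmult)
qed

lemma fourier1_dist_partial_inv_fourier: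
  fixes \<phi> :: "'a::euclidean_space \<times> 'b::euclidean_space \<Rightarrow> complex"
  assumes "schwartz \<phi>" shows "fourier1_dist L (partial_inv_fourier \<phi>) = L \<phi>"
  using partial_fourier_partial_inv_fourier[OF assms]
  by (simp add: fourier1_dist_def partial_fourier_def)

section \<open>The kernel of Weyl quantization\<close>

text \<open>
  A linear change of variables in \<open>f \<otimes> \<phi>\<close> followed by a partial Fourier transform; continuity in \<open>\<phi>\<close> is read
  off from this form.
\<close>
lemma weyl_kernel_eq:
  fixes f \<phi> :: "real ^ 'n \<Rightarrow> complex"
  shows "weyl_kernel f \<phi> = (\<lambda>z. partial_fourier
    (\<lambda>w. (\<lambda>(a, b). f a * \<phi> b) (snd w - (1/2) *\<^sub>R fst w, snd w + (1/2) *\<^sub>R fst w)) (- snd z, fst z))"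
  by (auto simp: weyl_kernel_def partial_fourier_def fourier_def mult.assoc fun_eq_iff)

lemma linear_weyl_change: "linear (\<lambda>w::'a::euclidean_space \<times> 'a. (snd w - (1/2) *\<^sub>R fst w, snd w + (1/2) *\<^sub>R fst w))"
  by (rule linearI) (auto simp: algebra_simps)

lemma linear_weyl_change_inv: "linear (\<lambda>w::'a::euclidean_space \<times> 'a. (snd w - fst w, (1/2) *\<^sub>R (fst w + snd w)))"
  by (rule linearI) (auto simp: algebra_simps)

lemma schwartz_cont_weyl_kernel:
  fixes f :: "real ^ 'n \<Rightarrow> complex"
  assumes "schwartz f" shows "schwartz_cont (weyl_kernel f)"
proof -
  have inv: "(snd w + (1/2) *\<^sub>R fst w) - (snd w - (1/2) *\<^sub>R fst w) = fst w"
    "(1/2) *\<^sub>R ((snd w - (1/2) *\<^sub>R fst w) + (snd w + (1/2) *\<^sub>R fst w)) = snd w" for w :: "(real ^ 'n) \<times> (real ^ 'n)"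
    by (auto simp: vec_eq_iff)
  have c1: "schwartz_cont (\<lambda>(\<Psi>::(real ^ 'n) \<times> (real ^ 'n) \<Rightarrow> complex) w. \<Psi> (snd w - (1/2) *\<^sub>R fst w, snd w + (1/2) *\<^sub>R fst w))"
    by (rule schwartz_cont_linear_iso[OF linear_weyl_change linear_weyl_change_inv]) (simp only: fst_conv snd_conv inv prod.collapse)
  have c2: "schwartz_cont (\<lambda>(\<Psi>::(real ^ 'n) \<times> (real ^ 'n) \<Rightarrow> complex) z. \<Psi> (- snd z, fst z))"
    by (rule schwartz_cont_linear_iso[where h = "\<lambda>z. (snd z, - fst z)"]) (auto intro!: linearI)
  have "schwartz_cont (\<lambda>\<phi>::real ^ 'n \<Rightarrow> complex. \<lambda>z. partial_fourier
    (\<lambda>w. (\<lambda>(a, b). f a * \<phi> b) (snd w - (1/2) *\<^sub>R fst w, snd w + (1/2) *\<^sub>R fst w)) (- snd z, fst z))"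
    using schwartz_cont_compose[OF c2 schwartz_cont_compose[OF schwartz_cont_partial_fourier
        schwartz_cont_compose[OF c1 schwartz_cont_tensor_left[OF assms]]]] by simp
  then show ?thesis by (simp only: weyl_kernel_eq[abs_def])
qed

lemma integrable_char_mult:
  fixes G :: "'a::euclidean_space \<Rightarrow> complex"
  assumes "schwartz G" "c \<in> borel_measurable borel" "\<And>z. norm (c z) = 1"
  shows "integrable lborel (\<lambda>z. c z * G z)"
  by (rule Bochner_Integration.integrable_bound[OF integrable_norm[OF schwartz_integrable[OF assms(1)]]])
    (use assms(2) schwartz_measurable[OF assms(1)] assms(3) in \<open>auto simp: norm_mult\<close>)

text \<open>
  In the variables \<open>a = p - q/2\<close> and \<open>b = p + q/2\<close> the phase \<open>p \<bullet> u + k \<bullet> q\<close> is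
  \<open>- (k - u/2) \<bullet> a + (k + u/2) \<bullet> b\<close>, so the double integral factors. The change of variables is made by
  the translations \<open>p = a + q/2\<close> and \<open>b = q + a\<close>, with an exchange of the integrals between them.
\<close>
lemma partial_inv_fourier_weyl_kernel:
  fixes g \<phi> :: "real ^ 'n \<Rightarrow> complex"
  assumes g: "schwartz g" and \<phi>: "schwartz \<phi>"
  shows "partial_inv_fourier (weyl_kernel g \<phi>) (u, k) = fourier g (k - (1/2) *\<^sub>R u) * inv_fourier \<phi> (k + (1/2) *\<^sub>R u)"
proof -
  let ?h = "\<lambda>x::real ^ 'n. (1/2) *\<^sub>R x"
  define e where "e t = exp (2 * pi * \<i> * of_real t)" for t :: real
  have e_add: "e (s + t) = e s * e t" for s t by (simp add: e_def exp_add[symmetric] distrib_left)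
  have e1: "norm (e t) = 1" for t by (simp add: e_def)
  have e_meas: "(\<lambda>z. e (\<alpha> z)) \<in> borel_measurable borel" if "continuous_on UNIV \<alpha>" for \<alpha> :: "(real ^ 'n) \<times> (real ^ 'n) \<Rightarrow> real"
    unfolding e_def using that by (intro borel_measurable_continuous_onI continuous_intros) auto
  have inv: "(snd w + ?h (fst w)) - (snd w - ?h (fst w)) = fst w"
    "(1/2) *\<^sub>R ((snd w - ?h (fst w)) + (snd w + ?h (fst w))) = snd w" for w :: "(real ^ 'n) \<times> (real ^ 'n)"
    by (auto simp: vec_eq_iff)
  have t: "schwartz (\<lambda>(a, b). g a * \<phi> b)" by (rule schwartz_tensor[OF g \<phi>])
  have s1: "schwartz (\<lambda>w. (\<lambda>(a, b). g a * \<phi> b) (snd w - ?h (fst w), snd w + ?h (fst w)))"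
    by (rule schwartz_linear_iso[OF t linear_weyl_change linear_weyl_change_inv]) (simp only: fst_conv snd_conv inv prod.collapse)
  have s2: "schwartz (\<lambda>w. (\<lambda>(a, b). g a * \<phi> b) (snd w, snd w + fst w))"
    by (rule schwartz_linear_iso[OF t, where h = "\<lambda>w. (snd w - fst w, fst w)"]) (auto intro!: linearI simp: scaleR_add_right scaleR_diff_right)
  have int1: "integrable (lborel \<Otimes>\<^sub>M lborel) (\<lambda>(q, p). e (p \<bullet> u + k \<bullet> q) * (g (p - ?h q) * \<phi> (p + ?h q)))"
    using integrable_char_mult[OF s1 e_meas e1, of "\<lambda>w. snd w \<bullet> u + k \<bullet> fst w"]
    by (simp add: lborel_prod case_prod_beta' continuous_intros)
  have int2: "integrable (lborel \<Otimes>\<^sub>M lborel) (\<lambda>(q, a). e ((a + ?h q) \<bullet> u + k \<bullet> q) * (g a * \<phi> (a + q)))"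
    using integrable_char_mult[OF s2 e_meas e1, of "\<lambda>w. (snd w + ?h (fst w)) \<bullet> u + k \<bullet> fst w"]
    by (simp add: lborel_prod case_prod_beta' continuous_intros)
  have gm [measurable]: "g \<in> borel_measurable borel" and \<phi>m [measurable]: "\<phi> \<in> borel_measurable borel"
    using g \<phi> by (auto intro: schwartz_measurable)
  have em [measurable]: "e \<in> borel_measurable borel"
    unfolding e_def by measurable
  have "partial_inv_fourier (weyl_kernel g \<phi>) (u, k) =
      (LINT p|lborel. e (p \<bullet> u) * (LINT q|lborel. e (k \<bullet> q) * g (p - ?h q) * \<phi> (p + ?h q)))"
    by (simp add: partial_inv_fourier_def inv_fourier_def weyl_kernel_def e_def inner_commute)
  also have "\<dots> = (LINT p|lborel. LINT q|lborel. e (p \<bullet> u + k \<bullet> q) * (g (p - ?h q) * \<phi> (p + ?h q)))"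
    by (simp add: e_add mult.assoc)
  also have "\<dots> = (LINT q|lborel. LINT p|lborel. e (p \<bullet> u + k \<bullet> q) * (g (p - ?h q) * \<phi> (p + ?h q)))"
    by (rule lborel_pair.Fubini_integral[OF int1])
  also have "\<dots> = (LINT q|lborel. LINT a|lborel. e ((a + ?h q) \<bullet> u + k \<bullet> q) * (g a * \<phi> (a + q)))"
  proof (rule Bochner_Integration.integral_cong[OF refl])
    fix q :: "real ^ 'n"
    have "(LINT p|lborel. e (p \<bullet> u + k \<bullet> q) * (g (p - ?h q) * \<phi> (p + ?h q))) =
      (LINT a|lborel. e ((a + ?h q) \<bullet> u + k \<bullet> q) * (g (a + ?h q - ?h q) * \<phi> (a + ?h q + ?h q)))"
      by (rule lborel_integral_translation[symmetric]) measurable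
    moreover have "a + ?h q + ?h q = a + q" for a by (simp add: vec_eq_iff)
    ultimately show "(LINT p|lborel. e (p \<bullet> u + k \<bullet> q) * (g (p - ?h q) * \<phi> (p + ?h q))) =
      (LINT a|lborel. e ((a + ?h q) \<bullet> u + k \<bullet> q) * (g a * \<phi> (a + q)))" by simp
  qed
  also have "\<dots> = (LINT a|lborel. LINT q|lborel. e ((a + ?h q) \<bullet> u + k \<bullet> q) * (g a * \<phi> (a + q)))"
    by (rule lborel_pair.Fubini_integral[OF int2, symmetric])
  also have "\<dots> = (LINT a|lborel. e (- ((k - ?h u) \<bullet> a)) * g a * inv_fourier \<phi> (k + ?h u))"
  proof (rule Bochner_Integration.integral_cong[OF refl])
    fix a :: "real ^ 'n"
    have split: "e ((a + ?h q) \<bullet> u + k \<bullet> q) * (g a * \<phi> (a + q)) =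
      (e (- ((k - ?h u) \<bullet> a)) * g a) * (e ((k + ?h u) \<bullet> (q + a)) * \<phi> (q + a))" for q
    proof -
      have "(a + ?h q) \<bullet> u + k \<bullet> q = - ((k - ?h u) \<bullet> a) + (k + ?h u) \<bullet> (q + a)"
        by (simp add: inner_add_left inner_add_right inner_diff_left inner_diff_right inner_commute field_simps)
      then show ?thesis by (simp only: e_add add.commute[of a q]) (simp only: mult_ac)
    qed
    have "(LINT q|lborel. e ((a + ?h q) \<bullet> u + k \<bullet> q) * (g a * \<phi> (a + q))) =
      (e (- ((k - ?h u) \<bullet> a)) * g a) * (LINT q|lborel. e ((k + ?h u) \<bullet> (q + a)) * \<phi> (q + a))"
      by (simp only: split integral_mult_right_zero)
    also have "(LINT q|lborel. e ((k + ?h u) \<bullet> (q + a)) * \<phi> (q + a)) = (LINT q|lborel. e ((k + ?h u) \<bullet> q) * \<phi> q)"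
      by (rule lborel_integral_translation[where f = "\<lambda>q. e ((k + ?h u) \<bullet> q) * \<phi> q"]) measurable
    also have "\<dots> = inv_fourier \<phi> (k + ?h u)"
      by (simp only: inv_fourier_def e_def inner_commute[of "k + ?h u"])
    finally show "(LINT q|lborel. e ((a + ?h q) \<bullet> u + k \<bullet> q) * (g a * \<phi> (a + q))) =
      e (- ((k - ?h u) \<bullet> a)) * g a * inv_fourier \<phi> (k + ?h u)" .
  qed
  also have "\<dots> = fourier g (k - ?h u) * inv_fourier \<phi> (k + ?h u)"
    by (simp add: fourier_def e_def)
  finally show ?thesis .
qed

section \<open>Uniqueness of the entire extension\<close>

lemma integral_cutoff_nonzero: "(LINT x|lborel. cutoff (x::'a::euclidean_space)) \<noteq> 0"
proof
  assume 0: "(LINT x|lborel. cutoff (x::'a)) = 0"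
  have int: "integrable lborel (cutoff :: 'a \<Rightarrow> complex)" by (rule schwartz_integrable[OF schwartz_cutoff])
  have "indicator (ball 0 1) x \<le> Re (cutoff x)" for x :: 'a
  proof (cases "x \<in> ball 0 1")
    case True then show ?thesis by (simp add: cutoff_eq_1)
  next
    case False
    obtain t where "0 \<le> t" "cutoff x = complex_of_real t" by (rule cutoff_real)
    then show ?thesis using False by simp
  qed
  then have "(LINT x|lborel. indicator (ball (0::'a) 1) x) \<le> (LINT x|lborel. Re (cutoff (x::'a)))"
    using int emeasure_lborel_ball_finite[of "0::'a" 1]
    by (intro integral_mono integrable_real_indicator integrable_Re) (auto simp: less_top)
  moreover have "(LINT x|lborel. Re (cutoff (x::'a))) = Re (LINT x|lborel. cutoff (x::'a))"
    using int by simp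
  moreover have "0 < measure lborel (ball (0::'a) 1)" by (rule content_ball_pos) simp
  ultimately show False using 0 by simp
qed

text \<open>
  Testing with cutoffs that concentrate at x recovers the value at x.
\<close>
lemma continuous_zero_if_weakly_zero:
  fixes F :: "'a::euclidean_space \<Rightarrow> complex"
  assumes F: "continuous_on UNIV F" and zero: "\<And>\<phi>. schwartz \<phi> \<Longrightarrow> (LINT x|lborel. F x * \<phi> x) = 0"
  shows "F x = 0"
proof -
  \<comment> \<open>The factor \<open>cutoff y\<close> makes f bounded and equals 1 near 0.\<close>
  define f where "f y = F (y + x) * cutoff y" for y
  have cont: "continuous_on UNIV f"
    unfolding f_def using smooth_continuous[OF smooth_cutoff]
    by (intro continuous_intros continuous_on_compose2[OF F]) auto
  then have "bounded (f ` cball 0 2)"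
    by (intro compact_imp_bounded compact_continuous_image compact_cball) (auto intro: continuous_on_subset)
  then obtain B where "\<forall>z\<in>f ` cball 0 2. norm z \<le> B" unfolding bounded_iff by blast
  then have B: "\<And>y. y \<in> cball 0 2 \<Longrightarrow> norm (f y) \<le> B" by blast
  have "norm (f y) \<le> \<bar>B\<bar>" for y
  proof (cases "y \<in> cball 0 2")
    case True then show ?thesis using B by force
  next
    case False then show ?thesis by (simp add: f_def cutoff_eq_0)
  qed
  from integral_dilation_tendsto[OF cont this schwartz_cutoff LIMSEQ_inverse_real_of_nat]
  have "(\<lambda>n. LINT y|lborel. f (inverse (real (Suc n)) *\<^sub>R y) * cutoff y) \<longlonglongrightarrow> f 0 * (LINT y|lborel. cutoff (y::'a))" .
  moreover have "(LINT y|lborel. f (c *\<^sub>R y) * cutoff y) = 0" if c: "0 < c" for c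
  proof -
    have m: "(\<lambda>y. f y * cutoff (inverse c *\<^sub>R y)) \<in> borel_measurable borel"
      using borel_measurable_continuous_onI[OF cont] smooth_measurable[OF smooth_cutoff] by measurable
    have s: "schwartz (\<lambda>y. cutoff y * cutoff (inverse c *\<^sub>R y))"
      using c by (intro schwartz_mult schwartz_scale schwartz_cutoff test_function_multiplier test_function_cutoff) auto
    have s': "schwartz (\<lambda>y. cutoff (y + (- x)) * cutoff (inverse c *\<^sub>R (y + (- x))))"
      by (rule schwartz_translate[OF s])
    have m': "(\<lambda>y. F y * (cutoff (y + (- x)) * cutoff (inverse c *\<^sub>R (y + (- x))))) \<in> borel_measurable borel"
      by (rule borel_measurable_times[OF borel_measurable_continuous_onI[OF F] schwartz_measurable[OF s']])
    have "0 = (LINT y|lborel. F y * (cutoff (y + (- x)) * cutoff (inverse c *\<^sub>R (y + (- x)))))"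
      using zero[OF s'] by simp
    also have "\<dots> = (LINT y|lborel. F (y + x) * (cutoff (y + x + (- x)) * cutoff (inverse c *\<^sub>R (y + x + (- x)))))"
      by (rule lborel_integral_translation[OF m', symmetric])
    also have "\<dots> = (LINT y|lborel. f y * cutoff (inverse c *\<^sub>R y))"
      by (simp add: f_def mult.assoc)
    also have "\<dots> = of_real (\<bar>c\<bar> ^ DIM('a)) * (LINT y|lborel. f (c *\<^sub>R y) * cutoff (inverse c *\<^sub>R (c *\<^sub>R y)))"
      using c by (intro lborel_integral_scale[OF m]) auto
    finally show ?thesis using c by simp
  qed
  ultimately have "(\<lambda>n. 0) \<longlonglongrightarrow> f 0 * (LINT y|lborel. cutoff (y::'a))" by simp
  then have "f 0 * (LINT y|lborel. cutoff (y::'a)) = 0" by (simp add: LIMSEQ_const_iff)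
  then show ?thesis using integral_cutoff_nonzero[where 'a = 'a] by (simp add: f_def cutoff_eq_1)
qed

text \<open>
  The coordinates become complex one at a time; S is the set of those that already are. For a new
  coordinate j the identity theorem in one variable applies, because F vanishes at its real values.
\<close>
lemma entire_zero_if_zero_on_reals:
  fixes F :: "complex ^ 'n \<Rightarrow> complex"
  assumes F: "entire F" and zero: "\<And>x. F (cvec x) = 0"
  shows "F z = 0"
proof -
  have "\<forall>z. (\<forall>i. i \<notin> S \<longrightarrow> z $ i \<in> \<real>) \<longrightarrow> F z = 0" if "finite S" for S :: "'n set"
    using that
  proof (induction S rule: finite_induct)
    case empty
    show ?case
    proof (intro allI impI)
      fix z :: "complex ^ 'n" assume "\<forall>i. i \<notin> {} \<longrightarrow> z $ i \<in> \<real>"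
      then have "z = cvec (\<chi> i. Re (z $ i))" by (simp add: cvec_def vec_eq_iff)
      then show "F z = 0" using zero by metis
    qed
  next
    case (insert j S)
    show ?case
    proof (intro allI impI)
      fix z :: "complex ^ 'n" assume z: "\<forall>i. i \<notin> insert j S \<longrightarrow> z $ i \<in> \<real>"
      define p where "p t = (\<chi> i. if i = j then t else z $ i)" for t :: complex
      have p_eq: "p t = p 0 + t *s axis j 1" for t
        by (simp add: p_def vec_eq_iff axis_def)
      have lin: "linear (\<lambda>t. t *s (axis j 1 :: complex ^ 'n))"
        by (rule linearI) (auto simp: vec_eq_iff algebra_simps)
      have "(F \<circ> p) field_differentiable (at t)" for t
      proof -
        obtain D where D: "(F has_derivative D) (at (p t))" "\<And>c v. D (c *s v) = c * D v"
          using F unfolding entire_def by metis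
        have "(p has_derivative (\<lambda>h. h *s axis j 1)) (at t)"
          by (subst p_eq[abs_def]) (intro has_derivative_add_const[of _ _ _ "p 0", unfolded add.commute[of _ "p 0"]] linear_imp_has_derivative lin)
        from has_derivative_compose[OF this D(1)] have "((F \<circ> p) has_derivative (\<lambda>h. h * D (axis j 1))) (at t)"
          by (simp add: D(2) o_def)
        then have "((F \<circ> p) has_field_derivative D (axis j 1)) (at t)"
          unfolding has_field_derivative_def by (rule has_derivative_eq_rhs) (simp add: fun_eq_iff mult.commute)
        then show ?thesis by (auto simp: field_differentiable_def)
      qed
      then have hol: "(F \<circ> p) holomorphic_on UNIV"
        by (simp add: holomorphic_on_def)
      have isl: "(0::complex) islimpt \<real>"
        unfolding islimpt_approachable
      proof (intro allI impI)
        fix e :: real assume "0 < e"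
        then show "\<exists>x'\<in>\<real>. x' \<noteq> 0 \<and> dist x' (0::complex) < e"
          by (intro bexI[of _ "complex_of_real (e / 2)"]) auto
      qed
      have "(F \<circ> p) t = 0" if "t \<in> \<real>" for t
        using insert.IH z that by (auto simp: p_def)
      from analytic_continuation[OF hol open_UNIV connected_UNIV subset_UNIV UNIV_I isl this UNIV_I, of "z $ j"]
      have "F (p (z $ j)) = 0" by simp
      moreover have "p (z $ j) = z" by (simp add: p_def vec_eq_iff)
      ultimately show "F z = 0" by simp
    qed
  qed
  from this[of UNIV] show ?thesis by simp
qed

lemma entire_continuous: "entire F \<Longrightarrow> continuous_on S F"
  unfolding entire_def by (meson continuous_at_imp_continuous_on has_derivative_continuous)

lemma continuous_cvec: "continuous_on S cvec"
  unfolding cvec_def by (intro continuous_intros)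

lemma entire_extension_unique:
  assumes E: "entire_extension L E" and E': "entire_extension L E'" and \<psi>: "schwartz \<psi>"
  shows "E z \<psi> = E' z \<psi>"
proof -
  define F where "F z = E z \<psi> - E' z \<psi>" for z
  have ent: "entire (\<lambda>z. E z \<psi>)" "entire (\<lambda>z. E' z \<psi>)"
    using E E' \<psi> by (auto simp: entire_extension_def)
  have F: "entire F"
    unfolding entire_def
  proof
    fix z
    obtain D D' where "((\<lambda>z. E z \<psi>) has_derivative D) (at z)" "\<And>c v. D (c *s v) = c * D v"
      "((\<lambda>z. E' z \<psi>) has_derivative D') (at z)" "\<And>c v. D' (c *s v) = c * D' v"
      using ent unfolding entire_def by metis
    then show "\<exists>D. (F has_derivative D) (at z) \<and> (\<forall>c v. D (c *s v) = c * D v)"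
      unfolding F_def[abs_def]
      by (intro exI[of _ "\<lambda>h. D h - D' h"]) (auto intro: has_derivative_diff simp: right_diff_distrib)
  qed
  have "F (cvec x) = 0" for x
  proof (rule continuous_zero_if_weakly_zero[where F = "\<lambda>x. F (cvec x)"])
    show "continuous_on UNIV (\<lambda>x. F (cvec x))"
      by (rule continuous_on_compose2[OF entire_continuous[OF F] continuous_cvec subset_UNIV])
    fix \<phi> :: "real ^ 'a \<Rightarrow> complex" assume \<phi>: "schwartz \<phi>"
    have 1: "integrable lborel (\<lambda>x. E (cvec x) \<psi> * \<phi> x)" "L (\<lambda>(x, k). \<phi> x * \<psi> k) = (LINT x|lborel. E (cvec x) \<psi> * \<phi> x)"
      using E \<phi> \<psi> unfolding entire_extension_def by blast+
    have 2: "integrable lborel (\<lambda>x. E' (cvec x) \<psi> * \<phi> x)" "L (\<lambda>(x, k). \<phi> x * \<psi> k) = (LINT x|lborel. E' (cvec x) \<psi> * \<phi> x)"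
      using E' \<phi> \<psi> unfolding entire_extension_def by blast+
    show "(LINT x|lborel. F (cvec x) * \<phi> x) = 0"
      unfolding F_def left_diff_distrib
      by (subst Bochner_Integration.integral_diff[OF 1(1) 2(1)]) (simp flip: 1(2) 2(2))
  qed
  then have "F z = 0" by (rule entire_zero_if_zero_on_reals[OF F])
  then show ?thesis by (simp add: F_def)
qed

section \<open>The entire extension\<close>

text \<open>
  Bilinear, without complex conjugation, hence holomorphic in z.
\<close>
definition cdot :: "complex ^ 'n \<Rightarrow> real ^ 'n \<Rightarrow> complex" where
  "cdot z u = (\<Sum>i\<in>UNIV. z $ i * of_real (u $ i))"

lemma cdot_cvec: "cdot (cvec x) u = of_real (x \<bullet> u)"
  by (simp add: cdot_def cvec_def inner_vec_def)

lemma cdot_add: "cdot (z + w) u = cdot z u + cdot w u"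
  by (simp add: cdot_def distrib_right sum.distrib)

lemma cdot_smult: "cdot (c *s z) u = c * cdot z u"
  by (simp add: cdot_def sum_distrib_left mult.assoc)

lemma linear_cdot_left: "linear (\<lambda>z. cdot z u)"
  by (rule linearI) (auto simp: cdot_def distrib_right sum.distrib scaleR_sum_right)

lemma linear_cdot_right: "linear (cdot z)"
  by (rule linearI) (auto simp: cdot_def distrib_left sum.distrib sum_distrib_left scaleR_conv_of_real[where 'a = complex] mult.left_commute)

abbreviation shifted_point :: "real \<Rightarrow> real ^ 'n \<Rightarrow> real ^ 'n \<Rightarrow> complex ^ 'n" where
  "shifted_point \<sigma> x k \<equiv> cvec x + (\<i> * of_real (\<sigma>\<^sup>2) / 2) *s cvec k"

definition wave :: "complex ^ 'n \<Rightarrow> real ^ 'n \<Rightarrow> complex" where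
  "wave z u = exp (2 * pi * \<i> * cdot z u)"

lemma wave_cvec: "wave (cvec x) u = fourier_char u (- x)"
  by (simp add: wave_def cdot_cvec fourier_char_neg)

text \<open>
  The imaginary part of the shifted point turns into a real exponential weight.
\<close>
lemma wave_complex_shift:
  "wave (shifted_point \<sigma> x k) u = fourier_char u (- x) * exp (of_real (- pi * \<sigma>\<^sup>2 * (k \<bullet> u)))"
proof -
  have "2 * pi * \<i> * cdot (shifted_point \<sigma> x k) u =
      2 * pi * \<i> * of_real (x \<bullet> u) + (\<i> * \<i>) * of_real (pi * \<sigma>\<^sup>2 * (k \<bullet> u))"
    by (simp add: cdot_add cdot_smult cdot_cvec algebra_simps)
  then show ?thesis by (simp add: wave_def fourier_char_neg exp_add[symmetric])
qed

lemma smooth_wave: "smooth (wave z)"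
  unfolding wave_def[abs_def] by (intro smooth_exp smooth_cmult smooth_linear linear_cdot_right)

lemma smooth_wave_pair: "smooth (\<lambda>p. wave (fst p) (snd p))"
proof -
  have "linear (\<lambda>p::(complex ^ 'n) \<times> (real ^ 'n). fst p $ i)" "linear (\<lambda>p::(complex ^ 'n) \<times> (real ^ 'n). complex_of_real (snd p $ i))" for i
    by (auto intro!: linearI simp: scaleR_conv_of_real[where 'a = complex])
  then show ?thesis unfolding wave_def cdot_def
    by (intro smooth_exp smooth_cmult smooth_sum smooth_mult smooth_linear finite)
qed

lemma wave_has_derivative: "((\<lambda>z. wave z u) has_derivative (\<lambda>h. 2 * pi * \<i> * cdot h u * wave z u)) (at z)"
proof -
  have "((\<lambda>z. 2 * pi * \<i> * cdot z u) has_derivative (\<lambda>h. 2 * pi * \<i> * cdot h u)) (at z)"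
    by (intro has_derivative_mult_right linear_imp_has_derivative linear_cdot_left)
  from has_derivative_compose[OF this DERIV_exp[unfolded has_field_derivative_def]]
  show ?thesis by (simp add: wave_def mult.commute)
qed

text \<open>
  The support is bounded by a ball in place of the cube, to fit the radial cutoffs.
\<close>
locale band_limited =
  fixes L :: "((real ^ 'n) \<times> (real ^ 'n) \<Rightarrow> complex) \<Rightarrow> complex" and r :: real
  assumes tempered_L: "tempered L" and r_pos: "0 < r"
    and supp: "dist_support (fourier1_dist L) \<subseteq> {u. norm u < r} \<times> UNIV"
begin

definition Lhat where "Lhat = fourier1_dist L"

definition chi :: "real ^ 'n \<Rightarrow> complex" where "chi u = cutoff (u /\<^sub>R r)"

lemma tempered_Lhat: "tempered Lhat" unfolding Lhat_def by (rule tempered_fourier1_dist[OF tempered_L])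

lemma Lhat_inverse: "schwartz \<phi> \<Longrightarrow> Lhat (partial_inv_fourier \<phi>) = L \<phi>"
  unfolding Lhat_def by (rule fourier1_dist_partial_inv_fourier)

lemma Lhat_chi: "schwartz \<phi> \<Longrightarrow> Lhat (\<lambda>z. chi (fst z) * \<phi> z) = Lhat \<phi>"
  unfolding chi_def using tempered_cutoff_fst[OF tempered_Lhat r_pos] supp by (simp add: Lhat_def)

lemma test_chi: "test_function chi"
  using cutoff_bump(1)[OF r_pos, of 0] by (simp add: chi_def[abs_def])

lemma schwartz_chi: "schwartz chi"
  by (rule test_function_schwartz[OF test_chi])

lemma schwartz_chi_wave: "schwartz (\<lambda>u. chi u * wave z u)"
  using test_function_schwartz[OF test_function_mult[OF smooth_wave test_chi]] by (simp add: mult.commute)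

text \<open>
  Fourier inversion in x at a complex point z. The cutoff \<open>chi\<close> makes the exponentially growing
  \<open>wave z\<close> admissible.
\<close>
definition extension :: "complex ^ 'n \<Rightarrow> (real ^ 'n \<Rightarrow> complex) \<Rightarrow> complex" where
  "extension z \<psi> = Lhat (\<lambda>(u, k). (chi u * wave z u) * \<psi> k)"

lemma tempered_extension: "tempered (extension z)"
  unfolding extension_def[abs_def]
  by (rule tempered_compose[OF tempered_Lhat schwartz_cont_tensor_left[OF schwartz_chi_wave]]) (auto simp: fun_eq_iff algebra_simps)

text \<open>
  A further cutoff in z, equal to 1 near \<open>z0\<close>, makes the function under \<open>Lhat\<close> a Schwartz function of z, u
  and k together. So the derivative may be computed under \<open>Lhat\<close>, where it is multiplication by
  \<open>2 \<pi> i cdot h u\<close>; this is complex linear in h.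
\<close>
lemma extension_entire:
  assumes \<psi>: "schwartz \<psi>" shows "entire (\<lambda>z. extension z \<psi>)"
  unfolding entire_def
proof
  fix z0 :: "complex ^ 'n"
  define a where "a p = cutoff (fst p - z0) * (chi (snd p) * wave (fst p) (snd p))" for p
  define H where "H w = a (fst w, fst (snd w)) * \<psi> (snd (snd w))" for w
  define G where "G h = (\<lambda>(u, k). (2 * pi * \<i> * cdot h u) * ((chi u * wave z0 u) * \<psi> k))" for h
  have "test_function a"
  proof (rule test_functionI)
    have d1: "((\<lambda>p::(complex ^ 'n) \<times> (real ^ 'n). fst p - z0) has_derivative fst) (at p)" for p
      by (auto intro!: derivative_eq_intros)
    have d2: "(snd has_derivative snd) (at p)" for p :: "(complex ^ 'n) \<times> (real ^ 'n)"
      by (auto intro!: derivative_eq_intros)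
    show "smooth a" unfolding a_def[abs_def] using test_chi
      by (intro smooth_mult smooth_wave_pair smooth_pullback[OF smooth_cutoff d1] smooth_pullback[OF _ d2])
        (simp add: test_function_def)
    show "compact (cball z0 2 \<times> fun_support chi)"
      using test_chi by (intro compact_Times compact_cball) (simp add: test_function_def)
    show "a p = 0" if "p \<notin> cball z0 2 \<times> fun_support chi" for p
    proof (cases "fst p \<in> cball z0 2")
      case True
      then have "snd p \<notin> fun_support chi" using that by (cases p) auto
      then show ?thesis by (simp add: a_def zero_outside_fun_support)
    next
      case False
      then have "cutoff (fst p - z0) = 0" by (intro cutoff_eq_0) (simp add: dist_norm norm_minus_commute)
      then show ?thesis by (simp add: a_def)
    qed
  qed
  then have "schwartz (\<lambda>(p, k). a p * \<psi> k)" by (intro schwartz_tensor test_function_schwartz \<psi>)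
  then have "schwartz (\<lambda>w. (\<lambda>(p, k). a p * \<psi> k) ((fst w, fst (snd w)), snd (snd w)))"
    by (rule schwartz_linear_iso[where h = "\<lambda>w. (fst (fst w), (snd (fst w), snd w))"]) (auto intro!: linearI)
  then have H: "schwartz H" by (simp add: H_def[abs_def])
  have G: "schwartz (G h)" for h
  proof -
    have "linear (\<lambda>w::(real ^ 'n) \<times> (real ^ 'n). cdot h (fst w))"
      using linear_compose[OF linear_fst linear_cdot_right] by (simp add: o_def)
    then have "schwartz (\<lambda>w. (2 * pi * \<i> * cdot h (fst w)) * (\<lambda>(u, k). (chi u * wave z0 u) * \<psi> k) w)"
      by (intro schwartz_mult multiplier_mult multiplier_const multiplier_linear schwartz_tensor schwartz_chi_wave \<psi>)
    then show ?thesis by (simp add: G_def case_prod_beta')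
  qed
  have near: "z0 \<in> ball z0 1" "open (ball z0 1)" by auto
  have H_near: "H (z, y) = (chi (fst y) * wave z (fst y)) * \<psi> (snd y)" if "z \<in> ball z0 1" for z y
    using that by (simp add: H_def a_def cutoff_eq_1 dist_norm norm_minus_commute)
  have pH: "(\<lambda>y. pdiff (b, 0) H (z0, y)) = G b" for b
  proof
    fix y
    have "((\<lambda>z. (chi (fst y) * wave z (fst y)) * \<psi> (snd y)) has_derivative
        (\<lambda>h. (chi (fst y) * (2 * pi * \<i> * cdot h (fst y) * wave z0 (fst y))) * \<psi> (snd y))) (at z0)"
      by (intro has_derivative_mult_left has_derivative_mult_right wave_has_derivative)
    then have "((\<lambda>z. H (z, y)) has_derivative
        (\<lambda>h. (chi (fst y) * (2 * pi * \<i> * cdot h (fst y) * wave z0 (fst y))) * \<psi> (snd y))) (at z0)"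
      by (rule has_derivative_transform_within_open[OF _ near(2,1)]) (simp add: H_near)
    from pdiff_eqI[OF this, of b]
    have "pdiff (b, 0) H (z0, y) = (chi (fst y) * (2 * pi * \<i> * cdot b (fst y) * wave z0 (fst y))) * \<psi> (snd y)"
      using pdiff_slice1[OF schwartz_smooth[OF H], of b y] by simp
    then show "pdiff (b, 0) H (z0, y) = G b y" by (simp add: G_def case_prod_beta' mult_ac)
  qed
  have "((\<lambda>z. Lhat (\<lambda>y. H (z, y))) has_derivative (\<lambda>h. \<Sum>b\<in>Basis. (h \<bullet> b) *\<^sub>R Lhat (G b))) (at z0)"
    using tempered_slice_has_derivative[OF tempered_Lhat H, of z0] by (simp only: pH)
  then have "((\<lambda>z. extension z \<psi>) has_derivative (\<lambda>h. \<Sum>b\<in>Basis. (h \<bullet> b) *\<^sub>R Lhat (G b))) (at z0)"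
    by (rule has_derivative_transform_within_open[OF _ near(2,1)]) (simp add: H_near extension_def case_prod_beta')
  moreover have "(\<Sum>b\<in>Basis. (h \<bullet> b) *\<^sub>R Lhat (G b)) = Lhat (G h)" for h
  proof -
    have "cdot h u = (\<Sum>b\<in>Basis. of_real (h \<bullet> b) * cdot b u)" for u
      by (subst (1) euclidean_representation[of h, symmetric])
        (simp add: linear_sum[OF linear_cdot_left] linear_scale[OF linear_cdot_left] scaleR_conv_of_real[where 'a = complex])
    then have "G h = (\<lambda>y. \<Sum>b\<in>Basis. of_real (h \<bullet> b) * G b y)"
      by (simp add: G_def fun_eq_iff sum_distrib_left sum_distrib_right mult_ac)
    then show ?thesis
      by (simp add: tempered_sum[OF tempered_Lhat] schwartz_cmult G tempered_cmult[OF tempered_Lhat G] scaleR_conv_of_real[where 'a = complex])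
  qed
  ultimately have "((\<lambda>z. extension z \<psi>) has_derivative (\<lambda>h. Lhat (G h))) (at z0)" by simp
  moreover have "Lhat (G (c *s v)) = c * Lhat (G v)" for c v
  proof -
    have "G (c *s v) = (\<lambda>y. c * G v y)" by (simp add: G_def fun_eq_iff cdot_smult mult_ac)
    then show ?thesis by (simp add: tempered_cmult[OF tempered_Lhat G])
  qed
  ultimately show "\<exists>D. ((\<lambda>z. extension z \<psi>) has_derivative D) (at z0) \<and> (\<forall>c v. D (c *s v) = c * D v)" by blast
qed

lemma extension_on_reals:
  assumes \<phi>: "schwartz \<phi>" and \<psi>: "schwartz \<psi>"
  shows "integrable lborel (\<lambda>x. extension (cvec x) \<psi> * \<phi> x) \<and>
    L (\<lambda>(x, k). \<phi> x * \<psi> k) = (LINT x|lborel. extension (cvec x) \<psi> * \<phi> x)"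
proof -
  define H where "H w = fourier_char (fst (snd w)) (- fst w) * (\<phi> (fst w) * (chi (fst (snd w)) * \<psi> (snd (snd w))))" for w
  have "schwartz (\<lambda>(x, y). \<phi> x * (\<lambda>(u, k). chi u * \<psi> k) y)"
    by (intro schwartz_tensor schwartz_chi \<phi> \<psi>)
  moreover have "multiplier (\<lambda>w::(real ^ 'n) \<times> (real ^ 'n) \<times> (real ^ 'n). (\<lambda>z. fourier_char (snd z) (- fst z)) (fst w, fst (snd w)))"
    by (rule multiplier_linear_compose[OF multiplier_fourier_char_pair]) (auto intro!: linearI)
  ultimately have "schwartz (\<lambda>w. (\<lambda>z. fourier_char (snd z) (- fst z)) (fst w, fst (snd w)) * (\<lambda>(x, y). \<phi> x * (\<lambda>(u, k). chi u * \<psi> k) y) w)"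
    by (intro schwartz_mult)
  then have H: "schwartz H" by (simp add: H_def[abs_def] case_prod_beta')
  have EH: "extension (cvec x) \<psi> * \<phi> x = Lhat (\<lambda>y. H (x, y))" for x
  proof -
    have "schwartz (\<lambda>(u, k). (chi u * wave (cvec x) u) * \<psi> k)" by (intro schwartz_tensor schwartz_chi_wave \<psi>)
    from tempered_cmult[OF tempered_Lhat this, of "\<phi> x"] show ?thesis
      by (simp add: extension_def H_def wave_cvec case_prod_beta' mult_ac)
  qed
  have "L (\<lambda>(x, k). \<phi> x * \<psi> k) = Lhat (\<lambda>y. chi (fst y) * partial_inv_fourier (\<lambda>(x, k). \<phi> x * \<psi> k) y)"
    using Lhat_chi[OF schwartz_partial_inv_fourier] Lhat_inverse schwartz_tensor[OF \<phi> \<psi>] by simp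
  also have "(\<lambda>y. chi (fst y) * partial_inv_fourier (\<lambda>(x, k). \<phi> x * \<psi> k) y) = (\<lambda>y. LINT x|lborel. H (x, y))"
  proof
    fix y
    have "H (x, y) = (chi (fst y) * \<psi> (snd y)) * (exp (2 * pi * \<i> * of_real (x \<bullet> fst y)) * \<phi> x)" for x
      by (simp add: H_def fourier_char_neg mult_ac)
    then have "(LINT x|lborel. H (x, y)) = (chi (fst y) * \<psi> (snd y)) * inv_fourier \<phi> (fst y)"
      by (simp add: inv_fourier_def)
    moreover have "partial_inv_fourier (\<lambda>(x, k). \<phi> x * \<psi> k) y = inv_fourier \<phi> (fst y) * \<psi> (snd y)"
      by (simp add: partial_inv_fourier_def case_prod_beta' inv_fourier_def mult.assoc[symmetric])
    ultimately show "chi (fst y) * partial_inv_fourier (\<lambda>(x, k). \<phi> x * \<psi> k) y = (LINT x|lborel. H (x, y))"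
      by simp
  qed
  also have "Lhat (\<lambda>y. LINT x|lborel. H (x, y)) = (LINT x|lborel. Lhat (\<lambda>y. H (x, y)))"
    by (rule tempered_integral[OF tempered_Lhat H])
  finally show ?thesis
    unfolding EH using schwartz_integrable[OF schwartz_tempered_slice[OF tempered_Lhat H]] by simp
qed

theorem extension_is_entire_extension: "entire_extension L extension"
  unfolding entire_extension_def using tempered_extension extension_entire extension_on_reals by blast

end

section \<open>The symbol at the complex point\<close>

lemma tendsto_dilation_at_right:
  fixes f :: "'a::euclidean_space \<Rightarrow> complex"
  assumes f: "schwartz f" and g: "schwartz g"
  shows "((\<lambda>\<epsilon>. LINT x|lborel. f (\<epsilon> *\<^sub>R x) * g x) \<longlongrightarrow> f 0 * (LINT x|lborel. g x)) (at_right 0)"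
  unfolding tendsto_at_iff_sequentially
  using integral_schwartz_dilation_tendsto[OF f g] by (auto simp: o_def)

text \<open>
  The weight \<open>exp (- \<pi> \<sigma>\<^sup>2 k \<bullet> u)\<close> at (u, k), cut off in both variables.
\<close>
definition damped :: "real \<Rightarrow> real \<Rightarrow> real \<Rightarrow> (real ^ 'n) \<times> (real ^ 'n) \<Rightarrow> complex" where
  "damped \<sigma> s R z = cutoff (fst z /\<^sub>R s) * (cutoff (snd z /\<^sub>R R) * exp (of_real (- pi * \<sigma>\<^sup>2 * (snd z \<bullet> fst z))))"

lemma test_damped:
  assumes "0 < s" "0 < R" shows "test_function (damped \<sigma> s R)"
proof (rule test_functionI)
  have d1: "((\<lambda>z::(real ^ 'n) \<times> (real ^ 'n). fst z /\<^sub>R s) has_derivative (\<lambda>h. fst h /\<^sub>R s)) (at z)"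
    and d2: "((\<lambda>z::(real ^ 'n) \<times> (real ^ 'n). snd z /\<^sub>R R) has_derivative (\<lambda>h. snd h /\<^sub>R R)) (at z)" for z
    by (auto intro!: derivative_eq_intros)
  have "smooth (\<lambda>z::(real ^ 'n) \<times> (real ^ 'n). exp (complex_of_real (- pi * \<sigma>\<^sup>2) * complex_of_real (fst z \<bullet> snd z)))"
    by (intro smooth_exp smooth_cmult multiplier_smooth multiplier_inner)
  then have "smooth (\<lambda>z::(real ^ 'n) \<times> (real ^ 'n). exp (of_real (- pi * \<sigma>\<^sup>2 * (snd z \<bullet> fst z))))"
    by (simp add: inner_commute)
  then show "smooth (damped \<sigma> s R)" unfolding damped_def[abs_def]
    by (intro smooth_mult smooth_pullback[OF smooth_cutoff d1] smooth_pullback[OF smooth_cutoff d2])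
  show "compact (cball (0::real ^ 'n) (2 * s) \<times> cball (0::real ^ 'n) (2 * R))"
    by (intro compact_Times compact_cball)
  have out: "cutoff (u /\<^sub>R t) = 0" if "u \<notin> cball 0 (2 * t)" "0 < t" for u :: "real ^ 'n" and t
  proof -
    have "u \<notin> fun_support (\<lambda>y. cutoff ((y - 0) /\<^sub>R t))" using cutoff_bump(2)[OF that(2), of 0] that(1) by blast
    from zero_outside_fun_support[OF this] show ?thesis by simp
  qed
  show "damped \<sigma> s R z = 0" if "z \<notin> cball (0::real ^ 'n) (2 * s) \<times> cball (0::real ^ 'n) (2 * R)" for z
    using that out[of "fst z" s] out[of "snd z" R] assms by (cases z) (auto simp: damped_def)
qed

lemma partial_inv_fourier_k_bounded:
  assumes "k_bounded_schwartz R \<phi>" "R < norm k" shows "partial_inv_fourier \<phi> (u, k) = 0"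
  using assms by (simp add: partial_inv_fourier_def inv_fourier_def k_bounded_schwartz_def)

lemma k_bounded_schwartz_mono: "k_bounded_schwartz R \<phi> \<Longrightarrow> R \<le> R' \<Longrightarrow> k_bounded_schwartz R' \<phi>"
  by (auto simp: k_bounded_schwartz_def)

lemma symbol_test_bound:
  assumes "symbol_test \<phi>" obtains R where "0 < R" "k_bounded_schwartz R \<phi>"
proof -
  obtain R where "k_bounded_schwartz R \<phi>" using assms by (auto simp: symbol_test_def)
  then have "k_bounded_schwartz (max R 1) \<phi>" by (rule k_bounded_schwartz_mono) simp
  then show ?thesis using that[of "max R 1"] by simp
qed

lemma schwartz_mollifier:
  fixes \<rho> :: "real ^ 'n \<Rightarrow> complex"
  assumes \<rho>: "schwartz \<rho>" and \<epsilon>: "0 < \<epsilon>" shows "schwartz (mollifier \<rho> \<epsilon>)"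
proof -
  have "schwartz (\<lambda>v. (1 / of_real (\<epsilon> ^ CARD('n))) * \<rho> (inverse \<epsilon> *\<^sub>R v))"
    using \<epsilon> by (intro schwartz_cmult schwartz_scale \<rho>) simp
  then show ?thesis by (simp add: mollifier_def[abs_def])
qed

lemma schwartz_mollifier_reflect:
  fixes \<rho> :: "real ^ 'n \<Rightarrow> complex"
  assumes \<rho>: "schwartz \<rho>" and \<epsilon>: "0 < \<epsilon>" shows "schwartz (\<lambda>l. mollifier \<rho> \<epsilon> (k - l))"
proof -
  have "schwartz (\<lambda>l. mollifier \<rho> \<epsilon> (- l))"
    by (rule schwartz_cont_schwartz[OF schwartz_cont_reflect schwartz_mollifier[OF assms]])
  from schwartz_translate[OF this, of "- k"] show ?thesis by simp
qed

lemma integral_mollifier: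
  fixes \<rho> :: "real ^ 'n \<Rightarrow> complex" and g :: "real ^ 'n \<Rightarrow> complex"
  assumes \<rho>: "schwartz \<rho>" and g: "schwartz g" and \<epsilon>: "0 < \<epsilon>"
  shows "(LINT k|lborel. g k * mollifier \<rho> \<epsilon> (k - l)) = (LINT v|lborel. g (l + \<epsilon> *\<^sub>R v) * \<rho> v)"
proof -
  have m1: "(\<lambda>k. g k * mollifier \<rho> \<epsilon> (k - l)) \<in> borel_measurable borel"
    using schwartz_translate[OF schwartz_mollifier[OF \<rho> \<epsilon>], of "- l"] g
    by (intro borel_measurable_times schwartz_measurable) simp_all
  have m2: "(\<lambda>k. g (k + l) * mollifier \<rho> \<epsilon> k) \<in> borel_measurable borel"
    by (intro borel_measurable_times schwartz_measurable schwartz_translate[OF g] schwartz_mollifier[OF \<rho> \<epsilon>])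
  have "(LINT k|lborel. g k * mollifier \<rho> \<epsilon> (k - l)) = (LINT k|lborel. g (k + l) * mollifier \<rho> \<epsilon> (k + l - l))"
    by (rule lborel_integral_translation[OF m1, symmetric])
  also have "\<dots> = (LINT k|lborel. g (k + l) * mollifier \<rho> \<epsilon> k)" by simp
  also have "\<dots> = of_real (\<bar>\<epsilon>\<bar> ^ DIM(real ^ 'n)) * (LINT v|lborel. g (\<epsilon> *\<^sub>R v + l) * mollifier \<rho> \<epsilon> (\<epsilon> *\<^sub>R v))"
    using \<epsilon> by (intro lborel_integral_scale[OF m2]) auto
  also have "\<dots> = (LINT v|lborel. g (l + \<epsilon> *\<^sub>R v) * \<rho> v)"
  proof -
    have "g (\<epsilon> *\<^sub>R v + l) * mollifier \<rho> \<epsilon> (\<epsilon> *\<^sub>R v) = (1 / of_real (\<epsilon> ^ CARD('n))) * (g (l + \<epsilon> *\<^sub>R v) * \<rho> v)" for v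
      using \<epsilon> by (simp add: mollifier_def add.commute[of l])
    then have "(LINT v|lborel. g (\<epsilon> *\<^sub>R v + l) * mollifier \<rho> \<epsilon> (\<epsilon> *\<^sub>R v)) =
        (1 / of_real (\<epsilon> ^ CARD('n))) * (LINT v|lborel. g (l + \<epsilon> *\<^sub>R v) * \<rho> v)"
      by (simp only: integral_mult_right_zero)
    then show ?thesis using \<epsilon> by simp
  qed
  finally show ?thesis .
qed

context band_limited
begin

text \<open>
  On the Fourier side, evaluation at the shifted point is multiplication by the exponential weight. If
  \<open>\<phi>\<close> has bounded support in k the weight may be cut off in k as well (\<open>shifted_symbol_eq\<close>), which yields the
  continuity estimate.
\<close>
definition shifted_symbol :: "real \<Rightarrow> ((real ^ 'n) \<times> (real ^ 'n) \<Rightarrow> complex) \<Rightarrow> complex" where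
  "shifted_symbol \<sigma> \<phi> = Lhat (\<lambda>z. (chi (fst z) * exp (of_real (- pi * \<sigma>\<^sup>2 * (snd z \<bullet> fst z)))) * partial_inv_fourier \<phi> z)"

lemma shifted_symbol_eq:
  assumes \<phi>: "k_bounded_schwartz R \<phi>" and R: "0 < R"
  shows "shifted_symbol \<sigma> \<phi> = Lhat (\<lambda>z. damped \<sigma> r R z * partial_inv_fourier \<phi> z)"
proof -
  have "(chi u * exp (of_real (- pi * \<sigma>\<^sup>2 * (k \<bullet> u)))) * partial_inv_fourier \<phi> (u, k) =
    damped \<sigma> r R (u, k) * partial_inv_fourier \<phi> (u, k)" for u k
  proof (cases "R < norm k")
    case True then show ?thesis using partial_inv_fourier_k_bounded[OF \<phi>] by simp
  next
    case False
    then have "cutoff (k /\<^sub>R R) = 1" using R by (intro cutoff_eq_1) (simp add: field_simps)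
    then show ?thesis by (simp add: damped_def chi_def)
  qed
  then show ?thesis unfolding shifted_symbol_def by (metis (no_types, lifting) prod.collapse)
qed

lemma symbol_distribution_shifted_symbol: "symbol_distribution (shifted_symbol \<sigma>)"
proof -
  define F where "F R = (\<lambda>\<phi>. Lhat (\<lambda>z. damped \<sigma> r R z * partial_inv_fourier \<phi> z))" for R
  have F: "tempered (F R)" if "0 < R" for R
    unfolding F_def
    by (rule tempered_compose[OF tempered_Lhat schwartz_cont_compose[OF schwartz_cont_mult[OF test_function_multiplier[OF test_damped[OF r_pos that]]]
       schwartz_cont_partial_inv_fourier]])
      (simp_all add: partial_inv_fourier_add partial_inv_fourier_cmult fun_eq_iff algebra_simps)
  have Lt: "shifted_symbol \<sigma> \<phi> = F R \<phi>" if "k_bounded_schwartz R \<phi>" "0 < R" for R \<phi>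
    unfolding F_def using that by (rule shifted_symbol_eq)
  show ?thesis unfolding symbol_distribution_def linear_on_class_def
  proof (intro conjI allI impI)
    fix \<phi> \<psi> :: "(real ^ 'n) \<times> (real ^ 'n) \<Rightarrow> complex" assume "symbol_test \<phi>" "symbol_test \<psi>"
    then obtain R1 R2 where R: "0 < R1" "k_bounded_schwartz R1 \<phi>" "0 < R2" "k_bounded_schwartz R2 \<psi>"
      by (meson symbol_test_bound)
    let ?R = "R1 + R2"
    have b: "0 < ?R" "k_bounded_schwartz ?R \<phi>" "k_bounded_schwartz ?R \<psi>"
      using R by (auto intro: k_bounded_schwartz_mono)
    then have "k_bounded_schwartz ?R (\<lambda>x. \<phi> x + \<psi> x)" by (auto simp: k_bounded_schwartz_def schwartz_add)
    with b show "shifted_symbol \<sigma> (\<lambda>x. \<phi> x + \<psi> x) = shifted_symbol \<sigma> \<phi> + shifted_symbol \<sigma> \<psi>"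
      using tempered_add[OF F] by (simp add: Lt[of ?R] k_bounded_schwartz_def)
  next
    fix c and \<phi> :: "(real ^ 'n) \<times> (real ^ 'n) \<Rightarrow> complex" assume "symbol_test \<phi>"
    then obtain R where R: "0 < R" "k_bounded_schwartz R \<phi>" by (meson symbol_test_bound)
    then have "k_bounded_schwartz R (\<lambda>x. c * \<phi> x)" by (auto simp: k_bounded_schwartz_def schwartz_cmult)
    with R show "shifted_symbol \<sigma> (\<lambda>x. c * \<phi> x) = c * shifted_symbol \<sigma> \<phi>"
      using tempered_cmult[OF F] by (simp add: Lt[of R] k_bounded_schwartz_def)
  next
    fix R
    have "tempered (F (max R 1))" by (rule F) simp
    then obtain N C where "\<And>\<phi>. schwartz \<phi> \<Longrightarrow> norm (F (max R 1) \<phi>) \<le> C * schwartz_norm N \<phi>"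
      unfolding tempered_def by blast
    moreover have "shifted_symbol \<sigma> \<phi> = F (max R 1) \<phi>" if "k_bounded_schwartz R \<phi>" for \<phi>
      by (intro Lt k_bounded_schwartz_mono[OF that]) auto
    ultimately have "norm (shifted_symbol \<sigma> \<phi>) \<le> C * schwartz_norm N \<phi>" if "k_bounded_schwartz R \<phi>" for \<phi>
      using that by (simp add: k_bounded_schwartz_def)
    then show "\<exists>N C. \<forall>\<phi>. k_bounded_schwartz R \<phi> \<longrightarrow> norm (shifted_symbol \<sigma> \<phi>) \<le> C * schwartz_norm N \<phi>" by blast
  qed
qed

text \<open>
  The regularized symbol times \<open>\<phi>\<close> is \<open>Lhat\<close> applied to slices of a single Schwartz function H.
  The factor \<open>damped\<close> in its definition below uses the radius \<open>2 * r\<close>, so that it is 1 in u on the support of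
  \<open>chi\<close>; \<open>chi\<close> itself then remains to provide the decay of H in u.
\<close>
lemma regularization_family:
  fixes \<rho> :: "real ^ 'n \<Rightarrow> complex"
  assumes \<rho>: "schwartz \<rho>" and \<phi>: "k_bounded_schwartz R \<phi>" and R: "0 < R" and \<epsilon>: "0 < \<epsilon>"
  obtains H where "schwartz H"
    "\<And>x k. extension (shifted_point \<sigma> x k) (\<lambda>l. mollifier \<rho> \<epsilon> (k - l)) * \<phi> (x, k) = Lhat (\<lambda>y. H ((x, k), y))"
    "\<And>x k u l. H ((x, k), (u, l)) = (fourier_char u (- x) * \<phi> (x, k)) * (damped \<sigma> r R (u, k) * mollifier \<rho> \<epsilon> (k - l))"
proof
  let ?m = "mollifier \<rho> \<epsilon>"
  let ?X = "\<lambda>w::((real ^ 'n) \<times> (real ^ 'n)) \<times> ((real ^ 'n) \<times> (real ^ 'n)). fst (fst w)"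
  let ?K = "\<lambda>w::((real ^ 'n) \<times> (real ^ 'n)) \<times> ((real ^ 'n) \<times> (real ^ 'n)). snd (fst w)"
  let ?U = "\<lambda>w::((real ^ 'n) \<times> (real ^ 'n)) \<times> ((real ^ 'n) \<times> (real ^ 'n)). fst (snd w)"
  let ?l = "\<lambda>w::((real ^ 'n) \<times> (real ^ 'n)) \<times> ((real ^ 'n) \<times> (real ^ 'n)). snd (snd w)"
  define H where "H w = fourier_char (?U w) (- ?X w) * (damped \<sigma> (2 * r) R (?U w, ?K w) *
    (\<phi> (?X w, ?K w) * (chi (?U w) * ?m (?K w - ?l w))))" for w
  have \<phi>s: "schwartz \<phi>" using \<phi> by (simp add: k_bounded_schwartz_def)
  have "schwartz (\<lambda>(p, q). \<phi> p * (\<lambda>(u, m). chi u * ?m m) q)"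
    by (intro schwartz_tensor \<phi>s schwartz_chi schwartz_mollifier \<rho> \<epsilon>)
  then have "schwartz (\<lambda>w. (\<lambda>(p, q). \<phi> p * (\<lambda>(u, m). chi u * ?m m) q) (fst w, (?U w, ?K w - ?l w)))"
    by (rule schwartz_linear_iso[where h = "\<lambda>w. (fst w, (fst (snd w), snd (fst w) - snd (snd w)))"])
      (auto intro!: linearI simp: algebra_simps)
  then have s: "schwartz (\<lambda>w. \<phi> (?X w, ?K w) * (chi (?U w) * ?m (?K w - ?l w)))" by simp
  have m1: "multiplier (\<lambda>w. (\<lambda>z. fourier_char (snd z) (- fst z)) (?X w, ?U w))"
    by (rule multiplier_linear_compose[OF multiplier_fourier_char_pair]) (auto intro!: linearI)
  have m2: "multiplier (\<lambda>w. damped \<sigma> (2 * r) R (?U w, ?K w))"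
    using r_pos R by (intro multiplier_linear_compose[OF test_function_multiplier[OF test_damped]]) (auto intro!: linearI)
  show "schwartz H"
    unfolding H_def[abs_def] using schwartz_mult[OF m1 schwartz_mult[OF m2 s]] by simp
  have chi2: "cutoff (u /\<^sub>R (2 * r)) * chi u = chi u" for u
  proof (cases "norm u \<le> 2 * r")
    case True
    then have "cutoff (u /\<^sub>R (2 * r)) = 1" using r_pos by (intro cutoff_eq_1) (simp add: field_simps)
    then show ?thesis by simp
  next
    case False
    then have "chi u = 0" unfolding chi_def using r_pos by (intro cutoff_eq_0) (simp add: field_simps)
    then show ?thesis by simp
  qed
  show eq: "H ((x, k), (u, l)) = (fourier_char u (- x) * \<phi> (x, k)) * (damped \<sigma> r R (u, k) * ?m (k - l))" for x k u l
  proof -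
    have "H ((x, k), (u, l)) = (cutoff (u /\<^sub>R (2 * r)) * chi u) * ((fourier_char u (- x) * \<phi> (x, k)) *
      ((cutoff (k /\<^sub>R R) * exp (of_real (- pi * \<sigma>\<^sup>2 * (k \<bullet> u)))) * ?m (k - l)))"
      by (simp add: H_def damped_def mult_ac)
    then show ?thesis unfolding chi2 by (simp add: damped_def chi_def mult_ac)
  qed
  fix x k :: "real ^ 'n"
  let ?z = "shifted_point \<sigma> x k"
  have "H ((x, k), y) = \<phi> (x, k) * (\<lambda>(u, l). (chi u * wave ?z u) * ?m (k - l)) y" for y
  proof (cases "R < norm k")
    case True
    then have "\<phi> (x, k) = 0" using \<phi> by (simp add: k_bounded_schwartz_def)
    then show ?thesis by (simp add: H_def)
  next
    case False
    then have "cutoff (k /\<^sub>R R) = 1" using R by (intro cutoff_eq_1) (simp add: field_simps)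
    then show ?thesis unfolding wave_complex_shift
      by (cases y) (simp add: eq damped_def chi_def mult_ac)
  qed
  moreover have "schwartz (\<lambda>(u, l). (chi u * wave ?z u) * ?m (k - l))"
    by (intro schwartz_tensor schwartz_chi_wave schwartz_mollifier_reflect \<rho> \<epsilon>)
  ultimately show "extension ?z (\<lambda>l. ?m (k - l)) * \<phi> (x, k) = Lhat (\<lambda>y. H ((x, k), y))"
    by (simp add: extension_def tempered_cmult[OF tempered_Lhat])
qed

text \<open>
  Integrating over (x, k) under \<open>Lhat\<close> first produces the inverse transform of \<open>\<phi>\<close> and then a convolution
  in k with the mollifier, which is an average of translates of g. A second interchange takes
  this average out of \<open>Lhat\<close>.
\<close>
lemma regularization_integral:
  fixes \<rho> :: "real ^ 'n \<Rightarrow> complex" and \<sigma> :: real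
  assumes \<rho>: "schwartz \<rho>" and \<phi>: "k_bounded_schwartz R \<phi>" and R: "0 < R" and \<epsilon>: "0 < \<epsilon>"
  defines "g \<equiv> \<lambda>z. damped \<sigma> r R z * partial_inv_fourier \<phi> z"
  shows "integrable lborel (\<lambda>(x, k). extension (shifted_point \<sigma> x k) (\<lambda>l. mollifier \<rho> \<epsilon> (k - l)) * \<phi> (x, k))"
    and "(LINT (x, k)|lborel. extension (shifted_point \<sigma> x k) (\<lambda>l. mollifier \<rho> \<epsilon> (k - l)) * \<phi> (x, k)) =
      (LINT v|lborel. Lhat (\<lambda>(u, l). g (u, l + \<epsilon> *\<^sub>R v)) * \<rho> v)"
proof -
  obtain H where H: "schwartz H"
    and EH: "\<And>x k. extension (shifted_point \<sigma> x k) (\<lambda>l. mollifier \<rho> \<epsilon> (k - l)) * \<phi> (x, k) = Lhat (\<lambda>y. H ((x, k), y))"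
    and H_eq: "\<And>x k u l. H ((x, k), (u, l)) = (fourier_char u (- x) * \<phi> (x, k)) * (damped \<sigma> r R (u, k) * mollifier \<rho> \<epsilon> (k - l))"
    using regularization_family[OF \<rho> \<phi> R \<epsilon>, of \<sigma>] by blast
  have E_eq: "(\<lambda>(x, k). extension (shifted_point \<sigma> x k) (\<lambda>l. mollifier \<rho> \<epsilon> (k - l)) * \<phi> (x, k)) = (\<lambda>w. Lhat (\<lambda>y. H (w, y)))"
    using EH by (auto simp: fun_eq_iff)
  show "integrable lborel (\<lambda>(x, k). extension (shifted_point \<sigma> x k) (\<lambda>l. mollifier \<rho> \<epsilon> (k - l)) * \<phi> (x, k))"
    unfolding E_eq by (rule schwartz_integrable[OF schwartz_tempered_slice[OF tempered_Lhat H]])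
  have \<phi>s: "schwartz \<phi>" using \<phi> by (simp add: k_bounded_schwartz_def)
  have g: "schwartz g" unfolding g_def
    by (intro schwartz_mult test_function_multiplier test_damped r_pos R schwartz_partial_inv_fourier \<phi>s)
  define K where "K w = \<rho> (fst w) * g (fst (snd w), snd (snd w) + \<epsilon> *\<^sub>R fst w)" for w
  have "schwartz (\<lambda>w. (\<lambda>(v, z). \<rho> v * g z) (fst w, (fst (snd w), snd (snd w) + \<epsilon> *\<^sub>R fst w)))"
    by (rule schwartz_linear_iso[OF schwartz_tensor[OF \<rho> g], where h = "\<lambda>w. (fst w, (fst (snd w), snd (snd w) - \<epsilon> *\<^sub>R fst w))"])
      (auto intro!: linearI simp: algebra_simps)
  then have K: "schwartz K" by (simp add: K_def[abs_def])
  have gs: "schwartz (\<lambda>z. g (fst z, snd z + \<epsilon> *\<^sub>R v))" for v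
  proof -
    have d: "((\<lambda>z. (fst z, snd z + a)) has_derivative (\<lambda>h. (fst h, snd h))) (at z)" for a :: "real ^ 'n" and z :: "(real ^ 'n) \<times> (real ^ 'n)"
      by (auto intro!: derivative_eq_intros)
    show ?thesis
      by (rule schwartz_compose_affine[OF g d, where h = "\<lambda>z. (fst z, snd z + - (\<epsilon> *\<^sub>R v))", OF d]) simp
  qed
  have inner: "(LINT w|lborel. H (w, y)) = (LINT v|lborel. K (v, y))" for y
  proof -
    obtain u l where y: "y = (u, l)" by (cases y)
    have int: "integrable (lborel \<Otimes>\<^sub>M lborel) (\<lambda>(x, k). H ((x, k), y))"
      using schwartz_integrable[OF schwartz_slice(2)[OF H, of y]] by (simp add: lborel_prod case_prod_beta')
    have "(LINT w|lborel. H (w, y)) = (LINT k|lborel. LINT x|lborel. H ((x, k), y))"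
      using lborel_pair.integral_snd[OF int] by (simp add: lborel_prod case_prod_beta')
    also have "\<dots> = (LINT k|lborel. g (u, k) * mollifier \<rho> \<epsilon> (k - l))"
    proof (rule Bochner_Integration.integral_cong[OF refl])
      fix k
      have "partial_inv_fourier \<phi> (u, k) = (LINT x|lborel. fourier_char u (- x) * \<phi> (x, k))"
        by (simp add: partial_inv_fourier_def inv_fourier_def fourier_char_neg)
      then show "(LINT x|lborel. H ((x, k), y)) = g (u, k) * mollifier \<rho> \<epsilon> (k - l)"
        by (simp add: y H_eq g_def)
    qed
    also have "\<dots> = (LINT v|lborel. K (v, y))"
      using integral_mollifier[OF \<rho> schwartz_slice(1)[OF g] \<epsilon>] by (simp add: K_def y mult.commute)
    finally show ?thesis .
  qed
  have "(LINT w|lborel. Lhat (\<lambda>y. H (w, y))) = Lhat (\<lambda>y. LINT v|lborel. K (v, y))"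
    using tempered_integral[OF tempered_Lhat H] by (simp add: inner)
  also have "\<dots> = (LINT v|lborel. Lhat (\<lambda>y. K (v, y)))" by (rule tempered_integral[OF tempered_Lhat K])
  also have "\<dots> = (LINT v|lborel. Lhat (\<lambda>(u, l). g (u, l + \<epsilon> *\<^sub>R v)) * \<rho> v)"
    using tempered_cmult[OF tempered_Lhat gs] by (simp add: K_def case_prod_beta' mult.commute)
  finally show "(LINT (x, k)|lborel. extension (shifted_point \<sigma> x k) (\<lambda>l. mollifier \<rho> \<epsilon> (k - l)) * \<phi> (x, k)) =
      (LINT v|lborel. Lhat (\<lambda>(u, l). g (u, l + \<epsilon> *\<^sub>R v)) * \<rho> v)"
    unfolding E_eq .
qed

text \<open>
  \<open>Lhat\<close> of the translate of g by a is a continuous function \<open>t a\<close>, so its average over \<open>a = \<epsilon> v\<close> tends to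
  \<open>t 0\<close>. The cutoff in a makes t a Schwartz function and is 1 at all translations that occur for small \<open>\<epsilon>\<close>.
\<close>
lemma regularization_tendsto:
  fixes \<rho> :: "real ^ 'n \<Rightarrow> complex"
  assumes \<rho>: "test_function \<rho>" and \<rho>1: "(LINT v|lborel. \<rho> v) = 1" and \<phi>: "k_bounded_schwartz R \<phi>" and R: "0 < R"
  shows "((\<lambda>\<epsilon>. LINT (x, k)|lborel. extension (shifted_point \<sigma> x k) (\<lambda>l. mollifier \<rho> \<epsilon> (k - l)) * \<phi> (x, k))
    \<longlongrightarrow> shifted_symbol \<sigma> \<phi>) (at_right 0)"
proof -
  define g where "g = (\<lambda>z. damped \<sigma> r R z * partial_inv_fourier \<phi> z)"
  have \<rho>s: "schwartz \<rho>" by (rule test_function_schwartz[OF \<rho>])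
  have \<phi>s: "schwartz \<phi>" using \<phi> by (simp add: k_bounded_schwartz_def)
  have g: "schwartz g" unfolding g_def
    by (intro schwartz_mult test_function_multiplier test_damped r_pos R schwartz_partial_inv_fourier \<phi>s)
  define A where "A w = cutoff (fst w) * g (fst (snd w), snd (snd w) + fst w)" for w
  have "schwartz (\<lambda>w. (\<lambda>(a, z). cutoff a * g z) (fst w, (fst (snd w), snd (snd w) + fst w)))"
    by (rule schwartz_linear_iso[OF schwartz_tensor[OF schwartz_cutoff g], where h = "\<lambda>w. (fst w, (fst (snd w), snd (snd w) - fst w))"])
      (auto intro!: linearI simp: algebra_simps)
  then have A: "schwartz A" by (simp add: A_def[abs_def])
  define t where "t a = Lhat (\<lambda>y. A (a, y))" for a
  have t: "schwartz t" unfolding t_def[abs_def] by (rule schwartz_tempered_slice[OF tempered_Lhat A])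
  have t_eq: "t a = Lhat (\<lambda>(u, l). g (u, l + a))" if "norm a \<le> 1" for a
    using that by (simp add: t_def A_def cutoff_eq_1 case_prod_beta')
  have t0: "t 0 = shifted_symbol \<sigma> \<phi>"
    using t_eq[of 0] shifted_symbol_eq[OF \<phi> R] by (simp add: g_def case_prod_beta')
  have "bounded (fun_support \<rho>)" using \<rho> by (simp add: test_function_def compact_imp_bounded)
  then obtain V where V: "0 < V" "\<And>v. v \<in> fun_support \<rho> \<Longrightarrow> norm v \<le> V"
    by (meson bounded_pos)
  have "((\<lambda>\<epsilon>. LINT v|lborel. t (\<epsilon> *\<^sub>R v) * \<rho> v) \<longlongrightarrow> t 0 * 1) (at_right 0)"
    using tendsto_dilation_at_right[OF t \<rho>s] by (simp add: \<rho>1)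
  moreover have "\<forall>\<^sub>F \<epsilon> in at_right 0. (LINT v|lborel. t (\<epsilon> *\<^sub>R v) * \<rho> v) =
    (LINT (x, k)|lborel. extension (shifted_point \<sigma> x k) (\<lambda>l. mollifier \<rho> \<epsilon> (k - l)) * \<phi> (x, k))"
  proof (rule eventually_at_rightI[of 0 "1 / V"])
    fix \<epsilon> assume "\<epsilon> \<in> {0<..<1 / V}"
    then have \<epsilon>: "0 < \<epsilon>" "\<epsilon> * V \<le> 1" using V(1) by (auto simp: field_simps)
    have eq: "t (\<epsilon> *\<^sub>R v) * \<rho> v = Lhat (\<lambda>(u, l). g (u, l + \<epsilon> *\<^sub>R v)) * \<rho> v" for v
    proof (cases "v \<in> fun_support \<rho>")
      case True
      then have "\<epsilon> * norm v \<le> \<epsilon> * V" using V(2) \<epsilon>(1) by (intro mult_left_mono) auto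
      then have "\<epsilon> * norm v \<le> 1" using \<epsilon>(2) by linarith
      then have "norm (\<epsilon> *\<^sub>R v) \<le> 1" using \<epsilon>(1) by simp
      then show ?thesis by (simp add: t_eq)
    qed (simp add: zero_outside_fun_support)
    show "(LINT v|lborel. t (\<epsilon> *\<^sub>R v) * \<rho> v) =
      (LINT (x, k)|lborel. extension (shifted_point \<sigma> x k) (\<lambda>l. mollifier \<rho> \<epsilon> (k - l)) * \<phi> (x, k))"
      unfolding regularization_integral(2)[OF \<rho>s \<phi> R \<epsilon>(1)] eq by (simp only: g_def)
  qed (use V(1) in simp)
  ultimately show ?thesis unfolding t0 mult_1_right by (rule Lim_transform_eventually)
qed

theorem symbol_of_extension_at_shifted_symbol:
  assumes E: "entire_extension L E"
  shows "symbol_of_extension_at E (shifted_point \<sigma>) (shifted_symbol \<sigma>)"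
  unfolding symbol_of_extension_at_def
proof (intro conjI symbol_distribution_shifted_symbol allI impI)
  fix \<rho> :: "real ^ 'n \<Rightarrow> complex" and \<phi> :: "(real ^ 'n) \<times> (real ^ 'n) \<Rightarrow> complex"
  assume \<rho>: "test_function \<rho>" "(LINT v|lborel. \<rho> v) = 1" and "symbol_test \<phi>"
  then obtain R where R: "0 < R" "k_bounded_schwartz R \<phi>" by (meson symbol_test_bound)
  have \<rho>s: "schwartz \<rho>" by (rule test_function_schwartz[OF \<rho>(1)])
  have E_eq: "E z (\<lambda>l. mollifier \<rho> \<epsilon> (k - l)) = extension z (\<lambda>l. mollifier \<rho> \<epsilon> (k - l))" if "0 < \<epsilon>" for z k \<epsilon>
    by (rule entire_extension_unique[OF E extension_is_entire_extension schwartz_mollifier_reflect[OF \<rho>s that]])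
  show "integrable lborel (\<lambda>(x, k). E (shifted_point \<sigma> x k) (\<lambda>l. mollifier \<rho> \<epsilon> (k - l)) * \<phi> (x, k))"
    if "0 < \<epsilon>" for \<epsilon>
    unfolding E_eq[OF that] by (rule regularization_integral(1)[OF \<rho>s R(2,1) that])
  have "\<forall>\<^sub>F \<epsilon> in at_right 0.
    (LINT (x, k)|lborel. extension (shifted_point \<sigma> x k) (\<lambda>l. mollifier \<rho> \<epsilon> (k - l)) * \<phi> (x, k)) =
    (LINT (x, k)|lborel. E (shifted_point \<sigma> x k) (\<lambda>l. mollifier \<rho> \<epsilon> (k - l)) * \<phi> (x, k))"
    by (rule eventually_at_rightI[of 0 1]) (simp_all add: E_eq)
  with regularization_tendsto[OF \<rho> R(2,1)]
  show "((\<lambda>\<epsilon>. LINT (x, k)|lborel. E (shifted_point \<sigma> x k) (\<lambda>l. mollifier \<rho> \<epsilon> (k - l)) * \<phi> (x, k))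
    \<longlongrightarrow> shifted_symbol \<sigma> \<phi>) (at_right 0)"
    by (rule Lim_transform_eventually)
qed

end

lemma symbol_of_extension_at_unique:
  assumes A: "symbol_of_extension_at E \<zeta> A" and B: "symbol_of_extension_at E \<zeta> B" and \<phi>: "symbol_test \<phi>"
  shows "A \<phi> = B \<phi>"
proof -
  define c where "c = (LINT v|lborel. cutoff (v :: real ^ 'a))"
  define \<rho> where "\<rho> v = inverse c * cutoff v" for v :: "real ^ 'a"
  have c: "c \<noteq> 0" unfolding c_def by (rule integral_cutoff_nonzero)
  have \<rho>: "test_function \<rho>" unfolding \<rho>_def[abs_def]
    by (rule test_function_mult[OF smooth_const test_function_cutoff])
  have "(LINT v|lborel. \<rho> v) = 1" using c by (simp add: \<rho>_def c_def)
  with A B \<rho> \<phi> show ?thesis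
    unfolding symbol_of_extension_at_def by (meson tendsto_unique trivial_limit_at_right_real)
qed

section \<open>The intertwining relation\<close>

lemma gauss_mult_eq: "gauss_mult \<sigma> = gaussian (pi / 2 * \<sigma>\<^sup>2)"
  by (simp add: gauss_mult_def gaussian_def fun_eq_iff dot_square_norm)

lemma fourier_add:
  fixes f g :: "'a::euclidean_space \<Rightarrow> complex"
  assumes "schwartz f" "schwartz g" shows "fourier (\<lambda>x. f x + g x) = (\<lambda>x. fourier f x + fourier g x)"
proof
  fix x
  have "integrable lborel (\<lambda>u. fourier_char u x * h u)" if "schwartz h" for h :: "'a \<Rightarrow> complex"
    by (rule integrable_char_mult[OF that]) (simp_all add: fourier_char_measurable2)
  then show "fourier (\<lambda>x. f x + g x) x = fourier f x + fourier g x"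
    unfolding fourier_alt using assms by (simp add: distrib_left)
qed

text \<open>
  Additivity is visible after a partial Fourier transform, where the kernel is a product.
\<close>
lemma weyl_kernel_add:
  fixes f :: "real ^ 'n \<Rightarrow> complex"
  assumes f: "schwartz f" and \<phi>: "schwartz \<phi>" and \<psi>: "schwartz \<psi>"
  shows "weyl_kernel f (\<lambda>x. \<phi> x + \<psi> x) = (\<lambda>z. weyl_kernel f \<phi> z + weyl_kernel f \<psi> z)"
proof -
  have s: "schwartz (weyl_kernel f h)" if "schwartz h" for h
    by (rule schwartz_cont_schwartz[OF schwartz_cont_weyl_kernel[OF f] that])
  have p: "partial_inv_fourier (weyl_kernel f (\<lambda>x. \<phi> x + \<psi> x)) = partial_inv_fourier (\<lambda>z. weyl_kernel f \<phi> z + weyl_kernel f \<psi> z)"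
  proof
    fix z :: "(real ^ 'n) \<times> (real ^ 'n)"
    obtain u k where z: "z = (u, k)" by (cases z)
    show "partial_inv_fourier (weyl_kernel f (\<lambda>x. \<phi> x + \<psi> x)) z = partial_inv_fourier (\<lambda>z. weyl_kernel f \<phi> z + weyl_kernel f \<psi> z) z"
      by (simp add: z partial_inv_fourier_add s \<phi> \<psi> partial_inv_fourier_weyl_kernel f schwartz_add inv_fourier_eq
          fourier_add distrib_left)
  qed
  show ?thesis
    using arg_cong[OF p, of partial_fourier] s \<phi> \<psi>
    by (simp add: partial_fourier_partial_inv_fourier schwartz_add)
qed

lemma weyl_kernel_cmult: "weyl_kernel f (\<lambda>x. c * \<phi> x) = (\<lambda>z. c * weyl_kernel f \<phi> z)"
  unfolding weyl_kernel_def by (auto simp: fun_eq_iff mult.left_commute[of _ c])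

text \<open>
  The transpose of the smoothing operator.
\<close>
definition dual_smoothing :: "real \<Rightarrow> ('a::euclidean_space \<Rightarrow> complex) \<Rightarrow> 'a \<Rightarrow> complex" where
  "dual_smoothing \<sigma> \<phi> = fourier (\<lambda>k. gauss_mult \<sigma> k * inv_fourier \<phi> k)"

lemma smoothing_dist_eq: "smoothing_dist \<sigma> S \<phi> = S (dual_smoothing \<sigma> \<phi>)"
  by (simp add: smoothing_dist_def inv_fourier_dist_def fourier_dist_def dual_smoothing_def)

lemma schwartz_cont_gauss_mult: "0 < \<sigma> \<Longrightarrow> schwartz_cont (\<lambda>(\<phi>::'a::euclidean_space \<Rightarrow> complex) k. gauss_mult \<sigma> k * \<phi> k)"
  unfolding gauss_mult_eq by (intro schwartz_cont_mult schwartz_multiplier schwartz_gaussian) simp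

lemma schwartz_cont_dual_smoothing: "0 < \<sigma> \<Longrightarrow> schwartz_cont (dual_smoothing \<sigma>)"
  unfolding dual_smoothing_def[abs_def]
  by (rule schwartz_cont_compose[OF schwartz_cont_fourier schwartz_cont_compose[OF schwartz_cont_gauss_mult schwartz_cont_inv_fourier]])

lemma dual_smoothing_add:
  fixes \<phi> \<psi> :: "'a::euclidean_space \<Rightarrow> complex"
  assumes "0 < \<sigma>" "schwartz \<phi>" "schwartz \<psi>"
  shows "dual_smoothing \<sigma> (\<lambda>x. \<phi> x + \<psi> x) = (\<lambda>x. dual_smoothing \<sigma> \<phi> x + dual_smoothing \<sigma> \<psi> x)"
proof -
  have s: "schwartz (\<lambda>k. gauss_mult \<sigma> k * inv_fourier h k)" if "schwartz h" for h :: "'a \<Rightarrow> complex"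
    by (rule schwartz_cont_schwartz[OF schwartz_cont_gauss_mult[OF assms(1)] schwartz_inv_fourier[OF that]])
  show ?thesis unfolding dual_smoothing_def
    by (subst fourier_add[OF s[OF assms(2)] s[OF assms(3)], symmetric])
      (simp add: inv_fourier_eq fourier_add[OF assms(2,3)] distrib_left)
qed

lemma dual_smoothing_cmult: "dual_smoothing \<sigma> (\<lambda>x. c * \<phi> x) = (\<lambda>x. c * dual_smoothing \<sigma> \<phi> x)"
  unfolding dual_smoothing_def inv_fourier_eq fourier_cmult
  by (simp add: mult.left_commute[of _ c] fourier_cmult)

lemma tempered_smoothed_weyl_op:
  fixes L :: "((real ^ 'n) \<times> (real ^ 'n) \<Rightarrow> complex) \<Rightarrow> complex"
  assumes \<sigma>: "0 < \<sigma>" and L: "tempered L" and f: "schwartz f"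
  shows "tempered (smoothing_dist \<sigma> (weyl_op L f))"
proof -
  have "tempered (\<lambda>\<phi>. L (weyl_kernel f \<phi>))"
    by (rule tempered_compose[OF L schwartz_cont_weyl_kernel[OF f]]) (simp_all add: weyl_kernel_add f weyl_kernel_cmult)
  then have "tempered (\<lambda>\<phi>. L (weyl_kernel f (dual_smoothing \<sigma> \<phi>)))"
    by (rule tempered_compose[OF _ schwartz_cont_dual_smoothing[OF \<sigma>]]) (simp_all add: dual_smoothing_add \<sigma> dual_smoothing_cmult)
  then show ?thesis by (simp add: smoothing_dist_eq[abs_def] weyl_op_def)
qed

text \<open>
  This is the identity \<open>|k - u/2|\<^sup>2 + 2 k \<bullet> u = |k + u/2|\<^sup>2\<close>.
\<close>
lemma gauss_mult_shift:
  fixes k u :: "'a::euclidean_space"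
  shows "exp (of_real (- pi * \<sigma>\<^sup>2 * (k \<bullet> u))) * gauss_mult \<sigma> (k - (1/2) *\<^sub>R u) = gauss_mult \<sigma> (k + (1/2) *\<^sub>R u)"
proof -
  have "(norm (k + (1/2) *\<^sub>R u))\<^sup>2 = (norm (k - (1/2) *\<^sub>R u))\<^sup>2 + 2 * (k \<bullet> u)"
    by (simp add: power2_norm_eq_inner inner_add_left inner_add_right inner_diff_left inner_diff_right inner_commute)
  then have e: "- pi * \<sigma>\<^sup>2 * (k \<bullet> u) + - (pi / 2) * \<sigma>\<^sup>2 * (norm (k - (1/2) *\<^sub>R u))\<^sup>2 =
      - (pi / 2) * \<sigma>\<^sup>2 * (norm (k + (1/2) *\<^sub>R u))\<^sup>2"
    by (simp add: algebra_simps)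
  have "exp (complex_of_real (- pi * \<sigma>\<^sup>2 * (k \<bullet> u))) * gauss_mult \<sigma> (k - (1/2) *\<^sub>R u) =
      of_real (exp (- pi * \<sigma>\<^sup>2 * (k \<bullet> u)) * exp (- (pi / 2) * \<sigma>\<^sup>2 * (norm (k - (1/2) *\<^sub>R u))\<^sup>2))"
    unfolding of_real_mult[of "exp _"] exp_of_real[symmetric] gauss_mult_def by (rule refl)
  also have "\<dots> = gauss_mult \<sigma> (k + (1/2) *\<^sub>R u)"
    by (simp only: exp_add[symmetric] e gauss_mult_def)
  finally show ?thesis .
qed

text \<open>
  The exponential weight moves the Gaussian factor from f to \<open>\<phi>\<close>; this is why the symbol has to be
  evaluated at the shifted point.
\<close>
lemma weyl_kernel_smoothing:
  fixes f \<phi> :: "real ^ 'n \<Rightarrow> complex"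
  assumes \<sigma>: "0 < \<sigma>" and f: "schwartz f" and \<phi>: "schwartz \<phi>"
  shows "exp (of_real (- pi * \<sigma>\<^sup>2 * (k \<bullet> u))) * partial_inv_fourier (weyl_kernel (smoothing \<sigma> f) \<phi>) (u, k) =
    partial_inv_fourier (weyl_kernel f (dual_smoothing \<sigma> \<phi>)) (u, k)"
proof -
  have s1: "schwartz (\<lambda>k. gauss_mult \<sigma> k * fourier f k)"
    by (rule schwartz_cont_schwartz[OF schwartz_cont_gauss_mult[OF \<sigma>] schwartz_fourier[OF f]])
  have s2: "schwartz (\<lambda>k. gauss_mult \<sigma> k * inv_fourier \<phi> k)"
    by (rule schwartz_cont_schwartz[OF schwartz_cont_gauss_mult[OF \<sigma>] schwartz_inv_fourier[OF \<phi>]])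
  have 1: "partial_inv_fourier (weyl_kernel (smoothing \<sigma> f) \<phi>) (u, k) =
     (gauss_mult \<sigma> (k - (1/2) *\<^sub>R u) * fourier f (k - (1/2) *\<^sub>R u)) * inv_fourier \<phi> (k + (1/2) *\<^sub>R u)"
    unfolding smoothing_def
    by (simp only: partial_inv_fourier_weyl_kernel[OF schwartz_inv_fourier[OF s1] \<phi>] fourier_inv_fourier[OF s1])
  have 2: "partial_inv_fourier (weyl_kernel f (dual_smoothing \<sigma> \<phi>)) (u, k) =
     fourier f (k - (1/2) *\<^sub>R u) * (gauss_mult \<sigma> (k + (1/2) *\<^sub>R u) * inv_fourier \<phi> (k + (1/2) *\<^sub>R u))"
    unfolding dual_smoothing_def
    by (simp only: partial_inv_fourier_weyl_kernel[OF f schwartz_fourier[OF s2]] inv_fourier_fourier[OF s2])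
  show ?thesis unfolding 1 2 gauss_mult_shift[symmetric, of \<sigma> k u] by (simp only: mult_ac)
qed

context band_limited
begin

text \<open>
  By \<open>weyl_kernel_smoothing\<close> the pairing with the cut off kernel is \<open>Lhat\<close> of \<open>\<eta> (k / R)\<close> times the
  transform V of a Schwartz function, from which \<open>chi\<close> can be dropped; it converges to \<open>Lhat V\<close>.
\<close>
theorem weyl_maps_shifted_symbol:
  assumes \<sigma>: "0 < \<sigma>" and f: "schwartz f" and A: "\<And>\<phi>. symbol_test \<phi> \<Longrightarrow> A \<phi> = shifted_symbol \<sigma> \<phi>"
  shows "weyl_maps A (smoothing \<sigma> f) (smoothing_dist \<sigma> (weyl_op L f))"
  unfolding weyl_maps_def
proof (intro conjI allI impI)
  show "tempered (smoothing_dist \<sigma> (weyl_op L f))" by (rule tempered_smoothed_weyl_op[OF \<sigma> tempered_L f])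
  fix \<eta> \<phi> :: "real ^ 'n \<Rightarrow> complex"
  assume \<eta>: "test_function \<eta>" "\<forall>\<^sub>F k in nhds 0. \<eta> k = 1" and \<phi>: "schwartz \<phi>"
  let ?w = "weyl_kernel (smoothing \<sigma> f) \<phi>"
  let ?v = "weyl_kernel f (dual_smoothing \<sigma> \<phi>)"
  let ?V = "partial_inv_fourier ?v"
  have "schwartz (smoothing \<sigma> f)" unfolding smoothing_def
    by (intro schwartz_inv_fourier schwartz_cont_schwartz[OF schwartz_cont_gauss_mult[OF \<sigma>]] schwartz_fourier f)
  then have w: "schwartz ?w" by (intro schwartz_cont_schwartz[OF schwartz_cont_weyl_kernel] \<phi>)
  have v: "schwartz ?v"
    by (intro schwartz_cont_schwartz[OF schwartz_cont_weyl_kernel[OF f]] schwartz_cont_schwartz[OF schwartz_cont_dual_smoothing[OF \<sigma>]] \<phi>)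
  have V: "schwartz ?V" by (rule schwartz_partial_inv_fourier[OF v])
  have \<eta>m: "multiplier (\<lambda>z::(real ^ 'n) \<times> (real ^ 'n). \<eta> (snd z /\<^sub>R R))" for R
    by (rule multiplier_linear_compose[OF test_function_multiplier[OF \<eta>(1)]]) (auto intro!: linearI simp: scaleR_add_right)
  have "bounded (fun_support \<eta>)" using \<eta>(1) by (simp add: test_function_def compact_imp_bounded)
  then obtain B where B: "0 < B" "\<And>k. k \<in> fun_support \<eta> \<Longrightarrow> norm k \<le> B" by (meson bounded_pos)
  have "A (\<lambda>(x, k). \<eta> (k /\<^sub>R R) * ?w (x, k)) = Lhat (\<lambda>z. \<eta> (snd z /\<^sub>R R) * ?V z)" if R: "0 < R" for R
  proof -
    let ?\<theta> = "\<lambda>z. \<eta> (snd z /\<^sub>R R) * ?w z"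
    have \<theta>: "schwartz ?\<theta>" by (rule schwartz_mult[OF \<eta>m w])
    have "?\<theta> (x, k) = 0" if "B * R < norm k" for x k
    proof -
      have "norm (k /\<^sub>R R) = norm k / R" using R by (simp add: divide_inverse mult.commute)
      then have "B < norm (k /\<^sub>R R)" using that R by (simp only: pos_less_divide_eq)
      then have "k /\<^sub>R R \<notin> fun_support \<eta>" using B(2)[of "k /\<^sub>R R"] by linarith
      then show ?thesis by (simp add: zero_outside_fun_support)
    qed
    then have "symbol_test ?\<theta>" unfolding symbol_test_def k_bounded_schwartz_def using \<theta> by blast
    then have "A ?\<theta> = Lhat (\<lambda>z. (chi (fst z) * exp (of_real (- pi * \<sigma>\<^sup>2 * (snd z \<bullet> fst z)))) * partial_inv_fourier ?\<theta> z)"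
      by (simp only: A shifted_symbol_def)
    also have "(\<lambda>z. (chi (fst z) * exp (of_real (- pi * \<sigma>\<^sup>2 * (snd z \<bullet> fst z)))) * partial_inv_fourier ?\<theta> z) =
        (\<lambda>z. chi (fst z) * (\<eta> (snd z /\<^sub>R R) * ?V z))"
    proof
      fix z :: "(real ^ 'n) \<times> (real ^ 'n)"
      obtain u k where z: "z = (u, k)" by (cases z)
      have "partial_inv_fourier ?\<theta> = (\<lambda>z. \<eta> (snd z /\<^sub>R R) * partial_inv_fourier ?w z)"
        by (rule partial_inv_fourier_snd_mult[where a = "\<lambda>k. \<eta> (k /\<^sub>R R)"])
      then show "(chi (fst z) * exp (of_real (- pi * \<sigma>\<^sup>2 * (snd z \<bullet> fst z)))) * partial_inv_fourier ?\<theta> z =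
        chi (fst z) * (\<eta> (snd z /\<^sub>R R) * ?V z)"
        using weyl_kernel_smoothing[OF \<sigma> f \<phi>, of k u, symmetric] by (simp only: z fst_conv snd_conv mult_ac)
    qed
    also have "Lhat \<dots> = Lhat (\<lambda>z. \<eta> (snd z /\<^sub>R R) * ?V z)" by (rule Lhat_chi[OF schwartz_mult[OF \<eta>m V]])
    finally show ?thesis by (simp add: case_prod_beta')
  qed
  then have "\<forall>\<^sub>F R in at_top. Lhat (\<lambda>z. \<eta> (snd z /\<^sub>R R) * ?V z) = A (\<lambda>(x, k). \<eta> (k /\<^sub>R R) * ?w (x, k))"
    by (intro eventually_mono[OF eventually_gt_at_top[of 0]]) simp
  moreover have "((\<lambda>R. Lhat (\<lambda>z. \<eta> (snd z /\<^sub>R R) * ?V z)) \<longlongrightarrow> Lhat ?V) at_top"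
    by (rule tempered_cutoff_tendsto[OF tempered_Lhat \<eta> linear_snd V])
  moreover have "Lhat ?V = smoothing_dist \<sigma> (weyl_op L f) \<phi>"
    by (simp add: Lhat_inverse[OF v] smoothing_dist_eq weyl_op_def)
  ultimately show "((\<lambda>R. A (\<lambda>(x, k). \<eta> (k /\<^sub>R R) * ?w (x, k))) \<longlongrightarrow> smoothing_dist \<sigma> (weyl_op L f) \<phi>) at_top"
    using Lim_transform_eventually by fastforce
qed

end

theorem theorem1p2:
  fixes L :: "((real ^ 'n) \<times> (real ^ 'n) \<Rightarrow> complex) \<Rightarrow> complex"
    and \<sigma> M :: real
  assumes "\<sigma> > 0"
    and "tempered L"
    and "M > 0"
    and "dist_support (fourier1_dist L) \<subseteq> {u. \<forall>i. u $ i \<in> {-M..M}} \<times> UNIV"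
  shows "(\<exists>E. entire_extension L E) \<and>
    (\<forall>E. entire_extension L E \<longrightarrow>
      (let \<zeta> = (\<lambda>x k. cvec x + (\<i> * of_real (\<sigma>\<^sup>2) / 2) *s cvec k) in
       (\<exists>Lt. symbol_of_extension_at E \<zeta> Lt) \<and>
       (\<forall>Lt. symbol_of_extension_at E \<zeta> Lt \<longrightarrow>
          (\<forall>f. schwartz f \<longrightarrow>
             weyl_maps Lt (smoothing \<sigma> f) (smoothing_dist \<sigma> (weyl_op L f))))))"
proof -
  \<comment> \<open>The cube lies in the open ball of this radius, because the norm is at most the sum of the coordinates.\<close>
  let ?r = "CARD('n) * M + 1"
  have "norm u < ?r" if "\<forall>i. u $ i \<in> {-M..M}" for u :: "real ^ 'n"
  proof -
    have "norm u \<le> (\<Sum>i\<in>UNIV. \<bar>u $ i\<bar>)" by (rule norm_le_l1_cart)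
    also have "\<dots> \<le> (\<Sum>i\<in>(UNIV::'n set). M)" using that by (intro sum_mono) (auto simp: abs_le_iff minus_le_iff)
    finally show ?thesis by simp
  qed
  then have "dist_support (fourier1_dist L) \<subseteq> {u. norm u < ?r} \<times> UNIV" using assms(4) by blast
  moreover have "0 < ?r" using assms(3) by (simp add: add_nonneg_pos)
  ultimately interpret band_limited L ?r using assms(2) by unfold_locales auto
  show ?thesis unfolding Let_def
  proof (intro conjI allI impI)
    show "\<exists>E. entire_extension L E" using extension_is_entire_extension by blast
    fix E assume E: "entire_extension L E"
    let ?\<zeta> = "\<lambda>x k. cvec x + (\<i> * of_real (\<sigma>\<^sup>2) / 2) *s cvec k"
    have sym: "symbol_of_extension_at E ?\<zeta> (shifted_symbol \<sigma>)" by (rule symbol_of_extension_at_shifted_symbol[OF E])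
    then show "\<exists>Lt. symbol_of_extension_at E ?\<zeta> Lt" by blast
    fix A and f :: "real ^ 'n \<Rightarrow> complex" assume A: "symbol_of_extension_at E ?\<zeta> A" and f: "schwartz f"
    show "weyl_maps A (smoothing \<sigma> f) (smoothing_dist \<sigma> (weyl_op L f))"
      by (rule weyl_maps_shifted_symbol[OF assms(1) f symbol_of_extension_at_unique[OF A sym]])
  qed
qed

end
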